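(* Let $I$ be an infinite set of positive integers and for each $n \in I$ let $H_n \le S_n$ be a primitive subgroup with $H_n \neq A_n$ and $H_n \neq S_n$. Then the family $(S_n, H_n)_{n \in I}$ is indistinguishable.
   Context: For a finite group $G$, let $\mathrm{Irr}(G)$ be its set of complex irreducible characters and $d_\chi=\chi(e)$. For $H \le G$ let $D_H = \frac{1}{|G|}\sum_{\chi \in \mathrm{Irr}(G)} d_\chi \big|\sum_{h \in H, h \neq e}\chi(h)\big|$ (the $L_1$ distance between the distributions $P_H(\chi)=\frac{d_\chi}{|G|}\sum_{h\in H}\chi(h)$ and $P_{\{e\}}$ on $\mathrm{Irr}(G)$ produced by weak quantum Fourier sampling). A family $(G_i,H_i)_{i \in I}$ with $H_i \le G_i$, $I$ an infinite set of positive integers and $|G_i| \to \infty$, is called distinguishable if there is a constant $c>0$ such that $D_{H_i} \ge (\log|G_i|)^{-c}$ for all sufficiently large $i \in I$, and indistinguishable otherwise. $S_n$ and $A_n$ are the symmetric and alternating groups on $\{1,\ldots,n\}$. A subgroup $H \le S_n$ is primitive if it acts transitively on $\{1,\ldots,n\}$ and preserves no nontrivial partition of $\{1,\ldots,n\}$ (i.e. no partition other than the one into singletons and the one with a single block). *)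

theory Defs
  imports "Jordan_Normal_Form.Matrix" "HOL-Algebra.Sym_Groups" "HOL-Library.Disjoint_Sets"
begin

definition mat_trace :: "nat \<Rightarrow> complex mat \<Rightarrow> complex" where
  "mat_trace d A = (\<Sum>i<d. A $$ (i, i))"

definition is_rep :: "('a, 'b) monoid_scheme \<Rightarrow> nat \<Rightarrow> ('a \<Rightarrow> complex mat) \<Rightarrow> bool" where
  "is_rep G d \<rho> \<longleftrightarrow>
     (\<forall>g \<in> carrier G. \<rho> g \<in> carrier_mat d d) \<and>
     \<rho> \<one>\<^bsub>G\<^esub> = 1\<^sub>m d \<and>
     (\<forall>g \<in> carrier G. \<forall>h \<in> carrier G. \<rho> (g \<otimes>\<^bsub>G\<^esub> h) = \<rho> g * \<rho> h)"

definition is_subspace :: "nat \<Rightarrow> complex vec set \<Rightarrow> bool" where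
  "is_subspace d W \<longleftrightarrow> W \<subseteq> carrier_vec d \<and> 0\<^sub>v d \<in> W \<and>
     (\<forall>v \<in> W. \<forall>w \<in> W. v + w \<in> W) \<and> (\<forall>c. \<forall>v \<in> W. c \<cdot>\<^sub>v v \<in> W)"

definition is_irred_rep :: "('a, 'b) monoid_scheme \<Rightarrow> nat \<Rightarrow> ('a \<Rightarrow> complex mat) \<Rightarrow> bool" where
  "is_irred_rep G d \<rho> \<longleftrightarrow> is_rep G d \<rho> \<and> d > 0 \<and>
     (\<forall>W. is_subspace d W \<and> (\<forall>g \<in> carrier G. \<forall>w \<in> W. \<rho> g *\<^sub>v w \<in> W)
          \<longrightarrow> W = {0\<^sub>v d} \<or> W = carrier_vec d)"

definition Irr :: "('a, 'b) monoid_scheme \<Rightarrow> ('a \<Rightarrow> complex) set" where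
  "Irr G = {\<chi>. \<exists>d \<rho>. is_irred_rep G d \<rho> \<and>
             \<chi> = (\<lambda>g. if g \<in> carrier G then mat_trace d (\<rho> g) else 0)}"

definition D_dist :: "('a, 'b) monoid_scheme \<Rightarrow> 'a set \<Rightarrow> real" where
  "D_dist G H = (1 / real (card (carrier G))) *
     (\<Sum>\<chi> \<in> Irr G. Re (\<chi> \<one>\<^bsub>G\<^esub>) * cmod (\<Sum>h \<in> H - {\<one>\<^bsub>G\<^esub>}. \<chi> h))"

definition distinguishable :: "nat set \<Rightarrow> (nat \<Rightarrow> ('a, 'b) monoid_scheme) \<Rightarrow> (nat \<Rightarrow> 'a set) \<Rightarrow> bool" where
  "distinguishable I G H \<longleftrightarrow>
     (\<exists>c > 0. \<exists>N. \<forall>i \<in> I. i \<ge> N \<longrightarrow> D_dist (G i) (H i) \<ge> ln (real (card (carrier (G i)))) powr (- c))"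

definition indistinguishable :: "nat set \<Rightarrow> (nat \<Rightarrow> ('a, 'b) monoid_scheme) \<Rightarrow> (nat \<Rightarrow> 'a set) \<Rightarrow> bool" where
  "indistinguishable I G H \<longleftrightarrow> \<not> distinguishable I G H"

definition primitive :: "nat \<Rightarrow> (nat \<Rightarrow> nat) set \<Rightarrow> bool" where
  "primitive n H \<longleftrightarrow>
     (\<forall>x \<in> {1..n}. \<forall>y \<in> {1..n}. \<exists>h \<in> H. h x = y) \<and>
     (\<forall>P. partition_on {1..n} P \<and> (\<forall>h \<in> H. \<forall>B \<in> P. h ` B \<in> P)
          \<longrightarrow> P = {{x} | x. x \<in> {1..n}} \<or> P = {{1..n}})"

end

theory Submission
  imports Defs "Jordan_Normal_Form.Spectral_Radius" "HOL-Analysis.L2_Norm"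
    "HOL-Real_Asymp.Real_Asymp" "HOL-Computational_Algebra.Squarefree"
begin

text \<open>By Cauchy-Schwarz and the orthogonality of characters, \<open>D\<^sub>H\<close> is at most the sum of
  \<open>|h\<^sup>G|\<close> to the power \<open>-1/2\<close> over the nontrivial \<open>h \<in> H\<close>, and an element of \<open>S\<^sub>n\<close> with support of
  size \<open>k\<close> has at least \<open>\<lceil>k/3\<rceil>!\<close> conjugates. So it suffices that \<open>H\<close> has few elements of each
  support size and none of small support.

  If \<open>H\<close> is primitive but not doubly transitive, any two points lie in different orbits of the stabilizer
  of \<open>w\<close> for more than about \<open>n\<close> to the power \<open>1/4\<close> of the points \<open>w\<close> (a variant of Babai's argument).
  Hence a random list of \<open>o(n)\<close> points is usually a base, and an element of support \<open>k\<close> usually moves only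
  \<open>o(k)\<close> of its entries; this bounds both the number and the support of the elements.

  If \<open>H\<close> is doubly transitive and does not contain \<open>A\<^sub>n\<close>, its minimal degree is at least \<open>n/10\<close> (Bochert's
  commutator argument), so no element has cycles of many different prime lengths. This forces every large orbit
  of a pointwise stabilizer to break up after fixing few further points: otherwise \<open>H\<close> would induce
  all permutations on some fairly large set of points. Iterating gives \<open>o(n)\<close> points
  whose stabilizer has only short orbits, hence the order of \<open>H\<close> is \<open>n\<close> to the power \<open>\<epsilon>n\<close> at most.\<close>

section \<open>Characters and the distinguishing distance\<close>

text \<open>Since \<open>ln (n!)\<close> is polynomial in \<open>n\<close>, distinguishability only
  asks for an inverse power of \<open>n\<close>, so crude bounds suffice if they are
  superpolynomially small. An element of support \<open>k\<close> contributes roughly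
  \<open>k powr (- k / 6)\<close>. Without double transitivity the minimal degree obtained is only
  of order \<open>n powr (1/4)\<close>. A bound on the order of \<open>H\<close> alone is then
  useless against elements of small support; for every \<open>k\<close> there must be at most
  \<open>n powr o(k)\<close> elements of support \<open>k\<close>. This is why the base is a random
  list: the number of entries that an element moves is then proportional to its support, and these
  few moves determine the element. With double transitivity all supports are linear in
  \<open>n\<close>, every term is about \<open>n powr (- n / 60)\<close>, and a bound on the order
  of \<open>H\<close> is enough. The exponents 1/200 and 1/1000 chosen at the end have to fit below
  this 1/60.\<close>

lemma index_mult_mat_sum:
  assumes "A \<in> carrier_mat a b" "B \<in> carrier_mat b c" "i < a" "j < c"
  shows "(A * B) $$ (i, j) = (\<Sum>k<b. A $$ (i, k) * B $$ (k, j))"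
  using assms by (auto simp: scalar_prod_def atLeast0LessThan intro!: sum.cong)

lemma mat_trace_mult_comm:
  assumes "A \<in> carrier_mat d e" "B \<in> carrier_mat e d"
  shows "mat_trace d (A * B) = mat_trace e (B * A)"
proof -
  have "mat_trace d (A * B) = (\<Sum>i<d. \<Sum>k<e. A $$ (i, k) * B $$ (k, i))"
    unfolding mat_trace_def using assms by (intro sum.cong refl index_mult_mat_sum) auto
  also have "\<dots> = (\<Sum>k<e. \<Sum>i<d. B $$ (k, i) * A $$ (i, k))"
    by (subst sum.swap) (simp add: mult.commute)
  also have "\<dots> = mat_trace e (B * A)"
    unfolding mat_trace_def using assms by (intro sum.cong refl index_mult_mat_sum[symmetric]) auto
  finally show ?thesis .
qed

text \<open>\<open>A = T * B * S\<close> and the trace is cyclic. The form with an intertwining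
  equation and formally different dimensions fits the isomorphisms from Schur's lemma.\<close>

lemma mat_trace_conj:
  assumes "A \<in> carrier_mat d d" "T \<in> carrier_mat d e" "S \<in> carrier_mat e d" "T * S = 1\<^sub>m d"
    and "B \<in> carrier_mat e e" "A * T = T * B" "S * T = 1\<^sub>m e"
  shows "mat_trace d A = mat_trace e B"
proof -
  have "A = A * (T * S)" using assms by simp
  also have "\<dots> = T * B * S" using assms by (metis assoc_mult_mat)
  also have "\<dots> = T * (B * S)" using assms by (meson assoc_mult_mat)
  finally have "mat_trace d A = mat_trace d (T * (B * S))" by simp
  also have "\<dots> = mat_trace e (B * S * T)"
    using assms by (intro mat_trace_mult_comm) auto
  also have "B * S * T = B" using assms by (metis assoc_mult_mat right_mult_one_mat)
  finally show ?thesis .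
qed

section \<open>Schur's lemma\<close>

lemma mult_unit_vec_index:
  assumes "A \<in> carrier_mat a b" "i < a" "j < b"
  shows "(A *\<^sub>v unit_vec b j) $ i = (A $$ (i, j) :: complex)"
  using assms by (simp add: row_def)

lemma mat_eq_0_if_mult_vec_0:
  assumes T: "T \<in> carrier_mat d e" and 0: "\<And>v. v \<in> carrier_vec e \<Longrightarrow> T *\<^sub>v v = 0\<^sub>v d"
  shows "T = (0\<^sub>m d e :: complex mat)"
proof (rule eq_matI)
  fix i j assume ij: "i < dim_row (0\<^sub>m d e :: complex mat)" "j < dim_col (0\<^sub>m d e :: complex mat)"
  hence "(T *\<^sub>v unit_vec e j) $ i = 0" using 0[of "unit_vec e j"] by simp
  moreover have "(T *\<^sub>v unit_vec e j) $ i = T $$ (i, j)"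
    using T ij by (simp add: row_def)
  ultimately show "T $$ (i, j) = 0\<^sub>m d e $$ (i, j)" using ij by simp
qed (use T in auto)

lemma smult_one_mult_vec:
  assumes "v \<in> carrier_vec d"
  shows "(c \<cdot>\<^sub>m 1\<^sub>m d) *\<^sub>v v = c \<cdot>\<^sub>v (v :: complex vec)"
proof (rule eq_vecI)
  fix i assume "i < dim_vec (c \<cdot>\<^sub>v v)"
  hence i: "i < d" using assms by simp
  hence "row (c \<cdot>\<^sub>m 1\<^sub>m d) i = c \<cdot>\<^sub>v unit_vec d i" by (intro eq_vecI) auto
  thus "((c \<cdot>\<^sub>m 1\<^sub>m d) *\<^sub>v v) $ i = (c \<cdot>\<^sub>v v) $ i"
    using i assms by simp
qed (use assms in auto)

lemma is_irred_repD:
  assumes "is_irred_rep G d \<rho>"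
  shows "\<And>g. g \<in> carrier G \<Longrightarrow> \<rho> g \<in> carrier_mat d d" "\<rho> \<one>\<^bsub>G\<^esub> = 1\<^sub>m d" "d > 0"
    "\<And>g h. g \<in> carrier G \<Longrightarrow> h \<in> carrier G \<Longrightarrow> \<rho> (g \<otimes>\<^bsub>G\<^esub> h) = \<rho> g * \<rho> h"
    "\<And>W. is_subspace d W \<Longrightarrow> (\<And>g w. g \<in> carrier G \<Longrightarrow> w \<in> W \<Longrightarrow> \<rho> g *\<^sub>v w \<in> W)
          \<Longrightarrow> W = {0\<^sub>v d} \<or> W = carrier_vec d"
  using assms unfolding is_irred_rep_def is_rep_def by blast+

text \<open>The kernel of \<open>T\<close> is invariant under \<open>\<sigma>\<close>, hence zero or
  everything. \<open>\<rho>\<close> is a mere family of matrices, so that it can later be the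
  adjoint of a representation at \<open>inv g\<close>.\<close>

lemma kernel_intertwiner:
  assumes \<sigma>: "is_irred_rep G e \<sigma>" and \<rho>: "\<And>g. g \<in> carrier G \<Longrightarrow> \<rho> g \<in> carrier_mat d d"
    and T: "T \<in> carrier_mat d e"
    and comm: "\<And>g. g \<in> carrier G \<Longrightarrow> \<rho> g * T = T * \<sigma> g"
    and nz: "T \<noteq> 0\<^sub>m d e" and v: "v \<in> carrier_vec e" "T *\<^sub>v v = 0\<^sub>v d"
  shows "v = 0\<^sub>v e"
proof -
  note s = is_irred_repD[OF \<sigma>]
  define W where "W = {v \<in> carrier_vec e. T *\<^sub>v v = 0\<^sub>v d}"
  have "is_subspace e W"
    unfolding is_subspace_def W_def using T
    by (auto simp: mult_add_distrib_mat_vec[of _ d e] mult_mat_vec[of _ d e])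
  moreover have "\<sigma> g *\<^sub>v w \<in> W" if "g \<in> carrier G" "w \<in> W" for g w
  proof -
    have w: "w \<in> carrier_vec e" "T *\<^sub>v w = 0\<^sub>v d" using that by (auto simp: W_def)
    have "T *\<^sub>v (\<sigma> g *\<^sub>v w) = (T * \<sigma> g) *\<^sub>v w"
      using T s(1)[OF that(1)] w by (simp add: assoc_mult_mat_vec)
    also have "\<dots> = \<rho> g *\<^sub>v (T *\<^sub>v w)"
      using T \<rho>[OF that(1)] w(1) by (simp add: comm[OF that(1), symmetric] assoc_mult_mat_vec)
    also have "\<dots> = 0\<^sub>v d" using w(2) \<rho>[OF that(1)] by (intro eq_vecI) (auto simp: scalar_prod_def)
    finally show ?thesis using s(1)[OF that(1)] w by (auto simp: W_def)
  qed
  ultimately have "W = {0\<^sub>v e} \<or> W = carrier_vec e" by (rule s(5))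
  moreover have "W \<noteq> carrier_vec e"
    using mat_eq_0_if_mult_vec_0[OF T] nz unfolding W_def by blast
  ultimately show ?thesis using v by (auto simp: W_def)
qed

text \<open>The kernel is zero by \<open>kernel_intertwiner\<close>; the image \<open>V\<close> is a
  nonzero invariant subspace for the irreducible \<open>\<rho>\<close>, hence everything.\<close>

lemma schur_invertible:
  assumes \<sigma>: "is_irred_rep G e \<sigma>" and \<rho>: "is_irred_rep G d \<rho>"
    and T: "T \<in> carrier_mat d e"
    and comm: "\<And>g. g \<in> carrier G \<Longrightarrow> \<rho> g * T = T * \<sigma> g"
    and nz: "T \<noteq> 0\<^sub>m d e"
  shows "\<exists>S \<in> carrier_mat e d. T * S = 1\<^sub>m d \<and> S * T = 1\<^sub>m e"
proof -
  note s = is_irred_repD[OF \<sigma>] and r = is_irred_repD[OF \<rho>]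
  define V where "V = (\<lambda>v. T *\<^sub>v v) ` carrier_vec e"
  have inj: "v = 0\<^sub>v e" if "v \<in> carrier_vec e" "T *\<^sub>v v = 0\<^sub>v d" for v
    using kernel_intertwiner[OF \<sigma> r(1) T comm nz] that by blast
  have "is_subspace d V"
    unfolding is_subspace_def
  proof (intro conjI ballI allI)
    show "V \<subseteq> carrier_vec d" using T by (auto simp: V_def)
    have "T *\<^sub>v 0\<^sub>v e = 0\<^sub>v d" using T by auto
    thus "0\<^sub>v d \<in> V" unfolding V_def by (metis imageI zero_carrier_vec)
  next
    fix v w assume "v \<in> V" "w \<in> V"
    then obtain v' w' where vw: "v' \<in> carrier_vec e" "w' \<in> carrier_vec e" "v = T *\<^sub>v v'" "w = T *\<^sub>v w'"
      by (auto simp: V_def)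
    hence "v + w = T *\<^sub>v (v' + w')" using T by (simp add: mult_add_distrib_mat_vec)
    thus "v + w \<in> V" using vw by (auto simp: V_def)
  next
    fix c v assume "v \<in> V"
    then obtain v' where vw: "v' \<in> carrier_vec e" "v = T *\<^sub>v v'"
      by (auto simp: V_def)
    hence "c \<cdot>\<^sub>v v = T *\<^sub>v (c \<cdot>\<^sub>v v')" using T by (simp add: mult_mat_vec)
    thus "c \<cdot>\<^sub>v v \<in> V" using vw by (auto simp: V_def)
  qed
  moreover have "\<rho> g *\<^sub>v w \<in> V" if that: "g \<in> carrier G" "w \<in> V" for g w
  proof -
    obtain w' where w: "w' \<in> carrier_vec e" "w = T *\<^sub>v w'" using \<open>w \<in> V\<close> by (auto simp: V_def)
    have "\<rho> g *\<^sub>v w = T *\<^sub>v (\<sigma> g *\<^sub>v w')"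
      using w(1) T s(1)[OF that(1)] r(1)[OF that(1)] comm[OF that(1)]
      unfolding w(2) by (metis assoc_mult_mat_vec)
    thus ?thesis using s(1)[OF that(1)] w by (auto simp: V_def)
  qed
  ultimately have "V = {0\<^sub>v d} \<or> V = carrier_vec d" by (rule r(5))
  moreover have "V \<noteq> {0\<^sub>v d}"
    using mat_eq_0_if_mult_vec_0[OF T] nz unfolding V_def by blast
  ultimately have V: "V = carrier_vec d" by blast
  have "\<exists>v \<in> carrier_vec e. T *\<^sub>v v = unit_vec d i" for i
  proof -
    have "unit_vec d i \<in> V" unfolding V by simp
    thus ?thesis unfolding V_def by force
  qed
  then obtain s where s': "\<And>i. s i \<in> carrier_vec e" "\<And>i. T *\<^sub>v s i = unit_vec d i" by metis
  \<comment> \<open>Column \<open>j\<close> is a preimage of the \<open>j\<close>-th unit vector, so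
    \<open>T * S = 1\<close>. The other equation follows from injectivity, since \<open>T\<close>
    kills the difference of \<open>u\<close> and its image under \<open>S * T\<close>.\<close>
  define S where "S = mat e d (\<lambda>(i, j). s j $ i)"
  have S: "S \<in> carrier_mat e d" by (simp add: S_def)
  have colS: "col S j = s j" if "j < d" for j
    using that s'(1)[of j] by (intro eq_vecI) (auto simp: S_def)
  have TS: "T * S = 1\<^sub>m d"
  proof (rule eq_matI)
    fix i j assume "i < dim_row (1\<^sub>m d :: complex mat)" "j < dim_col (1\<^sub>m d :: complex mat)"
    hence ij: "i < d" "j < d" by auto
    have "(T * S) $$ (i, j) = (T *\<^sub>v s j) $ i" using ij T S colS by simp
    thus "(T * S) $$ (i, j) = 1\<^sub>m d $$ (i, j)" using ij unfolding s'(2) by simp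
  qed (use T S in auto)
  have "S * T = 1\<^sub>m e"
  proof (rule eq_matI)
    fix i j assume "i < dim_row (1\<^sub>m e :: complex mat)" "j < dim_col (1\<^sub>m e :: complex mat)"
    hence ij: "i < e" "j < e" by auto
    let ?u = "unit_vec e j :: complex vec"
    let ?w = "S *\<^sub>v (T *\<^sub>v ?u)"
    have w: "?w \<in> carrier_vec e" using S T by (metis mult_mat_vec_carrier unit_vec_carrier)
    have "T *\<^sub>v ?w = T *\<^sub>v ?u"
      using S T TS by (metis assoc_mult_mat_vec mult_mat_vec_carrier one_mult_mat_vec unit_vec_carrier)
    hence "T *\<^sub>v (?w - ?u) = 0\<^sub>v d"
      using mult_minus_distrib_mat_vec[OF T w unit_vec_carrier] T by auto
    hence "?w - ?u = 0\<^sub>v e" using w by (intro inj) auto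
    hence "(?w - ?u) $ i = 0" using ij by simp
    hence "?w $ i = ?u $ i" using ij w by simp
    moreover have "?w = (S * T) *\<^sub>v ?u" using S T by (metis assoc_mult_mat_vec unit_vec_carrier)
    ultimately have "((S * T) *\<^sub>v ?u) $ i = ?u $ i" by simp
    thus "(S * T) $$ (i, j) = 1\<^sub>m e $$ (i, j)"
      using ij mult_unit_vec_index[OF mult_carrier_mat[OF S T] ij] by simp
  qed (use T S in auto)
  thus ?thesis using S TS by blast
qed

text \<open>Subtracting an eigenvalue, which exists over the complex numbers, leaves an intertwiner
  with nonzero kernel, and this must vanish.\<close>

lemma schur_scalar:
  assumes \<rho>: "is_irred_rep G d \<rho>" and T: "T \<in> carrier_mat d d"
    and comm: "\<And>g. g \<in> carrier G \<Longrightarrow> \<rho> g * T = T * \<rho> g"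
  shows "\<exists>c. T = c \<cdot>\<^sub>m 1\<^sub>m d"
proof -
  note r = is_irred_repD[OF \<rho>]
  obtain c v where "eigenvector T v c"
    using spectrum_non_empty[OF T r(3)] unfolding spectrum_def eigenvalue_def by blast
  hence v: "v \<in> carrier_vec d" "v \<noteq> 0\<^sub>v d" "T *\<^sub>v v = c \<cdot>\<^sub>v v"
    using T unfolding eigenvector_def by auto
  define T' where "T' = T - c \<cdot>\<^sub>m 1\<^sub>m d"
  have T': "T' \<in> carrier_mat d d" unfolding T'_def by (intro minus_carrier_mat) auto
  have comm': "\<rho> g * T' = T' * \<rho> g" if "g \<in> carrier G" for g
  proof -
    have "\<rho> g * T' = \<rho> g * T - \<rho> g * (c \<cdot>\<^sub>m 1\<^sub>m d)"
      unfolding T'_def using r(1)[OF that] T by (intro mult_minus_distrib_mat) auto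
    also have "\<rho> g * (c \<cdot>\<^sub>m 1\<^sub>m d) = (c \<cdot>\<^sub>m 1\<^sub>m d) * \<rho> g"
      using mult_smult_distrib[OF r(1)[OF that] one_carrier_mat, of c]
        mult_smult_assoc_mat[OF one_carrier_mat r(1)[OF that], of c] r(1)[OF that] by simp
    also have "\<rho> g * T - \<dots> = T' * \<rho> g"
      unfolding T'_def comm[OF that]
      using r(1)[OF that] T by (intro minus_mult_distrib_mat[symmetric]) auto
    finally show ?thesis .
  qed
  have T'v: "T' *\<^sub>v v = 0\<^sub>v d"
  proof -
    have "T' *\<^sub>v v = T *\<^sub>v v - (c \<cdot>\<^sub>m 1\<^sub>m d) *\<^sub>v v" unfolding T'_def
      using T v by (simp add: minus_mult_distrib_mat_vec)
    also have "\<dots> = 0\<^sub>v d" using v by (simp add: smult_one_mult_vec)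
    finally show ?thesis .
  qed
  have "T' = 0\<^sub>m d d"
    using kernel_intertwiner[OF \<rho> r(1) T' comm' _ v(1) T'v] v(2) by blast
  hence "T' $$ (i, j) = 0" if "i < d" "j < d" for i j using that by simp
  hence "T = c \<cdot>\<^sub>m 1\<^sub>m d" using T unfolding T'_def by (intro eq_matI) auto
  thus ?thesis ..
qed

text \<open>The type of matrices contains all dimensions and so has no common zero; hence the
  dimensions are parameters and the sum is entrywise.\<close>

definition mat_sum :: "nat \<Rightarrow> nat \<Rightarrow> 'g set \<Rightarrow> ('g \<Rightarrow> complex mat) \<Rightarrow> complex mat" where
  "mat_sum d e S f = mat d e (\<lambda>ij. \<Sum>g \<in> S. f g $$ ij)"

lemma mat_sum_carrier [simp]: "mat_sum d e S f \<in> carrier_mat d e"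
  by (simp add: mat_sum_def)

lemma mult_mat_sum:
  assumes "A \<in> carrier_mat a d" "\<And>g. g \<in> S \<Longrightarrow> f g \<in> carrier_mat d e"
  shows "A * mat_sum d e S f = mat_sum a e S (\<lambda>g. A * f g)"
proof (rule eq_matI)
  fix i j assume "i < dim_row (mat_sum a e S (\<lambda>g. A * f g))" "j < dim_col (mat_sum a e S (\<lambda>g. A * f g))"
  hence ij: "i < a" "j < e" by (auto simp: mat_sum_def)
  have "(A * mat_sum d e S f) $$ (i, j) = (\<Sum>k<d. A $$ (i, k) * (\<Sum>g\<in>S. f g $$ (k, j)))"
    using ij by (subst index_mult_mat_sum[OF assms(1) mat_sum_carrier]) (auto simp: mat_sum_def)
  also have "\<dots> = (\<Sum>g\<in>S. \<Sum>k<d. A $$ (i, k) * f g $$ (k, j))"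
    by (simp only: sum_distrib_left) (rule sum.swap)
  also have "\<dots> = (\<Sum>g\<in>S. (A * f g) $$ (i, j))"
    using ij assms by (intro sum.cong refl index_mult_mat_sum[symmetric]) auto
  finally show "(A * mat_sum d e S f) $$ (i, j) = mat_sum a e S (\<lambda>g. A * f g) $$ (i, j)"
    using ij by (simp add: mat_sum_def)
qed (use assms in \<open>auto simp: mat_sum_def\<close>)

lemma mat_sum_mult:
  assumes "A \<in> carrier_mat e a" "\<And>g. g \<in> S \<Longrightarrow> f g \<in> carrier_mat d e"
  shows "mat_sum d e S f * A = mat_sum d a S (\<lambda>g. f g * A)"
proof (rule eq_matI)
  fix i j assume "i < dim_row (mat_sum d a S (\<lambda>g. f g * A))" "j < dim_col (mat_sum d a S (\<lambda>g. f g * A))"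
  hence ij: "i < d" "j < a" by (auto simp: mat_sum_def)
  have "(mat_sum d e S f * A) $$ (i, j) = (\<Sum>k<e. (\<Sum>g\<in>S. f g $$ (i, k)) * A $$ (k, j))"
    using ij by (subst index_mult_mat_sum[OF mat_sum_carrier assms(1)]) (auto simp: mat_sum_def)
  also have "\<dots> = (\<Sum>g\<in>S. \<Sum>k<e. f g $$ (i, k) * A $$ (k, j))"
    by (simp only: sum_distrib_right) (rule sum.swap)
  also have "\<dots> = (\<Sum>g\<in>S. (f g * A) $$ (i, j))"
    using ij assms by (intro sum.cong refl index_mult_mat_sum[symmetric]) auto
  finally show "(mat_sum d e S f * A) $$ (i, j) = mat_sum d a S (\<lambda>g. f g * A) $$ (i, j)"
    using ij by (simp add: mat_sum_def)
qed (use assms in \<open>auto simp: mat_sum_def\<close>)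

lemma mat_trace_mat_sum: "mat_trace d (mat_sum d d S f) = (\<Sum>g\<in>S. mat_trace d (f g))"
  unfolding mat_trace_def mat_sum_def by (simp add: sum.swap[of _ _ S])

lemma mat_sum_cong: "(\<And>g. g \<in> S \<Longrightarrow> f g = f' g) \<Longrightarrow> mat_sum d e S f = mat_sum d e S f'"
  unfolding mat_sum_def by (intro cong_mat) auto

lemma mat_sum_reindex:
  assumes "bij_betw \<phi> S S"
  shows "mat_sum d e S (\<lambda>g. f (\<phi> g)) = mat_sum d e S f"
  unfolding mat_sum_def by (intro cong_mat refl sum.reindex_bij_betw[OF assms])

text \<open>Sandwiching a matrix unit isolates a product of two diagonal entries, the typical term
  of a product of two traces.\<close>

lemma mult_unit_mat:
  assumes "A \<in> carrier_mat d d" "B \<in> carrier_mat e e" "i < d" "k < e"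
  shows "(A * mat d e (\<lambda>ij. if ij = (i, k) then 1 else 0) * B) $$ (i, k) = A $$ (i, i) * (B $$ (k, k) :: complex)"
proof -
  let ?E = "mat d e (\<lambda>ij. if ij = (i, k) then 1 else 0 :: complex)"
  have AE: "(A * ?E) $$ (i, l) = (if l = k then A $$ (i, i) else 0)" if "l < e" for l
  proof -
    have "(A * ?E) $$ (i, l) = (\<Sum>m<d. A $$ (i, m) * ?E $$ (m, l))"
      using assms that by (intro index_mult_mat_sum) auto
    also have "\<dots> = (\<Sum>m<d. if m = i then (if l = k then A $$ (i, i) else 0) else 0)"
      using that by (intro sum.cong) auto
    finally show ?thesis using assms by simp
  qed
  have "(A * ?E * B) $$ (i, k) = (\<Sum>l<e. (A * ?E) $$ (i, l) * B $$ (l, k))"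
    using assms by (intro index_mult_mat_sum[of _ d]) auto
  also have "\<dots> = (\<Sum>l<e. if l = k then A $$ (i, i) * B $$ (k, k) else 0)"
    by (intro sum.cong) (auto simp: AE)
  finally show ?thesis using assms by simp
qed

section \<open>Orthogonality of characters and Bessel's inequality\<close>

context group begin

lemma bij_betw_mult_left: "h \<in> carrier G \<Longrightarrow> bij_betw (\<lambda>g. h \<otimes> g) (carrier G) (carrier G)"
  by (rule bij_betw_byWitness[where f' = "\<lambda>g. inv h \<otimes> g"]) (auto simp: m_assoc[symmetric])

lemma bij_betw_mult_right: "h \<in> carrier G \<Longrightarrow> bij_betw (\<lambda>g. g \<otimes> h) (carrier G) (carrier G)"
  by (rule bij_betw_byWitness[where f' = "\<lambda>g. g \<otimes> inv h"]) (auto simp: m_assoc)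

text \<open>Multiplying by \<open>\<rho> h\<close> on the left amounts to replacing \<open>g\<close>
  by \<open>h \<otimes> g\<close> in the average, at the cost of a factor \<open>\<sigma> h\<close>
  on the right.\<close>

lemma average_intertwines:
  assumes \<rho>: "is_irred_rep G d \<rho>" and \<sigma>: "is_irred_rep G e \<sigma>" and X: "X \<in> carrier_mat d e"
    and h: "h \<in> carrier G"
  defines "T \<equiv> mat_sum d e (carrier G) (\<lambda>g. \<rho> g * X * \<sigma> (inv g))"
  shows "\<rho> h * T = T * \<sigma> h"
proof -
  note r = is_irred_repD[OF \<rho>] and s = is_irred_repD[OF \<sigma>]
  have c: "\<rho> g * X * \<sigma> (inv g) \<in> carrier_mat d e" if "g \<in> carrier G" for g
    using r(1)[OF that] s(1)[OF inv_closed[OF that]] X by auto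
  have "\<rho> h * T = mat_sum d e (carrier G) (\<lambda>g. \<rho> h * (\<rho> g * X * \<sigma> (inv g)))"
    unfolding T_def by (intro mult_mat_sum r h c)
  also have "\<dots> = mat_sum d e (carrier G) (\<lambda>g. \<rho> (h \<otimes> g) * X * \<sigma> (inv (h \<otimes> g)) * \<sigma> h)"
  proof (rule mat_sum_cong)
    fix g assume g: "g \<in> carrier G"
    have "inv g = inv (h \<otimes> g) \<otimes> h" using g h by (simp add: inv_mult_group m_assoc)
    hence 1: "\<sigma> (inv g) = \<sigma> (inv (h \<otimes> g)) * \<sigma> h" using s(4)[of "inv (h \<otimes> g)" h] g h by simp
    have m: "\<rho> h \<in> carrier_mat d d" "\<rho> g \<in> carrier_mat d d" "\<sigma> h \<in> carrier_mat e e"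
      "\<sigma> (inv (h \<otimes> g)) \<in> carrier_mat e e" using r(1) s(1) g h by auto
    have "\<rho> h * (\<rho> g * X * (\<sigma> (inv (h \<otimes> g)) * \<sigma> h)) = \<rho> h * ((\<rho> g * X * \<sigma> (inv (h \<otimes> g))) * \<sigma> h)"
      using m X by (subst assoc_mult_mat[symmetric, of "\<rho> g * X" d e _ e _ e]) auto
    also have "\<dots> = \<rho> h * (\<rho> g * X * \<sigma> (inv (h \<otimes> g))) * \<sigma> h"
      using m X by (subst assoc_mult_mat[symmetric, of "\<rho> h" d d _ e _ e]) auto
    also have "\<rho> h * (\<rho> g * X * \<sigma> (inv (h \<otimes> g))) = \<rho> h * (\<rho> g * X) * \<sigma> (inv (h \<otimes> g))"
      using m X by (subst assoc_mult_mat[symmetric, of "\<rho> h" d d _ e _ e]) auto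
    also have "\<rho> h * (\<rho> g * X) = \<rho> (h \<otimes> g) * X" using m X r(4)[OF h g] by (auto simp: assoc_mult_mat[of _ d d _ d _ e])
    finally show "\<rho> h * (\<rho> g * X * \<sigma> (inv g)) = \<rho> (h \<otimes> g) * X * \<sigma> (inv (h \<otimes> g)) * \<sigma> h"
      unfolding 1 .
  qed
  also have "\<dots> = mat_sum d e (carrier G) (\<lambda>g. \<rho> g * X * \<sigma> (inv g) * \<sigma> h)"
    by (rule mat_sum_reindex[OF bij_betw_mult_left[OF h], where f = "\<lambda>g. \<rho> g * X * \<sigma> (inv g) * \<sigma> h"])
  also have "\<dots> = T * \<sigma> h"
    unfolding T_def by (intro mat_sum_mult[symmetric] s h c)
  finally show ?thesis .
qed

text \<open>After expanding the traces, the sum over \<open>g\<close> for fixed \<open>i\<close> and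
  \<open>k\<close> is an entry of the average of a matrix unit. A nonzero average would be
  invertible by Schur and force all traces to agree.\<close>

lemma trace_orthogonality:
  assumes \<rho>: "is_irred_rep G d \<rho>" and \<sigma>: "is_irred_rep G e \<sigma>" and fin: "finite (carrier G)"
    and neq: "\<exists>g\<in>carrier G. mat_trace d (\<rho> g) \<noteq> mat_trace e (\<sigma> g)"
  shows "(\<Sum>g\<in>carrier G. mat_trace d (\<rho> g) * mat_trace e (\<sigma> (inv g))) = 0"
proof -
  note r = is_irred_repD[OF \<rho>] and s = is_irred_repD[OF \<sigma>]
  have "(\<Sum>g\<in>carrier G. mat_trace d (\<rho> g) * mat_trace e (\<sigma> (inv g)))
     = (\<Sum>g\<in>carrier G. \<Sum>i<d. \<Sum>k<e. \<rho> g $$ (i,i) * \<sigma> (inv g) $$ (k,k))"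
    unfolding mat_trace_def by (simp add: sum_product)
  also have "\<dots> = (\<Sum>i<d. \<Sum>k<e. \<Sum>g\<in>carrier G. \<rho> g $$ (i,i) * \<sigma> (inv g) $$ (k,k))"
    by (subst sum.swap) (simp add: sum.swap[of _ "carrier G"])
  also have "\<dots> = 0"
  proof (rule sum.neutral, rule ballI, rule sum.neutral, rule ballI)
    fix i k assume "i \<in> {..<d}" "k \<in> {..<e}"
    hence ik: "i < d" "k < e" by auto
    define X where "X = mat d e (\<lambda>ij. if ij = (i, k) then 1 else 0 :: complex)"
    define T where "T = mat_sum d e (carrier G) (\<lambda>g. \<rho> g * X * \<sigma> (inv g))"
    have X: "X \<in> carrier_mat d e" and T: "T \<in> carrier_mat d e" by (auto simp: X_def T_def)
    have comm: "\<rho> g * T = T * \<sigma> g" if "g \<in> carrier G" for g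
      unfolding T_def by (rule average_intertwines[OF \<rho> \<sigma> X that])
    have "T = 0\<^sub>m d e"
    proof (rule ccontr)
      assume "T \<noteq> 0\<^sub>m d e"
      from schur_invertible[OF \<sigma> \<rho> T comm this] obtain S
        where "S \<in> carrier_mat e d" "T * S = 1\<^sub>m d" "S * T = 1\<^sub>m e" by blast
      hence "mat_trace d (\<rho> g) = mat_trace e (\<sigma> g)" if "g \<in> carrier G" for g
        using mat_trace_conj[OF r(1)[OF that] T _ _ s(1)[OF that] comm[OF that]] by blast
      with neq show False by blast
    qed
    hence "T $$ (i, k) = 0" using ik by simp
    moreover have "T $$ (i, k) = (\<Sum>g\<in>carrier G. (\<rho> g * X * \<sigma> (inv g)) $$ (i, k))"
      using ik by (simp add: T_def mat_sum_def)
    moreover have "\<dots> = (\<Sum>g\<in>carrier G. \<rho> g $$ (i,i) * \<sigma> (inv g) $$ (k,k))"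
      unfolding X_def using ik by (intro sum.cong refl mult_unit_mat r s) auto
    ultimately show "(\<Sum>g\<in>carrier G. \<rho> g $$ (i,i) * \<sigma> (inv g) $$ (k,k)) = 0" by simp
  qed
  finally show ?thesis .
qed

text \<open>Here the average of the matrix unit at \<open>(i, k)\<close> is a scalar matrix;
  comparing traces, the scalar is the group order over \<open>d\<close> if \<open>i = k\<close> and
  zero otherwise.\<close>

lemma trace_norm:
  assumes \<rho>: "is_irred_rep G d \<rho>" and fin: "finite (carrier G)"
  shows "(\<Sum>g\<in>carrier G. mat_trace d (\<rho> g) * mat_trace d (\<rho> (inv g))) = of_nat (card (carrier G))"
proof -
  note r = is_irred_repD[OF \<rho>]
  have "(\<Sum>g\<in>carrier G. mat_trace d (\<rho> g) * mat_trace d (\<rho> (inv g)))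
     = (\<Sum>g\<in>carrier G. \<Sum>i<d. \<Sum>k<d. \<rho> g $$ (i,i) * \<rho> (inv g) $$ (k,k))"
    unfolding mat_trace_def by (simp add: sum_product)
  also have "\<dots> = (\<Sum>i<d. \<Sum>k<d. \<Sum>g\<in>carrier G. \<rho> g $$ (i,i) * \<rho> (inv g) $$ (k,k))"
    by (subst sum.swap) (simp add: sum.swap[of _ "carrier G"])
  also have "\<dots> = (\<Sum>i<d. \<Sum>k<d. if k = i then of_nat (card (carrier G)) / of_nat d else 0)"
  proof (intro sum.cong refl)
    fix i k assume "i \<in> {..<d}" "k \<in> {..<d}"
    hence ik: "i < d" "k < d" by auto
    define X where "X = mat d d (\<lambda>ij. if ij = (i, k) then 1 else 0 :: complex)"
    define T where "T = mat_sum d d (carrier G) (\<lambda>g. \<rho> g * X * \<rho> (inv g))"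
    have X: "X \<in> carrier_mat d d" and T: "T \<in> carrier_mat d d" by (auto simp: X_def T_def)
    have "\<rho> g * T = T * \<rho> g" if "g \<in> carrier G" for g
      unfolding T_def by (rule average_intertwines[OF \<rho> \<rho> X that])
    from schur_scalar[OF \<rho> T this] obtain c where c: "T = c \<cdot>\<^sub>m 1\<^sub>m d" by blast
    have "mat_trace d T = (\<Sum>g\<in>carrier G. mat_trace d (\<rho> g * X * \<rho> (inv g)))"
      unfolding T_def by (rule mat_trace_mat_sum)
    also have "\<dots> = (\<Sum>g\<in>carrier G. mat_trace d X)"
    proof (rule sum.cong)
      fix g assume g: "g \<in> carrier G"
      have m: "\<rho> g \<in> carrier_mat d d" "\<rho> (inv g) \<in> carrier_mat d d" using g r(1) by auto
      have "mat_trace d (\<rho> g * X * \<rho> (inv g)) = mat_trace d (\<rho> (inv g) * (\<rho> g * X))"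
        using m X by (intro mat_trace_mult_comm) auto
      also have "\<rho> (inv g) * (\<rho> g * X) = \<rho> (inv g \<otimes> g) * X"
        using m X r(4)[of "inv g" g] g by (simp add: assoc_mult_mat[of _ d d _ d _ d] del: l_inv)
      also have "\<dots> = X" using g r(2) X by simp
      finally show "mat_trace d (\<rho> g * X * \<rho> (inv g)) = mat_trace d X" .
    qed simp
    also have "mat_trace d X = (if k = i then 1 else 0)"
    proof -
      have "mat_trace d X = (\<Sum>j<d. if j = i then (if k = i then 1 else 0) else 0)"
        unfolding mat_trace_def X_def by (intro sum.cong) auto
      thus ?thesis using ik by simp
    qed
    finally have "mat_trace d T = of_nat (card (carrier G)) * (if k = i then 1 else 0)" by simp
    moreover have "mat_trace d T = c * of_nat d" unfolding c mat_trace_def by simp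
    ultimately have cc: "c = of_nat (card (carrier G)) * (if k = i then 1 else 0) / of_nat d"
      using r(3) by (simp add: field_simps)
    have "(\<Sum>g\<in>carrier G. \<rho> g $$ (i,i) * \<rho> (inv g) $$ (k,k)) = (\<Sum>g\<in>carrier G. (\<rho> g * X * \<rho> (inv g)) $$ (i, k))"
      unfolding X_def using ik by (intro sum.cong refl mult_unit_mat[symmetric] r) auto
    also have "\<dots> = T $$ (i, k)" using ik by (simp add: T_def mat_sum_def)
    also have "\<dots> = (if k = i then of_nat (card (carrier G)) / of_nat d else 0)"
      using ik cc by (simp add: c)
    finally show "(\<Sum>g\<in>carrier G. \<rho> g $$ (i,i) * \<rho> (inv g) $$ (k,k))
       = (if k = i then of_nat (card (carrier G)) / of_nat d else 0)" .
  qed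
  also have "\<dots> = of_nat (card (carrier G))" using r(3) by simp
  finally show ?thesis .
qed

text \<open>Replaces the passage to a unitary representation: the sum \<open>M\<close> of all
  \<open>adj (\<rho> g) * \<rho> g\<close> intertwines \<open>\<rho>\<close> with its conjugate
  dual, the family \<open>adj (\<rho> (inv g))\<close>, and an invertible intertwiner equates the
  traces.\<close>

lemma mat_trace_inv:
  assumes \<rho>: "is_irred_rep G d \<rho>" and fin: "finite (carrier G)" and h: "h \<in> carrier G"
  shows "mat_trace d (\<rho> (inv h)) = cnj (mat_trace d (\<rho> h))"
proof -
  note r = is_irred_repD[OF \<rho>]
  define adj where "adj A = mat d d (\<lambda>(i, j). cnj (A $$ (j, i)))" for A :: "complex mat"
  have adj_carrier: "adj A \<in> carrier_mat d d" for A by (simp add: adj_def)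
  have adj_mult: "adj (A * B) = adj B * adj A" if "A \<in> carrier_mat d d" "B \<in> carrier_mat d d" for A B
  proof (rule eq_matI)
    fix i j assume "i < dim_row (adj B * adj A)" "j < dim_col (adj B * adj A)"
    hence ij: "i < d" "j < d" by (auto simp: adj_def)
    have "adj (A * B) $$ (i, j) = cnj (\<Sum>k<d. A $$ (j, k) * B $$ (k, i))"
      using ij index_mult_mat_sum[OF that ij(2,1)] by (simp add: adj_def)
    also have "\<dots> = (\<Sum>k<d. adj B $$ (i, k) * adj A $$ (k, j))"
      using ij by (simp add: adj_def mult.commute)
    also have "\<dots> = (adj B * adj A) $$ (i, j)"
      by (rule index_mult_mat_sum[symmetric, OF adj_carrier adj_carrier ij])
    finally show "adj (A * B) $$ (i, j) = (adj B * adj A) $$ (i, j)" .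
  qed (auto simp: adj_def)
  define M where "M = mat_sum d d (carrier G) (\<lambda>g. adj (\<rho> g) * \<rho> g)"
  have M: "M \<in> carrier_mat d d" by (simp add: M_def)
  have c: "adj (\<rho> g) * \<rho> g \<in> carrier_mat d d" if "g \<in> carrier G" for g
    using adj_carrier r(1)[OF that] by (rule mult_carrier_mat)
  have intertw: "adj (\<rho> (inv k)) * M = M * \<rho> k" if k: "k \<in> carrier G" for k
  proof -
    have "adj (\<rho> (inv k)) * M = mat_sum d d (carrier G) (\<lambda>g. adj (\<rho> (inv k)) * (adj (\<rho> g) * \<rho> g))"
      unfolding M_def by (intro mult_mat_sum adj_carrier c)
    also have "\<dots> = mat_sum d d (carrier G) (\<lambda>g. adj (\<rho> (g \<otimes> inv k)) * \<rho> (g \<otimes> inv k) * \<rho> k)"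
    proof (rule mat_sum_cong)
      fix g assume g: "g \<in> carrier G"
      have m: "\<rho> g \<in> carrier_mat d d" "\<rho> k \<in> carrier_mat d d" "\<rho> (inv k) \<in> carrier_mat d d"
        "\<rho> (g \<otimes> inv k) \<in> carrier_mat d d" using r(1) g k by auto
      have "\<rho> g = \<rho> (g \<otimes> inv k) * \<rho> k"
        using r(4)[of "g \<otimes> inv k" k] g k by (simp add: m_assoc)
      hence "adj (\<rho> (inv k)) * (adj (\<rho> g) * \<rho> g) = adj (\<rho> (inv k)) * (adj (\<rho> g) * (\<rho> (g \<otimes> inv k) * \<rho> k))"
        by simp
      also have "\<dots> = (adj (\<rho> (inv k)) * adj (\<rho> g)) * (\<rho> (g \<otimes> inv k) * \<rho> k)"
        by (rule assoc_mult_mat[symmetric, OF adj_carrier adj_carrier]) (use m in auto)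
      also have "adj (\<rho> (inv k)) * adj (\<rho> g) = adj (\<rho> (g \<otimes> inv k))"
        using adj_mult[OF m(1,3)] r(4)[of g "inv k"] g k by simp
      also have "adj (\<rho> (g \<otimes> inv k)) * (\<rho> (g \<otimes> inv k) * \<rho> k) = adj (\<rho> (g \<otimes> inv k)) * \<rho> (g \<otimes> inv k) * \<rho> k"
        by (rule assoc_mult_mat[symmetric, OF adj_carrier m(4,2)])
      finally show "adj (\<rho> (inv k)) * (adj (\<rho> g) * \<rho> g) = adj (\<rho> (g \<otimes> inv k)) * \<rho> (g \<otimes> inv k) * \<rho> k" .
    qed
    also have "\<dots> = mat_sum d d (carrier G) (\<lambda>g. adj (\<rho> g) * \<rho> g * \<rho> k)"
      by (rule mat_sum_reindex[OF bij_betw_mult_right[OF inv_closed[OF k]], where f = "\<lambda>g. adj (\<rho> g) * \<rho> g * \<rho> k"])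
    also have "\<dots> = M * \<rho> k"
      unfolding M_def by (intro mat_sum_mult[symmetric] r k c)
    finally show ?thesis .
  qed
  \<comment> \<open>The \<open>(0, 0)\<close> entry is a sum of squared absolute values, and the
    term with \<open>g = \<one>\<close> and \<open>k = 0\<close> is 1.\<close>
  have "M \<noteq> 0\<^sub>m d d"
  proof
    assume "M = 0\<^sub>m d d"
    hence "M $$ (0, 0) = 0" using r(3) by simp
    moreover have "M $$ (0, 0) = (\<Sum>g\<in>carrier G. (adj (\<rho> g) * \<rho> g) $$ (0, 0))"
      using r(3) by (simp add: M_def mat_sum_def)
    moreover have "\<dots> = (\<Sum>g\<in>carrier G. \<Sum>k<d. complex_of_real ((cmod (\<rho> g $$ (k, 0)))\<^sup>2))"
    proof (rule sum.cong)
      fix g assume g: "g \<in> carrier G"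
      have "(adj (\<rho> g) * \<rho> g) $$ (0, 0) = (\<Sum>k<d. adj (\<rho> g) $$ (0, k) * \<rho> g $$ (k, 0))"
        using r(1)[OF g] r(3) adj_carrier by (intro index_mult_mat_sum) auto
      also have "\<dots> = (\<Sum>k<d. complex_of_real ((cmod (\<rho> g $$ (k, 0)))\<^sup>2))"
        using r(3) by (intro sum.cong refl) (simp add: adj_def complex_norm_square mult.commute del: of_real_power)
      finally show "(adj (\<rho> g) * \<rho> g) $$ (0, 0) = \<dots>" .
    qed simp
    moreover have "\<dots> = complex_of_real (\<Sum>g\<in>carrier G. \<Sum>k<d. (cmod (\<rho> g $$ (k, 0)))\<^sup>2)" by simp
    ultimately have "complex_of_real (\<Sum>g\<in>carrier G. \<Sum>k<d. (cmod (\<rho> g $$ (k, 0)))\<^sup>2) = 0"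
      by argo
    hence "(\<Sum>g\<in>carrier G. \<Sum>k<d. (cmod (\<rho> g $$ (k, 0)))\<^sup>2) = 0"
      unfolding of_real_eq_0_iff .
    hence "(\<Sum>k<d. (cmod (\<rho> \<one> $$ (k, 0)))\<^sup>2) = 0"
      by (subst (asm) sum_nonneg_eq_0_iff[OF fin]) (auto intro: sum_nonneg)
    hence "(cmod (\<rho> \<one> $$ (0, 0)))\<^sup>2 = 0"
      using r(3) by (subst (asm) sum_nonneg_eq_0_iff) auto
    thus False using r(2,3) by simp
  qed
  hence inj: "v = 0\<^sub>v d" if "v \<in> carrier_vec d" "M *\<^sub>v v = 0\<^sub>v d" for v
    using kernel_intertwiner[OF \<rho> adj_carrier M intertw] that by blast
  have "det M \<noteq> 0" using det_0_iff_vec_prod_zero_field[OF M] inj by blast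
  then obtain S where S: "S \<in> carrier_mat d d" "S * M = 1\<^sub>m d" "M * S = 1\<^sub>m d"
    using det_non_zero_imp_unit[OF M] unfolding Units_def ring_mat_def by auto
  have "mat_trace d (adj (\<rho> (inv h))) = mat_trace d (\<rho> h)"
    by (rule mat_trace_conj[OF adj_carrier M S(1,3) r(1)[OF h] intertw[OF h] S(2)])
  moreover have "mat_trace d (adj (\<rho> (inv h))) = cnj (mat_trace d (\<rho> (inv h)))"
    by (simp add: mat_trace_def adj_def)
  ultimately show ?thesis by (metis complex_cnj_cnj)
qed

lemma Irr_conj:
  assumes "\<chi> \<in> Irr G" "x \<in> carrier G" "g \<in> carrier G"
  shows "\<chi> (g \<otimes> x \<otimes> inv g) = \<chi> x"
proof -
  from assms(1) obtain d \<rho> where \<rho>: "is_irred_rep G d \<rho>"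
    and \<chi>: "\<chi> = (\<lambda>g. if g \<in> carrier G then mat_trace d (\<rho> g) else 0)" unfolding Irr_def by blast
  note r = is_irred_repD[OF \<rho>]
  have "\<rho> (g \<otimes> x \<otimes> inv g) * \<rho> g = \<rho> g * \<rho> x"
    using r(4)[of "g \<otimes> x \<otimes> inv g" g] r(4)[of g x] assms by (simp add: m_assoc)
  moreover have "\<rho> g * \<rho> (inv g) = 1\<^sub>m d" "\<rho> (inv g) * \<rho> g = 1\<^sub>m d"
    using r(4)[of g "inv g"] r(4)[of "inv g" g] r(2) assms by auto
  ultimately have "mat_trace d (\<rho> (g \<otimes> x \<otimes> inv g)) = mat_trace d (\<rho> x)"
    using r(1) assms by (intro mat_trace_conj[where T = "\<rho> g" and S = "\<rho> (inv g)"]) auto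
  thus ?thesis using \<chi> assms by simp
qed

lemma Irr_orthonormal:
  assumes fin: "finite (carrier G)" and "\<chi> \<in> Irr G" "\<psi> \<in> Irr G"
  shows "(\<Sum>g\<in>carrier G. \<chi> g * cnj (\<psi> g)) = (if \<chi> = \<psi> then of_nat (card (carrier G)) else 0)"
proof -
  from assms(2) obtain d \<rho> where \<rho>: "is_irred_rep G d \<rho>"
    and \<chi>: "\<chi> = (\<lambda>g. if g \<in> carrier G then mat_trace d (\<rho> g) else 0)" unfolding Irr_def by blast
  from assms(3) obtain e \<sigma> where \<sigma>: "is_irred_rep G e \<sigma>"
    and \<psi>: "\<psi> = (\<lambda>g. if g \<in> carrier G then mat_trace e (\<sigma> g) else 0)" unfolding Irr_def by blast
  have eq: "(\<Sum>g\<in>carrier G. \<chi> g * cnj (\<psi> g)) = (\<Sum>g\<in>carrier G. mat_trace d (\<rho> g) * mat_trace e (\<sigma> (inv g)))"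
    unfolding \<chi> \<psi> by (intro sum.cong refl) (simp add: mat_trace_inv[OF \<sigma> fin])
  show ?thesis
  proof (cases "\<chi> = \<psi>")
    case True
    hence "mat_trace d (\<rho> g) = mat_trace e (\<sigma> g)" if "g \<in> carrier G" for g
      using fun_cong[OF True[unfolded \<chi> \<psi>], of g] that by simp
    hence "(\<Sum>g\<in>carrier G. mat_trace d (\<rho> g) * mat_trace e (\<sigma> (inv g)))
        = (\<Sum>g\<in>carrier G. mat_trace d (\<rho> g) * mat_trace d (\<rho> (inv g)))" by simp
    thus ?thesis using True eq trace_norm[OF \<rho> fin] by simp
  next
    case False
    hence "\<exists>g\<in>carrier G. mat_trace d (\<rho> g) \<noteq> mat_trace e (\<sigma> g)"
      unfolding \<chi> \<psi> by (metis (mono_tags))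
    from trace_orthogonality[OF \<rho> \<sigma> fin this] False eq show ?thesis by simp
  qed
qed

definition conj_class :: "'a \<Rightarrow> 'a set" where
  "conj_class x = (\<lambda>g. g \<otimes> x \<otimes> inv g) ` carrier G"

text \<open>Bessel's inequality for the indicator function \<open>f\<close> of the conjugacy class
  against the orthogonal family \<open>F\<close>. With a finite \<open>F\<close> nothing is
  presupposed about the size of \<open>Irr G\<close>.\<close>

lemma sum_Irr_norm_le:
  assumes fin: "finite (carrier G)" and F: "finite F" "F \<subseteq> Irr G" and x: "x \<in> carrier G"
  shows "(\<Sum>\<chi>\<in>F. (cmod (\<chi> x))\<^sup>2) \<le> card (carrier G) / card (conj_class x)"
proof -
  define C where "C = conj_class x"
  define N where "N = real (card (carrier G))"
  define m where "m = real (card C)"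
  have C: "C \<subseteq> carrier G" using x by (auto simp: C_def conj_class_def)
  hence finC: "finite C" using fin finite_subset by blast
  have N: "N > 0" using fin by (auto simp: N_def card_gt_0_iff)
  have "C \<noteq> {}" by (auto simp: C_def conj_class_def)
  hence m: "m > 0" using finC by (simp add: m_def card_gt_0_iff)
  have conC: "\<chi> y = \<chi> x" if "\<chi> \<in> F" "y \<in> C" for \<chi> y
    using that F Irr_conj[of \<chi> x] x by (auto simp: C_def conj_class_def)
  have ort: "(\<Sum>g\<in>carrier G. \<chi> g * cnj (\<psi> g)) = (if \<chi> = \<psi> then of_real N else 0)"
    if "\<chi> \<in> F" "\<psi> \<in> F" for \<chi> \<psi>
    using Irr_orthonormal[OF fin subsetD[OF F(2) that(1)] subsetD[OF F(2) that(2)]] by (simp add: N_def)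
  define f where "f g = (if g \<in> C then 1 else 0 :: complex)" for g
  \<comment> \<open>The Fourier coefficient of \<open>f\<close> at \<open>\<chi>\<close>: each of
    the \<open>m\<close> class elements contributes \<open>cnj (\<chi> x)\<close>, and
    \<open>\<chi>\<close> has squared norm \<open>N\<close>. So \<open>p\<close> is the orthogonal
    projection of \<open>f\<close>, and the claim says that \<open>f - p\<close> has nonnegative
    squared norm.\<close>
  define a where "a \<chi> = of_real (m / N) * cnj (\<chi> x)" for \<chi> :: "'a \<Rightarrow> complex"
  define p where "p g = (\<Sum>\<chi>\<in>F. a \<chi> * \<chi> g)" for g
  have fp: "(\<Sum>g\<in>carrier G. f g * cnj (p g)) = of_real (m\<^sup>2 / N * (\<Sum>\<chi>\<in>F. (cmod (\<chi> x))\<^sup>2))"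
  proof -
    have "(\<Sum>g\<in>carrier G. f g * cnj (p g)) = (\<Sum>g\<in>C. cnj (p g))"
      unfolding f_def using C fin by (simp add: if_distrib[of "\<lambda>z. z * _"] sum.If_cases Int_absorb1 cong: if_cong)
    also have "\<dots> = (\<Sum>g\<in>C. \<Sum>\<chi>\<in>F. of_real (m / N) * of_real ((cmod (\<chi> x))\<^sup>2))"
      unfolding p_def a_def cnj_sum
      by (intro sum.cong refl) (simp add: conC complex_norm_square mult.assoc del: of_real_power)
    also have "\<dots> = of_real (m\<^sup>2 / N * (\<Sum>\<chi>\<in>F. (cmod (\<chi> x))\<^sup>2))"
      by (simp add: sum_distrib_left m_def power2_eq_square mult_ac)
    finally show ?thesis .
  qed
  have pp: "(\<Sum>g\<in>carrier G. p g * cnj (p g)) = of_real (m\<^sup>2 / N * (\<Sum>\<chi>\<in>F. (cmod (\<chi> x))\<^sup>2))"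
  proof -
    have "(\<Sum>g\<in>carrier G. p g * cnj (p g))
      = (\<Sum>g\<in>carrier G. \<Sum>\<chi>\<in>F. \<Sum>\<psi>\<in>F. a \<chi> * cnj (a \<psi>) * (\<chi> g * cnj (\<psi> g)))"
      unfolding p_def cnj_sum sum_product by (simp add: mult_ac)
    also have "\<dots> = (\<Sum>\<chi>\<in>F. \<Sum>\<psi>\<in>F. a \<chi> * cnj (a \<psi>) * (\<Sum>g\<in>carrier G. \<chi> g * cnj (\<psi> g)))"
      by (subst sum.swap) (simp add: sum.swap[of _ "carrier G"] sum_distrib_left)
    also have "\<dots> = (\<Sum>\<chi>\<in>F. \<Sum>\<psi>\<in>F. if \<psi> = \<chi> then a \<chi> * cnj (a \<chi>) * of_real N else 0)"
      by (intro sum.cong refl) (auto simp: ort)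
    also have "\<dots> = (\<Sum>\<chi>\<in>F. of_real ((cmod (a \<chi>))\<^sup>2 * N))"
      using F by (simp add: complex_norm_square del: of_real_power)
    also have "\<dots> = (\<Sum>\<chi>\<in>F. of_real (m\<^sup>2 / N * (cmod (\<chi> x))\<^sup>2))"
      using N m by (intro sum.cong refl arg_cong[of _ _ of_real])
        (simp add: a_def norm_mult norm_divide power_mult_distrib power_divide power2_eq_square)
    finally show ?thesis by (simp add: sum_distrib_left)
  qed
  have ff: "(\<Sum>g\<in>carrier G. f g * cnj (f g)) = of_real m"
    unfolding f_def m_def using C fin by (simp add: if_distrib[of "\<lambda>z. z * _"] sum.If_cases Int_absorb1 cong: if_cong)
  let ?B = "m\<^sup>2 / N * (\<Sum>\<chi>\<in>F. (cmod (\<chi> x))\<^sup>2)"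
  have pf: "(\<Sum>g\<in>carrier G. p g * cnj (f g)) = of_real ?B"
    using arg_cong[OF fp, of cnj] by (simp add: mult.commute)
  have "of_real (\<Sum>g\<in>carrier G. (cmod (f g - p g))\<^sup>2)
     = (\<Sum>g\<in>carrier G. f g * cnj (f g) - f g * cnj (p g) - p g * cnj (f g) + p g * cnj (p g))"
    unfolding of_real_sum by (intro sum.cong refl) (simp add: complex_norm_square algebra_simps del: of_real_power)
  also have "\<dots> = of_real (m - ?B)"
    unfolding sum.distrib sum_subtractf ff fp pf pp by simp
  finally have "(\<Sum>g\<in>carrier G. (cmod (f g - p g))\<^sup>2) = m - ?B" using of_real_eq_iff by blast
  moreover have "(\<Sum>g\<in>carrier G. (cmod (f g - p g))\<^sup>2) \<ge> 0" by (intro sum_nonneg) auto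
  ultimately have "?B \<le> m" by linarith
  thus ?thesis using m N unfolding C_def[symmetric] m_def[symmetric] N_def[symmetric]
    by (simp add: field_simps power2_eq_square)
qed

lemma conj_class_one: "conj_class \<one> = {\<one>}"
  by (auto simp: conj_class_def image_iff)

text \<open>The triangle inequality moves the sum over \<open>h\<close> outside. Cauchy-Schwarz over
  the characters then combines \<open>sum_Irr_norm_le\<close> at \<open>\<one>\<close>, whose class
  is a singleton, with the same bound at \<open>h\<close>.\<close>

theorem D_dist_le:
  assumes fin: "finite (carrier G)" and H: "H \<subseteq> carrier G"
  shows "D_dist G H \<le> (\<Sum>h\<in>H - {\<one>}. 1 / sqrt (card (conj_class h)))"
proof (cases "finite (Irr G)")
  case False \<comment> \<open>never happens, but then the defining sum is \<open>0\<close>\<close>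
  thus ?thesis by (auto simp: D_dist_def intro!: sum_nonneg)
next
  case True
  define N where "N = real (card (carrier G))"
  have N: "N > 0" using fin by (auto simp: N_def card_gt_0_iff)
  have "(\<Sum>\<chi>\<in>Irr G. Re (\<chi> \<one>) * cmod (\<Sum>h\<in>H - {\<one>}. \<chi> h))
      \<le> (\<Sum>\<chi>\<in>Irr G. cmod (\<chi> \<one>) * (\<Sum>h\<in>H - {\<one>}. cmod (\<chi> h)))"
    by (intro sum_mono mult_mono complex_Re_le_cmod norm_sum) auto
  also have "\<dots> = (\<Sum>h\<in>H - {\<one>}. \<Sum>\<chi>\<in>Irr G. cmod (\<chi> \<one>) * cmod (\<chi> h))"
    unfolding sum_distrib_left by (rule sum.swap)
  also have "\<dots> \<le> (\<Sum>h\<in>H - {\<one>}. N / sqrt (card (conj_class h)))"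
  proof (rule sum_mono)
    fix h assume "h \<in> H - {\<one>}"
    hence h: "h \<in> carrier G" using H by auto
    have "(\<Sum>\<chi>\<in>Irr G. cmod (\<chi> \<one>) * cmod (\<chi> h))
        \<le> sqrt (\<Sum>\<chi>\<in>Irr G. (cmod (\<chi> \<one>))\<^sup>2) * sqrt (\<Sum>\<chi>\<in>Irr G. (cmod (\<chi> h))\<^sup>2)"
      using L2_set_mult_ineq[of "\<lambda>\<chi>. cmod (\<chi> \<one>)" "\<lambda>\<chi>. cmod (\<chi> h)" "Irr G"] by (simp add: L2_set_def)
    also have "\<dots> \<le> sqrt N * sqrt (N / card (conj_class h))"
      using sum_Irr_norm_le[OF fin True subset_refl one_closed] sum_Irr_norm_le[OF fin True subset_refl h]
      by (intro mult_mono real_sqrt_le_mono) (auto simp: conj_class_one N_def intro: sum_nonneg)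
    also have "\<dots> = N / sqrt (card (conj_class h))"
      using N by (simp add: real_sqrt_divide)
    finally show "(\<Sum>\<chi>\<in>Irr G. cmod (\<chi> \<one>) * cmod (\<chi> h)) \<le> N / sqrt (card (conj_class h))" .
  qed
  also have "\<dots> = N * (\<Sum>h\<in>H - {\<one>}. 1 / sqrt (card (conj_class h)))"
    by (simp add: sum_distrib_left)
  finally show ?thesis unfolding D_dist_def N_def[symmetric] using N by (simp add: field_simps)
qed

end

section \<open>Permutation groups and sampled bases\<close>

definition supp :: "('a \<Rightarrow> 'a) \<Rightarrow> 'a set" where
  "supp h = {x. h x \<noteq> x}"

definition fixer :: "('a \<Rightarrow> 'a) set \<Rightarrow> 'a set \<Rightarrow> ('a \<Rightarrow> 'a) set" where
  "fixer H B = {h \<in> H. \<forall>b\<in>B. h b = b}"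

definition orb :: "('a \<Rightarrow> 'a) set \<Rightarrow> 'a \<Rightarrow> 'a set" where
  "orb H x = (\<lambda>h. h x) ` H"

text \<open>Permutations are total functions that are the identity outside \<open>\<Omega>\<close>,
  with composition as product. In this form every \<open>fixer H B\<close> is again an instance over
  the same \<open>\<Omega>\<close>.\<close>

locale perm_group =
  fixes \<Omega> :: "'a set" and H :: "('a \<Rightarrow> 'a) set"
  assumes finite_points: "finite \<Omega>"
    and permutes: "h \<in> H \<Longrightarrow> h permutes \<Omega>"
    and id_mem: "id \<in> H"
    and comp_mem: "g \<in> H \<Longrightarrow> h \<in> H \<Longrightarrow> g \<circ> h \<in> H"
    and inv_mem: "h \<in> H \<Longrightarrow> inv' h \<in> H"
begin

lemma finite_group: "finite H"
  by (rule finite_subset[OF _ finite_permutations[OF finite_points]]) (auto intro: permutes)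

lemma supp_subset: "h \<in> H \<Longrightarrow> supp h \<subseteq> \<Omega>"
  using permutes permutes_not_in unfolding supp_def by fastforce

lemma finite_supp: "h \<in> H \<Longrightarrow> finite (supp h)"
  using supp_subset finite_points finite_subset by blast

lemma mem_points: "h \<in> H \<Longrightarrow> h x \<in> \<Omega> \<longleftrightarrow> x \<in> \<Omega>"
  by (simp add: permutes permutes_in_image)

lemma inv_apply: "h \<in> H \<Longrightarrow> inv' h (h x) = x" "h \<in> H \<Longrightarrow> h (inv' h x) = x"
  using permutes permutes_inverses by fastforce+

lemma eq_iff: "h \<in> H \<Longrightarrow> h x = h y \<longleftrightarrow> x = y"
  using inv_apply by metis

lemma perm_group_fixer: "perm_group \<Omega> (fixer H B)"
  by unfold_locales
    (auto simp: fixer_def finite_points permutes id_mem comp_mem inv_mem, metis inv_apply(1))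

lemma fixer_subset: "fixer H B \<subseteq> H"
  by (auto simp: fixer_def)

lemma fixer_fixer: "fixer (fixer H A) B = fixer H (A \<union> B)"
  by (auto simp: fixer_def)

lemma fixer_mono: "A \<subseteq> B \<Longrightarrow> fixer H B \<subseteq> fixer H A"
  by (auto simp: fixer_def)

lemma orb_refl: "x \<in> orb H x"
  unfolding orb_def using id_mem by (metis id_apply image_eqI)

lemma orb_apply: "h \<in> H \<Longrightarrow> orb H (h x) = orb H x"
proof -
  assume h: "h \<in> H"
  have "g (h x) \<in> orb H x" if "g \<in> H" for g
    using comp_mem[OF that h] unfolding orb_def by (metis comp_apply image_eqI)
  moreover have "g x \<in> orb H (h x)" if "g \<in> H" for g
    using comp_mem[OF that inv_mem[OF h]] inv_apply(1)[OF h, of x] unfolding orb_def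
    by (metis comp_apply image_eqI)
  ultimately show ?thesis by (auto simp: orb_def)
qed

lemma orb_eq: "y \<in> orb H x \<Longrightarrow> orb H y = orb H x"
  using orb_apply by (auto simp: orb_def[of H x])

lemma orb_sym: "y \<in> orb H x \<longleftrightarrow> x \<in> orb H y"
  using orb_eq orb_refl by blast

lemma orb_subset: "x \<in> \<Omega> \<Longrightarrow> orb H x \<subseteq> \<Omega>"
  by (auto simp: orb_def mem_points)

lemma finite_orb: "finite (orb H x)"
  by (simp add: orb_def finite_group)

lemma apply_mem_orb: "h \<in> H \<Longrightarrow> h y \<in> orb H x \<longleftrightarrow> y \<in> orb H x"
  using orb_apply orb_eq orb_refl by metis

lemma card_maps_to:
  assumes "y \<in> orb H x"
  shows "card {h \<in> H. h x = y} = card (fixer H {x})"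
proof -
  obtain k where k: "k \<in> H" "k x = y" using assms by (auto simp: orb_def)
  have "bij_betw (\<lambda>h. k \<circ> h) (fixer H {x}) {h \<in> H. h x = y}"
  proof (rule bij_betw_byWitness[where f' = "\<lambda>h. inv' k \<circ> h"])
    show "(\<lambda>h. inv' k \<circ> h) ` {h \<in> H. h x = y} \<subseteq> fixer H {x}"
      using k comp_mem inv_mem inv_apply by (auto simp: fixer_def)
  qed (use k comp_mem inv_apply in \<open>auto simp: fixer_def fun_eq_iff\<close>)
  from bij_betw_same_card[OF this] show ?thesis by simp
qed

lemma orbit_stabilizer: "card H = card (orb H x) * card (fixer H {x})"
proof -
  have "H = (\<Union>y\<in>orb H x. {h \<in> H. h x = y})" by (auto simp: orb_def)
  hence "card H = card (\<Union>y\<in>orb H x. {h \<in> H. h x = y})" by simp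
  also have "\<dots> = (\<Sum>y\<in>orb H x. card {h \<in> H. h x = y})"
    by (rule card_UN_disjoint) (auto simp: finite_orb finite_group)
  also have "\<dots> = card (orb H x) * card (fixer H {x})" by (simp add: card_maps_to)
  finally show ?thesis .
qed

lemma orb_fixer_conj:
  assumes "g \<in> H"
  shows "orb (fixer H {g w}) (g y) = g ` orb (fixer H {w}) y"
proof -
  have sub: "orb (fixer H {k w}) (k y) \<supseteq> k ` orb (fixer H {w}) y" if k: "k \<in> H" for k w y
  proof
    fix z assume "z \<in> k ` orb (fixer H {w}) y"
    then obtain h where h: "h \<in> H" "h w = w" "z = k (h y)" by (auto simp: orb_def fixer_def)
    have "k \<circ> h \<circ> inv' k \<in> fixer H {k w}"
      using h k by (auto simp: fixer_def comp_mem inv_mem inv_apply)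
    moreover have "z = (k \<circ> h \<circ> inv' k) (k y)" using h k by (simp add: inv_apply)
    ultimately show "z \<in> orb (fixer H {k w}) (k y)" unfolding orb_def by blast
  qed
  have "inv' g ` orb (fixer H {g w}) (g y) \<subseteq> orb (fixer H {w}) y"
    using sub[OF inv_mem[OF assms], of "g w" "g y"] assms by (simp add: inv_apply)
  hence "orb (fixer H {g w}) (g y) \<subseteq> g ` orb (fixer H {w}) y"
    using inv_apply(2)[OF assms] by (metis (no_types, lifting) image_eqI image_subset_iff subsetI)
  thus ?thesis using sub[OF assms] by blast
qed

text \<open>Babai's distinguishing set of a pair of points. Its cardinality behaves like an
  \<open>H\<close>-invariant metric: zero on the diagonal, symmetric and subadditive.\<close>

definition separators :: "'a \<Rightarrow> 'a \<Rightarrow> 'a set" where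
  "separators y z = {w \<in> \<Omega>. z \<notin> orb (fixer H {w}) y}"

lemma separators_subset: "separators y z \<subseteq> \<Omega>"
  by (auto simp: separators_def)

lemma separators_finite: "finite (separators y z)"
  using separators_subset finite_points finite_subset by blast

lemma separators_commute: "separators z y = separators y z"
  using perm_group.orb_sym[OF perm_group_fixer] by (auto simp: separators_def)

text \<open>An \<open>h\<close> that fixes \<open>w\<close> keeps \<open>h y\<close> in the orbit of
  \<open>y\<close> under the stabilizer of \<open>w\<close>. So large separator sets force large
  supports, and a list of points that meets all of them is a base.\<close>

lemma separators_apply_subset_supp: "h \<in> H \<Longrightarrow> separators y (h y) \<subseteq> supp h"
  by (auto simp: separators_def supp_def orb_def fixer_def)

end

lemma card_bounded_subsets_le:
  assumes "finite A"
  shows "card {B. B \<subseteq> A \<and> card B \<le> J} \<le> (card A + 1) ^ J"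
proof -
  have "{B. B \<subseteq> A \<and> card B \<le> J} = (\<Union>i\<le>J. {B. B \<subseteq> A \<and> card B = i})" by auto
  hence "card {B. B \<subseteq> A \<and> card B \<le> J} \<le> (\<Sum>i\<le>J. card {B. B \<subseteq> A \<and> card B = i})"
    by (simp add: card_UN_le)
  also have "\<dots> = (\<Sum>i\<le>J. card A choose i)" using assms by (simp add: n_subsets)
  also have "\<dots> \<le> (\<Sum>i\<le>J. (J choose i) * card A ^ i)"
  proof (rule sum_mono)
    fix i assume i: "i \<in> {..J}"
    have "card A choose i \<le> card A ^ i"
      by (cases "i \<le> card A") (auto intro: binomial_le_pow simp: binomial_eq_0)
    also have "\<dots> \<le> (J choose i) * card A ^ i" using i by (simp add: Suc_le_eq)
    finally show "card A choose i \<le> (J choose i) * card A ^ i" .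
  qed
  also have "\<dots> = (card A + 1) ^ J" using binomial[of "card A" 1 J] by simp
  finally show ?thesis .
qed

lemma sum_card_swap:
  assumes "finite A" "finite B"
  shows "(\<Sum>a\<in>A. card {b\<in>B. P a b}) = (\<Sum>b\<in>B. card {a\<in>A. P a b})"
proof -
  have "(\<Sum>a\<in>A. card {b\<in>B. P a b}) = (\<Sum>a\<in>A. \<Sum>b\<in>B. if P a b then 1 else 0)"
    using assms by (intro sum.cong refl) (simp add: sum.If_cases Int_def)
  also have "\<dots> = (\<Sum>b\<in>B. \<Sum>a\<in>A. if P a b then 1 else 0)" by (rule sum.swap)
  also have "\<dots> = (\<Sum>b\<in>B. card {a\<in>A. P a b})"
    using assms by (intro sum.cong refl) (simp add: sum.If_cases Int_def)
  finally show ?thesis .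
qed

text \<open>Each entry of a uniformly random list is uniform; the factor \<open>card A\<close>
  avoids the exponent \<open>b - 1\<close>.\<close>

lemma card_lists_nth_in:
  assumes "finite A" "S \<subseteq> A" "i < b"
  shows "card {xs. set xs \<subseteq> A \<and> length xs = b \<and> xs ! i \<in> S} * card A = card S * card A ^ b"
  using \<open>i < b\<close>
proof (induction b arbitrary: i)
  case (Suc b)
  have fS: "finite S" using assms finite_subset by blast
  let ?L = "\<lambda>b. {xs. set xs \<subseteq> A \<and> length xs = b}"
  have inj: "inj_on (\<lambda>(x, xs). x # xs) X" for X :: "('a \<times> 'a list) set" by (auto simp: inj_on_def)
  show ?case
  proof (cases i)
    case 0
    have "{xs. set xs \<subseteq> A \<and> length xs = Suc b \<and> xs ! i \<in> S} = (\<lambda>(x, xs). x # xs) ` (S \<times> ?L b)"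
      using assms(2) by (auto simp: 0 length_Suc_conv image_iff)
    thus ?thesis using assms fS
      by (simp add: card_image[OF inj] card_cartesian_product card_lists_length_eq)
  next
    case (Suc j)
    let ?M = "{xs. set xs \<subseteq> A \<and> length xs = b \<and> xs ! j \<in> S}"
    have "{xs. set xs \<subseteq> A \<and> length xs = Suc b \<and> xs ! i \<in> S} = (\<lambda>(x, xs). x # xs) ` (A \<times> ?M)"
      by (auto simp: Suc length_Suc_conv image_iff)
    hence "card {xs. set xs \<subseteq> A \<and> length xs = Suc b \<and> xs ! i \<in> S} = card A * card ?M"
      by (simp add: card_image[OF inj] card_cartesian_product)
    thus ?thesis using Suc.IH[of j] Suc Suc.prems by simp
  qed
qed simp

context perm_group begin

text \<open>At least half of all lists of length \<open>b\<close> are bases, and for each \<open>h\<close> at most a quarter of the lists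
  have more than \<open>J\<close> entries moved by \<open>h\<close>. So a quarter of the relevant \<open>h\<close> are determined by their
  at most \<open>J\<close> moves on one common base.\<close>

lemma card_support_le:
  assumes n: "card \<Omega> = n"
    and sep: "\<And>y z. y \<in> \<Omega> \<Longrightarrow> z \<in> \<Omega> \<Longrightarrow> y \<noteq> z \<Longrightarrow> \<theta> \<le> card (separators y z)"
    and b: "2 * n\<^sup>2 * (n - \<theta>) ^ b \<le> n ^ b"
    and J: "4 * b * k \<le> (J + 1) * n" and n0: "n > 0"
  shows "card {h \<in> H. card (supp h) = k} \<le> 4 * (n\<^sup>2 + 1) ^ J"
proof -
  define L where "L = {xs. set xs \<subseteq> \<Omega> \<and> length xs = b}"
  define good where "good xs \<longleftrightarrow> fixer H (set xs) = {id}" for xs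
  define cnt where "cnt h xs = card {i. i < b \<and> xs ! i \<in> supp h}" for h and xs :: "'a list"
  define S where "S = {h \<in> H. card (supp h) = k}"
  have finL: "finite L" and cL: "card L = n ^ b"
    unfolding L_def using finite_lists_length_eq[OF finite_points] card_lists_length_eq[OF finite_points] n by auto
  have finS: "finite S" using finite_group by (simp add: S_def)
  \<comment> \<open>Union bound over pairs of points: if \<open>u \<noteq> id\<close> fixes all
    entries and moves \<open>y\<close>, then no entry separates \<open>y\<close> from
    \<open>u y\<close>. The hypothesis on \<open>b\<close> brings the total probability down to
    1/2.\<close>
  have bad: "2 * card {xs \<in> L. \<not> good xs} \<le> n ^ b"
  proof -
    let ?P = "{p \<in> \<Omega> \<times> \<Omega>. fst p \<noteq> snd p}"
    let ?Q = "\<lambda>p. {xs. set xs \<subseteq> \<Omega> - separators (fst p) (snd p) \<and> length xs = b}"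
    have "{xs \<in> L. \<not> good xs} \<subseteq> (\<Union>p\<in>?P. ?Q p)"
    proof
      fix xs assume xs: "xs \<in> {xs \<in> L. \<not> good xs}"
      have "id \<in> fixer H (set xs)" by (simp add: fixer_def id_mem)
      then obtain u where u: "u \<in> fixer H (set xs)" "u \<noteq> id" using xs unfolding good_def by blast
      then obtain y where y: "u y \<noteq> y" by (auto simp: fun_eq_iff)
      have uH: "u \<in> H" using u by (auto simp: fixer_def)
      have "y \<in> \<Omega>" using supp_subset[OF uH] y by (auto simp: supp_def)
      moreover have "set xs \<inter> supp u = {}" using u by (auto simp: fixer_def supp_def)
      ultimately show "xs \<in> (\<Union>p\<in>?P. ?Q p)"
        using xs y separators_apply_subset_supp[OF uH, of y] mem_points[OF uH, of y]
        by (intro UN_I[of "(y, u y)"]) (auto simp: L_def)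
    qed
    moreover have "finite (\<Union>p\<in>?P. ?Q p)"
      using finite_points by (intro finite_UN_I finite_lists_length_eq) auto
    ultimately have "card {xs \<in> L. \<not> good xs} \<le> card (\<Union>p\<in>?P. ?Q p)" by (rule card_mono[rotated])
    also have "\<dots> \<le> (\<Sum>p\<in>?P. card (?Q p))" using finite_points by (intro card_UN_le) auto
    also have "\<dots> \<le> (\<Sum>p\<in>?P. (n - \<theta>) ^ b)"
    proof (rule sum_mono)
      fix p assume p: "p \<in> ?P"
      have "card (?Q p) = card (\<Omega> - separators (fst p) (snd p)) ^ b"
        using finite_points by (intro card_lists_length_eq) auto
      also have "card (\<Omega> - separators (fst p) (snd p)) = n - card (separators (fst p) (snd p))"
        using separators_subset separators_finite n by (intro card_Diff_subset[THEN trans]) auto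
      also have "\<dots> ^ b \<le> (n - \<theta>) ^ b" using sep p by (intro power_mono) (auto intro: diff_le_mono2)
      finally show "card (?Q p) \<le> (n - \<theta>) ^ b" .
    qed
    also have "\<dots> = card ?P * (n - \<theta>) ^ b" by simp
    also have "card ?P \<le> card (\<Omega> \<times> \<Omega>)" using finite_points by (intro card_mono) auto
    also have "card (\<Omega> \<times> \<Omega>) = n\<^sup>2" using n by (simp add: card_cartesian_product power2_eq_square)
    finally show ?thesis using b by simp
  qed
  \<comment> \<open>Markov's inequality: the expected number of moved entries is
    \<open>b * k / n\<close>, at most a quarter of \<open>J + 1\<close>.\<close>
  have heavy: "4 * card {xs \<in> L. cnt h xs \<ge> J + 1} \<le> n ^ b" if h: "h \<in> S" for h
  proof -
    have hk: "card (supp h) = k" "supp h \<subseteq> \<Omega>" using h supp_subset by (auto simp: S_def)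
    have "(J + 1) * card {xs \<in> L. cnt h xs \<ge> J + 1} = (\<Sum>xs\<in>{xs \<in> L. cnt h xs \<ge> J + 1}. J + 1)" by simp
    also have "\<dots> \<le> (\<Sum>xs\<in>{xs \<in> L. cnt h xs \<ge> J + 1}. cnt h xs)" by (intro sum_mono) auto
    also have "\<dots> \<le> (\<Sum>xs\<in>L. cnt h xs)" using finL by (intro sum_mono2) auto
    also have "\<dots> = (\<Sum>xs\<in>L. card {i \<in> {..<b}. xs ! i \<in> supp h})" by (simp add: cnt_def)
    also have "\<dots> = (\<Sum>i<b. card {xs \<in> L. xs ! i \<in> supp h})" using finL by (intro sum_card_swap) auto
    finally have 1: "(J + 1) * card {xs \<in> L. cnt h xs \<ge> J + 1} \<le> (\<Sum>i<b. card {xs \<in> L. xs ! i \<in> supp h})" .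
    have "(\<Sum>i<b. card {xs \<in> L. xs ! i \<in> supp h}) * n = (\<Sum>i<b. k * n ^ b)"
      unfolding sum_distrib_right
      using card_lists_nth_in[OF finite_points hk(2)] n hk(1)
      by (intro sum.cong refl) (simp add: L_def conj_assoc)
    hence 2: "(\<Sum>i<b. card {xs \<in> L. xs ! i \<in> supp h}) * n = b * (k * n ^ b)" by simp
    have "4 * ((J + 1) * card {xs \<in> L. cnt h xs \<ge> J + 1}) * n
        = 4 * (((J + 1) * card {xs \<in> L. cnt h xs \<ge> J + 1}) * n)" by (simp only: mult.assoc)
    also have "\<dots> \<le> 4 * ((\<Sum>i<b. card {xs \<in> L. xs ! i \<in> supp h}) * n)"
      by (intro mult_left_mono mult_right_mono 1) auto
    also have "\<dots> = 4 * (b * (k * n ^ b))" using 2 by simp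
    also have "\<dots> \<le> ((J + 1) * n) * n ^ b" using mult_right_mono[OF J, of "n ^ b"] by (simp add: mult_ac)
    finally have "((J + 1) * n) * (4 * card {xs \<in> L. cnt h xs \<ge> J + 1}) \<le> ((J + 1) * n) * n ^ b"
      by (simp only: mult_ac)
    thus ?thesis using n0 by (subst (asm) mult_le_cancel1) simp
  qed
  have many: "n ^ b \<le> 4 * card {xs \<in> L. good xs \<and> cnt h xs \<le> J}" if h: "h \<in> S" for h
  proof -
    have "L = {xs \<in> L. \<not> good xs} \<union> {xs \<in> L. cnt h xs \<ge> J + 1} \<union> {xs \<in> L. good xs \<and> cnt h xs \<le> J}" by auto
    hence "card L \<le> card {xs \<in> L. \<not> good xs} + card {xs \<in> L. cnt h xs \<ge> J + 1}
        + card {xs \<in> L. good xs \<and> cnt h xs \<le> J}"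
      by (metis (no_types, lifting) card_Un_le add_le_mono1 le_trans)
    thus ?thesis using bad heavy[OF h] cL by linarith
  qed
  have few: "card {h \<in> S. good xs \<and> cnt h xs \<le> J} \<le> (n\<^sup>2 + 1) ^ J" if xs: "xs \<in> L" for xs
  proof (cases "good xs")
    case True
    \<comment> \<open>The moves of \<open>h\<close> on the base. Entries that do not occur in
      \<open>gr h\<close> are fixed, so \<open>gr h\<close> determines \<open>h\<close> on the base
      and hence everywhere.\<close>
    define gr where "gr h = {p \<in> \<Omega> \<times> \<Omega>. fst p \<in> set xs \<and> h (fst p) \<noteq> fst p \<and> snd p = h (fst p)}" for h
    have xs': "set xs \<subseteq> \<Omega>" "length xs = b" using xs by (auto simp: L_def)
    have "inj_on gr H"
    proof (rule inj_onI)
      fix g h assume gh: "g \<in> H" "h \<in> H" "gr g = gr h"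
      have "g x = h x" if x: "x \<in> set xs" for x
      proof -
        have "x \<in> \<Omega>" using xs' x by auto
        have g: "g x \<noteq> x \<Longrightarrow> (x, g x) \<in> gr g" using x xs' gh(1) by (auto simp: gr_def mem_points)
        have h: "h x \<noteq> x \<Longrightarrow> (x, h x) \<in> gr h" using x xs' gh(2) by (auto simp: gr_def mem_points)
        have "h x = g x" if "g x \<noteq> x" using g[OF that] unfolding gh(3) by (auto simp: gr_def)
        moreover have "g x = h x" if "h x \<noteq> x" using h[OF that] unfolding gh(3)[symmetric] by (auto simp: gr_def)
        ultimately show ?thesis by fastforce
      qed
      hence "inv' g \<circ> h \<in> fixer H (set xs)"
        using gh by (auto simp: fixer_def comp_mem inv_mem) (metis inv_apply(1))
      hence "inv' g \<circ> h = id" using True by (simp add: good_def)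
      thus "g = h" using inv_apply(2)[OF gh(1)] by (metis comp_apply ext id_apply)
    qed
    moreover have "gr ` {h \<in> S. good xs \<and> cnt h xs \<le> J} \<subseteq> {B. B \<subseteq> \<Omega> \<times> \<Omega> \<and> card B \<le> J}"
    proof safe
      fix h assume h: "cnt h xs \<le> J"
      have "gr h \<subseteq> (\<lambda>i. (xs ! i, h (xs ! i))) ` {i. i < b \<and> xs ! i \<in> supp h}"
        using xs' by (auto simp: gr_def supp_def in_set_conv_nth image_iff)
      hence "card (gr h) \<le> cnt h xs" unfolding cnt_def by (rule surj_card_le[rotated]) auto
      thus "card (gr h) \<le> J" using h by simp
    qed (auto simp: gr_def)
    moreover have "finite {B. B \<subseteq> \<Omega> \<times> \<Omega> \<and> card B \<le> J}"
      by (rule finite_subset[of _ "Pow (\<Omega> \<times> \<Omega>)"]) (auto simp: finite_points)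
    ultimately have "card {h \<in> S. good xs \<and> cnt h xs \<le> J} \<le> card {B. B \<subseteq> \<Omega> \<times> \<Omega> \<and> card B \<le> J}"
      by (intro card_inj_on_le[of gr]) (auto simp: S_def inj_on_def)
    also have "\<dots> \<le> (card (\<Omega> \<times> \<Omega>) + 1) ^ J" using finite_points by (intro card_bounded_subsets_le) auto
    also have "card (\<Omega> \<times> \<Omega>) = n\<^sup>2" using n by (simp add: card_cartesian_product power2_eq_square)
    finally show ?thesis .
  qed simp
  have "card S * n ^ b = (\<Sum>h\<in>S. n ^ b)" by simp
  also have "\<dots> \<le> (\<Sum>h\<in>S. 4 * card {xs \<in> L. good xs \<and> cnt h xs \<le> J})" by (intro sum_mono many)
  also have "\<dots> = 4 * (\<Sum>xs\<in>L. card {h \<in> S. good xs \<and> cnt h xs \<le> J})"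
    unfolding sum_distrib_left[symmetric] using finS finL by (subst sum_card_swap) auto
  also have "\<dots> \<le> 4 * (\<Sum>xs\<in>L. (n\<^sup>2 + 1) ^ J)" by (intro mult_left_mono sum_mono few) auto
  also have "\<dots> = (4 * (n\<^sup>2 + 1) ^ J) * n ^ b" using cL by simp
  finally show ?thesis using n0 unfolding S_def[symmetric] by (subst (asm) mult_le_cancel2) simp
qed

end

text \<open>Take \<open>A\<close> maximal with this disjointness. A point of the support outside
  \<open>A\<close>, its image and its preimage could be added to \<open>A\<close>, so these three
  sets, none larger than \<open>A\<close>, cover the support.\<close>

lemma ex_displaced_subset:
  assumes fin: "finite (supp h)" and inj: "inj h"
  shows "\<exists>A \<subseteq> supp h. A \<inter> h ` A = {} \<and> card (supp h) \<le> 3 * card A"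
proof -
  define F where "F = {A. A \<subseteq> supp h \<and> A \<inter> h ` A = {}}"
  have "finite F" using fin by (simp add: F_def)
  moreover have "{} \<in> F" by (simp add: F_def)
  ultimately obtain A where A: "A \<in> F" and max: "\<And>B. B \<in> F \<Longrightarrow> A \<subseteq> B \<Longrightarrow> B = A"
    using finite_has_maximal[of F] by blast
  have A': "A \<subseteq> supp h" "A \<inter> h ` A = {}" using A by (auto simp: F_def)
  have finA: "finite A" using A' fin finite_subset by blast
  have "supp h \<subseteq> A \<union> h ` A \<union> {x. h x \<in> A}"
  proof
    fix x assume x: "x \<in> supp h"
    show "x \<in> A \<union> h ` A \<union> {x. h x \<in> A}"
    proof (rule ccontr)
      assume no: "x \<notin> A \<union> h ` A \<union> {x. h x \<in> A}"
      hence "insert x A \<in> F" using A' x by (auto simp: F_def supp_def)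
      from max[OF this] no show False by auto
    qed
  qed
  moreover have "{x. h x \<in> A} = h -` A" by auto
  ultimately have "card (supp h) \<le> card (A \<union> h ` A \<union> h -` A)"
    using finA finite_vimageI[OF finA inj] by (intro card_mono) auto
  also have "\<dots> \<le> card A + card (h ` A) + card (h -` A)"
    by (metis (no_types, lifting) card_Un_le add_le_mono1 le_trans)
  also have "card (h ` A) \<le> card A" using finA by (rule card_image_le)
  also have "card (h -` A) \<le> card A" using card_vimage_inj_on_le[OF inj finA] by simp
  finally have "card (supp h) \<le> 3 * card A" by simp
  with A' show ?thesis by (intro exI[of _ A]) simp
qed

text \<open>Take a set \<open>A\<close> displaced by \<open>h\<close> and conjugate by the
  permutations \<open>g\<close> of its image. They fix \<open>A\<close> pointwise, so the conjugate
  maps \<open>a\<close> to \<open>g (h a)\<close> and thereby determines \<open>g\<close>.\<close>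

lemma card_conj_class_sym_group:
  assumes h: "h \<in> carrier (sym_group n)"
  shows "\<exists>t. card (supp h) \<le> 3 * t \<and> fact t \<le> card {g \<circ> h \<circ> inv' g |g. g \<in> carrier (sym_group n)}"
proof -
  have hp: "h permutes {1..n}" using h by (simp add: sym_group_carrier)
  have supp: "supp h \<subseteq> {1..n}" using hp permutes_not_in unfolding supp_def by fastforce
  obtain A where A: "A \<subseteq> supp h" "A \<inter> h ` A = {}" "card (supp h) \<le> 3 * card A"
    using ex_displaced_subset[of h] supp finite_subset permutes_inj[OF hp] by blast
  have finA: "finite A" by (rule finite_subset[OF subset_trans[OF A(1) supp]]) simp
  have hA: "h ` A \<subseteq> {1..n}" using A supp permutes_image[OF hp] by blast
  let ?P = "{g. g permutes (h ` A)}" and ?C = "{g \<circ> h \<circ> inv' g |g. g \<in> carrier (sym_group n)}"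
  have conj: "(g \<circ> h \<circ> inv' g) a = g (h a)" if "g permutes (h ` A)" "a \<in> A" for g a
  proof -
    have "g a = a" using that A permutes_not_in by fastforce
    hence "inv' g a = a" using that permutes_inverses(2) by metis
    thus ?thesis by simp
  qed
  have "inj_on (\<lambda>g. g \<circ> h \<circ> inv' g) ?P"
  proof (rule inj_onI)
    fix f g assume fg: "f \<in> ?P" "g \<in> ?P" "f \<circ> h \<circ> inv' f = g \<circ> h \<circ> inv' g"
    have "f (h a) = g (h a)" if "a \<in> A" for a
      using conj[of f a] conj[of g a] fg that by simp
    hence "f x = g x" for x using fg permutes_not_in[of f "h ` A" x] permutes_not_in[of g "h ` A" x]
      by (cases "x \<in> h ` A") auto
    thus "f = g" by auto
  qed
  moreover have "(\<lambda>g. g \<circ> h \<circ> inv' g) ` ?P \<subseteq> ?C"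
    using permutes_subset[OF _ hA] by (auto simp: sym_group_carrier)
  moreover have "finite ?C"
    using finite_permutations[of "{1..n}"] by (simp add: sym_group_carrier setcompr_eq_image)
  ultimately have "card ?P \<le> card ?C" by (rule card_inj_on_le)
  moreover have "card ?P = fact (card A)"
    using finA card_image[of h A] permutes_inj_on[OF hp] by (subst card_permutations) auto
  ultimately show ?thesis using A(3) by auto
qed

section \<open>Primitive groups that are not doubly transitive\<close>

context perm_group begin

lemma separators_self: "separators y y = {}"
  using perm_group.orb_refl[OF perm_group_fixer] by (auto simp: separators_def)

lemma separators_triangle: "separators y z \<subseteq> separators y u \<union> separators u z"
  using perm_group.orb_eq[OF perm_group_fixer] by (auto simp: separators_def)

lemma separators_apply:
  assumes "g \<in> H"
  shows "separators (g y) (g z) = g ` separators y z"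
proof -
  have 1: "g w \<in> separators (g y) (g z) \<longleftrightarrow> w \<in> separators y z" if "w \<in> \<Omega>" for w
    using that assms by (auto simp: separators_def orb_fixer_conj mem_points eq_iff)
  have "v \<in> separators (g y) (g z) \<longleftrightarrow> v \<in> g ` separators y z" for v
  proof -
    have "v = g (inv' g v)" using assms by (simp add: inv_apply)
    moreover have "inv' g v \<in> \<Omega> \<longleftrightarrow> v \<in> \<Omega>" using assms by (simp add: mem_points inv_mem)
    ultimately show ?thesis using 1[of "inv' g v"] separators_subset assms
      by (smt (verit, ccfv_threshold) eq_iff image_iff subset_iff)
  qed
  thus ?thesis by blast
qed

lemma card_separators_apply: "g \<in> H \<Longrightarrow> card (separators (g y) (g z)) = card (separators y z)"
  using separators_apply eq_iff by (metis card_image inj_onI)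

text \<open>Averaging: every \<open>w\<close> separates \<open>y\<close> from at least
  \<open>a\<close> points \<open>z\<close>, so some \<open>z\<close> has at least \<open>a\<close>
  separators from \<open>y\<close>.\<close>

lemma exists_far_pair:
  assumes n: "n = card \<Omega>" "y \<in> \<Omega>"
    and a: "\<And>w. w \<in> \<Omega> \<Longrightarrow> card (orb (fixer H {w}) y) + a \<le> n"
  shows "\<exists>z\<in>\<Omega>. a \<le> card (separators y z)"
proof (rule ccontr)
  assume "\<not> ?thesis"
  hence less: "card (separators y z) < a" if "z \<in> \<Omega>" for z using that by force
  have "n * a = (\<Sum>w\<in>\<Omega>. a)" using n by simp
  also have "\<dots> \<le> (\<Sum>w\<in>\<Omega>. card {z \<in> \<Omega>. z \<notin> orb (fixer H {w}) y})"
  proof (rule sum_mono)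
    fix w assume w: "w \<in> \<Omega>"
    have "{z \<in> \<Omega>. z \<notin> orb (fixer H {w}) y} = \<Omega> - orb (fixer H {w}) y" by auto
    moreover have "orb (fixer H {w}) y \<subseteq> \<Omega>"
      using perm_group.orb_subset[OF perm_group_fixer n(2)] .
    ultimately have "card {z \<in> \<Omega>. z \<notin> orb (fixer H {w}) y} = n - card (orb (fixer H {w}) y)"
      using finite_points finite_subset n(1) card_Diff_subset by metis
    thus "a \<le> card {z \<in> \<Omega>. z \<notin> orb (fixer H {w}) y}" using a[OF w] by simp
  qed
  also have "\<dots> = (\<Sum>z\<in>\<Omega>. card (separators y z))"
    unfolding separators_def using finite_points by (intro sum_card_swap) auto
  also have "\<dots> < (\<Sum>z\<in>\<Omega>. a)"
    using less n(2) finite_points by (intro sum_strict_mono) auto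
  also have "\<dots> = n * a" using n by simp
  finally show False by simp
qed

text \<open>Let \<open>d\<close> be the valency of the graph \<open>E\<close>. If \<open>E\<close> were connected, some pair with at least \<open>a\<close>
  separators would have distance at least \<open>a/\<theta>\<close>, and disjointness of distant neighbourhoods would give
  \<open>a d \<le> 3 n \<theta>\<close>; but every point \<open>w\<close> separates at least \<open>n - 1\<close> edges (each point and its predecessor
  on a path from \<open>w\<close>), so that \<open>n - 1 \<le> d \<theta>\<close>.\<close>

theorem close_graph_disconnected:
  assumes n: "n = card \<Omega>" "n \<ge> 2" and trans: "\<And>x. x \<in> \<Omega> \<Longrightarrow> orb H x = \<Omega>"
    and a: "\<And>w y. w \<in> \<Omega> \<Longrightarrow> y \<in> \<Omega> \<Longrightarrow> card (orb (fixer H {w}) y) + a \<le> n"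
    and \<theta>: "6 * \<theta>\<^sup>2 < a"
  defines "E \<equiv> {(y, z). y \<in> \<Omega> \<and> z \<in> \<Omega> \<and> card (separators y z) \<le> \<theta>}"
  shows "\<exists>y\<in>\<Omega>. \<exists>z\<in>\<Omega>. (y, z) \<notin> E\<^sup>*"
proof (rule ccontr)
  assume "\<not> ?thesis"
  hence conn: "(y, z) \<in> E\<^sup>*" if "y \<in> \<Omega>" "z \<in> \<Omega>" for y z using that by blast
  define \<delta> where "\<delta> y z = (LEAST k. (y, z) \<in> E ^^ k)" for y z
  have refl: "(y, y) \<in> E" if "y \<in> \<Omega>" for y using that by (simp add: E_def separators_self)
  have E_sub: "E \<subseteq> \<Omega> \<times> \<Omega>" by (auto simp: E_def)
  have finE: "finite E" by (rule finite_subset[OF E_sub]) (simp add: finite_points)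
  have \<delta>: "(y, z) \<in> E ^^ \<delta> y z" if "y \<in> \<Omega>" "z \<in> \<Omega>" for y z
    unfolding \<delta>_def using conn[OF that] rtrancl_imp_relpow by (metis LeastI)
  have \<delta>_le: "\<delta> y z \<le> k" if "(y, z) \<in> E ^^ k" for y z k
    unfolding \<delta>_def using that by (rule Least_le)
  have E_inv: "(g y, g z) \<in> E" if "g \<in> H" "(y, z) \<in> E" for g y z
    using that by (auto simp: E_def mem_points card_separators_apply)
  have Ek_inv: "(g y, g z) \<in> E ^^ k" if "g \<in> H" "(y, z) \<in> E ^^ k" for g y z k
    using that(2)
  proof (induction k arbitrary: z)
    case (Suc k)
    then obtain u where "(y, u) \<in> E ^^ k" "(u, z) \<in> E" by auto
    thus ?case using Suc.IH E_inv[OF that(1)] by auto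
  qed simp
  have \<delta>_inv: "\<delta> (g y) (g z) = \<delta> y z" if g: "g \<in> H" "y \<in> \<Omega>" "z \<in> \<Omega>" for g y z
  proof (rule antisym)
    show "\<delta> (g y) (g z) \<le> \<delta> y z" using Ek_inv[OF g(1) \<delta>[OF g(2,3)]] by (rule \<delta>_le)
    have "(g y, g z) \<in> E ^^ \<delta> (g y) (g z)" using g by (intro \<delta>) (auto simp: mem_points)
    from Ek_inv[OF inv_mem[OF g(1)] this] show "\<delta> y z \<le> \<delta> (g y) (g z)"
      using g by (intro \<delta>_le) (simp add: inv_apply)
  qed
  have sep_le: "card (separators y z) \<le> k * \<theta>" if "(y, z) \<in> E ^^ k" for y z k
    using that
  proof (induction k arbitrary: z)
    case (Suc k)
    then obtain u where u: "(y, u) \<in> E ^^ k" "(u, z) \<in> E" by auto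
    have "card (separators y z) \<le> card (separators y u \<union> separators u z)"
      by (intro card_mono separators_triangle) (simp add: separators_finite)
    also have "\<dots> \<le> card (separators y u) + card (separators u z)" by (rule card_Un_le)
    also have "\<dots> \<le> k * \<theta> + \<theta>" using Suc.IH[OF u(1)] u(2) by (intro add_mono) (auto simp: E_def)
    finally show ?case by simp
  qed (simp add: separators_self)
  obtain y0 where y0: "y0 \<in> \<Omega>" using n by fastforce
  obtain z0 where z0: "z0 \<in> \<Omega>" "a \<le> card (separators y0 z0)"
    using exists_far_pair[OF n(1) y0 a[OF _ y0]] by blast
  define R where "R = \<delta> y0 z0"
  have aR: "a \<le> R * \<theta>" using sep_le[OF \<delta>[OF y0 z0(1)]] z0(2) by (simp add: R_def)
  define d where "d = card (E `` {y0})"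
  have d: "card (E `` {u}) = d" if u: "u \<in> \<Omega>" for u
  proof -
    obtain g where g: "g \<in> H" "g y0 = u" using trans[OF y0] u by (auto simp: orb_def)
    have "E `` {u} = g ` (E `` {y0})"
    proof
      show "g ` (E `` {y0}) \<subseteq> E `` {u}" using E_inv g by auto
      show "E `` {u} \<subseteq> g ` (E `` {y0})"
      proof
        fix v assume "v \<in> E `` {u}"
        hence "(inv' g u, inv' g v) \<in> E" using E_inv[OF inv_mem[OF g(1)]] by auto
        hence "inv' g v \<in> E `` {y0}" using g inv_apply(1)[OF g(1), of y0] by auto
        thus "v \<in> g ` (E `` {y0})" using inv_apply(2)[OF g(1), of v] by (metis image_eqI)
      qed
    qed
    thus ?thesis unfolding d_def using eq_iff[OF g(1)] by (metis card_image inj_onI)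
  qed
  have step: "\<delta> y v \<le> \<delta> y u + 1" if "(u, v) \<in> E" "y \<in> \<Omega>" for y u v
    using \<delta>[OF that(2), of u] that E_sub by (intro \<delta>_le) auto
  have E_sym: "(v, u) \<in> E" if "(u, v) \<in> E" for u v
    using that separators_commute by (auto simp: E_def)
  have layers: "(R + 1) * d \<le> 3 * n"
  proof -
    have "\<exists>u\<in>\<Omega>. \<delta> y0 u = i" if i: "i \<le> R" for i
    proof -
      have "(y0, z0) \<in> E ^^ (i + (R - i))" using \<delta>[OF y0 z0(1)] i by (simp add: R_def)
      then obtain u where u: "(y0, u) \<in> E ^^ i" "(u, z0) \<in> E ^^ (R - i)"
        unfolding relpow_add by auto
      have u\<Omega>: "u \<in> \<Omega>"
      proof (cases i)
        case (Suc j) thus ?thesis using u(1) E_sub by auto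
      qed (use u y0 in auto)
      have "(y0, z0) \<in> E ^^ (\<delta> y0 u + (R - i))"
        unfolding relpow_add using \<delta>[OF y0 u\<Omega>] u(2) by blast
      hence "R \<le> \<delta> y0 u + (R - i)" unfolding R_def by (rule \<delta>_le)
      thus ?thesis using \<delta>_le[OF u(1)] i u\<Omega> by (intro bexI[of _ u]) auto
    qed
    then obtain u where u: "\<And>i. i \<le> R \<Longrightarrow> u i \<in> \<Omega> \<and> \<delta> y0 (u i) = i" by metis
    \<comment> \<open>Here \<open>u i\<close> is a point at distance \<open>i\<close> from
      \<open>y0\<close> on a shortest path to \<open>z0\<close>. A neighbour \<open>v\<close> of
      \<open>u i\<close> has distance within one of \<open>i\<close>, so each \<open>v\<close> is
      counted for at most three values of \<open>i\<close>.\<close>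
    let ?near = "\<lambda>i v. \<delta> y0 v \<le> i + 1 \<and> i \<le> \<delta> y0 v + 1"
    have "(R + 1) * d = (\<Sum>i\<le>R. d)" by simp
    also have "\<dots> \<le> (\<Sum>i\<le>R. card {v \<in> \<Omega>. ?near i v})"
    proof (rule sum_mono)
      fix i assume i: "i \<in> {..R}"
      have "E `` {u i} \<subseteq> {v \<in> \<Omega>. ?near i v}"
        using step[OF _ y0] E_sym u[of i] i E_sub by fastforce
      hence "card (E `` {u i}) \<le> card {v \<in> \<Omega>. ?near i v}"
        using finite_points by (intro card_mono) auto
      thus "d \<le> card {v \<in> \<Omega>. ?near i v}" using d u[of i] i by auto
    qed
    also have "\<dots> = (\<Sum>v\<in>\<Omega>. card {i \<in> {..R}. ?near i v})"
      using finite_points by (intro sum_card_swap) auto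
    also have "\<dots> \<le> (\<Sum>v\<in>\<Omega>. 3)"
    proof (rule sum_mono)
      fix v
      have "card {i \<in> {..R}. ?near i v} \<le> card {\<delta> y0 v - 1, \<delta> y0 v, \<delta> y0 v + 1}"
        by (intro card_mono) auto
      also have "\<dots> \<le> 3" by (simp add: card_insert_if)
      finally show "card {i \<in> {..R}. ?near i v} \<le> 3" .
    qed
    finally show ?thesis using n by simp
  qed
  have edges: "n * (n - 1) \<le> n * d * \<theta>"
  proof -
    have "n * (n - 1) = (\<Sum>w\<in>\<Omega>. n - 1)" using n by simp
    also have "\<dots> \<le> (\<Sum>w\<in>\<Omega>. card {e \<in> E. w \<in> separators (fst e) (snd e)})"
    proof (rule sum_mono)
      fix w assume w: "w \<in> \<Omega>"
      have "\<exists>v. (u, v) \<in> E \<and> w \<in> separators u v" if u: "u \<in> \<Omega> - {w}" for u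
      proof -
        have "\<delta> w u \<noteq> 0" using \<delta>[OF w, of u] u by (metis DiffE insertI1 pair_in_Id_conv relpow.simps(1))
        then obtain k where k: "\<delta> w u = Suc k" by (cases "\<delta> w u") auto
        obtain v where v: "(w, v) \<in> E ^^ k" "(v, u) \<in> E" using \<delta>[OF w, of u] u unfolding k by auto
        have "v \<in> \<Omega>" using v(2) E_sub by auto
        \<comment> \<open>The stabilizer of \<open>w\<close> preserves the distance from
          \<open>w\<close>, and these distances differ by one for \<open>u\<close> and its
          predecessor \<open>v\<close>.\<close>
        moreover have "v \<notin> orb (fixer H {w}) u"
        proof
          assume "v \<in> orb (fixer H {w}) u"
          then obtain h where "h \<in> H" "h w = w" "h u = v" by (auto simp: orb_def fixer_def)
          hence "\<delta> w v = \<delta> w u" using \<delta>_inv[of h w u] w u by simp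
          thus False using \<delta>_le[OF v(1)] k by simp
        qed
        ultimately show ?thesis using E_sym[OF v(2)] w by (auto simp: separators_def)
      qed
      then obtain f where f: "\<And>u. u \<in> \<Omega> - {w} \<Longrightarrow> (u, f u) \<in> E \<and> w \<in> separators u (f u)" by metis
      have "card (\<Omega> - {w}) \<le> card {e \<in> E. w \<in> separators (fst e) (snd e)}"
        using f finE by (intro card_inj_on_le[of "\<lambda>u. (u, f u)"]) (auto simp: inj_on_def)
      thus "n - 1 \<le> card {e \<in> E. w \<in> separators (fst e) (snd e)}" using n w finite_points by simp
    qed
    also have "\<dots> = (\<Sum>e\<in>E. card {w \<in> \<Omega>. w \<in> separators (fst e) (snd e)})"
      using finite_points finE by (intro sum_card_swap)
    also have "\<dots> \<le> (\<Sum>e\<in>E. \<theta>)"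
    proof (rule sum_mono)
      fix e assume "e \<in> E"
      moreover have "{w \<in> \<Omega>. w \<in> separators (fst e) (snd e)} = separators (fst e) (snd e)"
        using separators_subset by blast
      ultimately show "card {w \<in> \<Omega>. w \<in> separators (fst e) (snd e)} \<le> \<theta>" by (auto simp: E_def)
    qed
    also have "\<dots> = card E * \<theta>" by simp
    also have "card E = (\<Sum>u\<in>\<Omega>. card (E `` {u}))"
    proof -
      have "E = (SIGMA u:\<Omega>. E `` {u})" using E_sub by auto
      moreover have "finite (E `` {u})" for u using finE by (metis Image_singleton_iff Range_iff finite_Range finite_subset subsetI)
      ultimately show ?thesis using finite_points by (metis card_SigmaI)
    qed
    also have "\<dots> = n * d" using n d by simp
    finally show ?thesis .
  qed
  have "n - 1 \<le> d * \<theta>" using edges n by (simp add: mult.assoc)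
  \<comment> \<open>The 6 in the hypothesis is this 2, which replaces \<open>n - 1\<close> by
    \<open>n\<close>, times the 3 of \<open>layers\<close>.\<close>
  have "n \<le> 2 * (n - 1)" using n by simp
  hence "a * n \<le> 2 * (a * (n - 1))" by (metis mult.left_commute mult_le_mono2)
  also have "\<dots> \<le> 2 * ((R * \<theta>) * (d * \<theta>))" using aR \<open>n - 1 \<le> d * \<theta>\<close> by (intro mult_mono) auto
  also have "\<dots> \<le> 2 * (((R + 1) * d) * \<theta>\<^sup>2)" by (simp add: power2_eq_square algebra_simps)
  also have "\<dots> \<le> 2 * ((3 * n) * \<theta>\<^sup>2)" by (rule mult_le_mono2[OF mult_le_mono1[OF layers]])
  also have "\<dots> = (6 * \<theta>\<^sup>2) * n" by simp
  finally have "a \<le> 6 * \<theta>\<^sup>2" using n by simp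
  thus False using \<theta> by simp
qed

end

section \<open>Primitivity, suborbits and the lower bound for separators\<close>

lemma primitive_orb:
  assumes "primitive n H" "perm_group {1..n} H" "x \<in> {1..n}"
  shows "orb H x = {1..n}"
proof
  show "orb H x \<subseteq> {1..n}" by (rule perm_group.orb_subset[OF assms(2,3)])
  have "\<exists>h\<in>H. h x = y" if "y \<in> {1..n}" for y
    using assms(1,3) that unfolding primitive_def by metis
  thus "{1..n} \<subseteq> orb H x" by (force simp: orb_def)
qed

text \<open>Passes from invariant partitions to invariant equivalence relations, the form in which
  blocks arise from the graphs used here.\<close>

lemma primitive_equiv_trivial:
  assumes prim: "primitive n H" and pg: "perm_group {1..n} H"
    and eq: "equiv {1..n} r" and inv: "\<And>h x y. h \<in> H \<Longrightarrow> (x, y) \<in> r \<Longrightarrow> (h x, h y) \<in> r"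
  shows "r = Id_on {1..n} \<or> r = {1..n} \<times> {1..n}"
proof -
  interpret perm_group "{1..n}" H by fact
  let ?P = "{1..n} // r"
  have r_sub: "r \<subseteq> {1..n} \<times> {1..n}" using eq by (rule equiv_type)
  have part: "partition_on {1..n} ?P" using eq by (rule partition_on_quotient)
  have img: "h ` B \<in> ?P" if h: "h \<in> H" "B \<in> ?P" for h B
  proof -
    obtain x where x: "x \<in> {1..n}" "B = r `` {x}" using h by (auto elim: quotientE)
    have "h ` (r `` {x}) = r `` {h x}"
    proof
      show "h ` (r `` {x}) \<subseteq> r `` {h x}" using inv[OF h(1)] by auto
      show "r `` {h x} \<subseteq> h ` (r `` {x})"
      proof
        fix v assume "v \<in> r `` {h x}"
        hence "(inv' h (h x), inv' h v) \<in> r" using inv[OF inv_mem[OF h(1)]] by auto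
        thus "v \<in> h ` (r `` {x})" using h(1) by (intro image_eqI[of _ _ "inv' h v"]) (auto simp: inv_apply)
      qed
    qed
    moreover have "h x \<in> {1..n}" using x h mem_points by blast
    ultimately show ?thesis using x by (auto intro: quotientI)
  qed
  have cls: "r `` {x} \<in> ?P" if "x \<in> {1..n}" for x using that by (rule quotientI)
  have "?P = {{x} | x. x \<in> {1..n}} \<or> ?P = {{1..n}}"
    using prim part img unfolding primitive_def by blast
  thus ?thesis
  proof
    assume P: "?P = {{x} | x. x \<in> {1..n}}"
    have "y = x" if "(x, y) \<in> r" for x y
    proof -
      have x: "x \<in> {1..n}" using that r_sub by auto
      have "(x, x) \<in> r" using eq x by (auto simp: equiv_def refl_on_def)
      hence "x \<in> r `` {x}" "y \<in> r `` {x}" using that by auto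
      moreover obtain z where "r `` {x} = {z}" using cls[OF x] unfolding P by auto
      ultimately have "x \<in> {z}" "y \<in> {z}" by (simp_all only:)
      thus ?thesis by simp
    qed
    moreover have "(x, x) \<in> r" if "x \<in> {1..n}" for x using eq that by (auto simp: equiv_def refl_on_def)
    ultimately have "r = Id_on {1..n}" using r_sub unfolding Id_on_def by fast
    thus ?thesis ..
  next
    assume P: "?P = {{1..n}}"
    have "(x, y) \<in> r" if "x \<in> {1..n}" "y \<in> {1..n}" for x y
    proof -
      have "r `` {x} = {1..n}" using cls[OF that(1)] unfolding P by (rule singletonD)
      thus ?thesis using that(2) by blast
    qed
    thus ?thesis using r_sub by (intro disjI2 subset_antisym) (auto simp del: atLeastAtMost_iff)
  qed
qed

context perm_group begin

definition doubly_transitive :: bool where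
  "doubly_transitive \<longleftrightarrow> (\<forall>x\<in>\<Omega>. \<forall>y\<in>\<Omega>. \<forall>u\<in>\<Omega>. \<forall>v\<in>\<Omega>. x \<noteq> y \<longrightarrow> u \<noteq> v \<longrightarrow> (\<exists>h\<in>H. h x = u \<and> h y = v))"

end

text \<open>Let \<open>\<Delta>\<close> be a largest orbit of the stabilizer of \<open>w0\<close>;
  join \<open>w0\<close> to the \<open>a\<close> points outside it and carry this relation
  \<open>r\<close> around by \<open>H\<close>. If \<open>r\<close> is not transitive, two steps lead
  from \<open>w0\<close> to a point of \<open>\<Delta>\<close> and, by invariance, to all of
  \<open>\<Delta>\<close>, so \<open>card \<Delta> \<le> a\<^sup>2\<close>. If \<open>r\<close> is a
  transitive relation with loops, it contradicts primitivity.\<close>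

lemma suborbit_bound:
  assumes prim: "primitive n H" and pg: "perm_group {1..n} H"
    and not2: "\<not> perm_group.doubly_transitive {1..n} H"
  shows "\<exists>a. n \<le> a\<^sup>2 + a \<and> (\<forall>w\<in>{1..n}. \<forall>y\<in>{1..n}. card (orb (fixer H {w}) y) + a \<le> n)"
proof -
  interpret perm_group "{1..n}" H by fact
  let ?\<Omega> = "{1..n}"
  let ?orb = "\<lambda>w. orb (fixer H {w})"
  note orb_eq' = perm_group.orb_eq[OF perm_group_fixer] and orb_refl' = perm_group.orb_refl[OF perm_group_fixer]
  have trans: "orb H x = ?\<Omega>" if "x \<in> ?\<Omega>" for x
    using primitive_orb[OF prim pg that] .
  have transE: "\<exists>g\<in>H. g x = y" if "x \<in> ?\<Omega>" "y \<in> ?\<Omega>" for x y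
    using prim that unfolding primitive_def by metis
  \<comment> \<open>Two points other than \<open>w0\<close> in different orbits of its stabilizer;
    they cannot both lie in \<open>\<Delta>\<close>, so \<open>r\<close> is not the
    identity.\<close>
  obtain w0 p q where w0: "w0 \<in> ?\<Omega>" "p \<in> ?\<Omega>" "q \<in> ?\<Omega>" "p \<noteq> w0" "q \<noteq> w0" "q \<notin> ?orb w0 p"
  proof -
    obtain x y u v where xy: "x \<in> ?\<Omega>" "y \<in> ?\<Omega>" "u \<in> ?\<Omega>" "v \<in> ?\<Omega>" "x \<noteq> y" "u \<noteq> v"
      "\<not> (\<exists>h\<in>H. h x = u \<and> h y = v)" using not2 unfolding doubly_transitive_def by blast
    obtain g where g: "g \<in> H" "g x = u" using transE[OF xy(1,3)] by blast
    have "v \<notin> ?orb u (g y)"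
    proof
      assume "v \<in> ?orb u (g y)"
      then obtain k where "k \<in> H" "k u = u" "k (g y) = v" by (auto simp: orb_def fixer_def)
      hence "k \<circ> g \<in> H" "(k \<circ> g) x = u" "(k \<circ> g) y = v" using g by (auto simp: comp_mem)
      thus False using xy(7) by blast
    qed
    moreover have "g y \<in> ?\<Omega>" "g y \<noteq> u" using g xy eq_iff[OF g(1), of y x] mem_points[OF g(1), of y] by auto
    ultimately show ?thesis using that[of u "g y" v] xy by blast
  qed
  define y0 where "y0 = (ARG_MAX (\<lambda>y. card (?orb w0 y)) y. y \<in> ?\<Omega>)"
  have "y0 \<in> ?\<Omega> \<and> (\<forall>y. y \<in> ?\<Omega> \<longrightarrow> card (?orb w0 y) \<le> card (?orb w0 y0))"
    unfolding y0_def
  proof (rule arg_max_nat_lemma[where b = "n + 1"])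
    show "w0 \<in> ?\<Omega>" by fact
    have "card (?orb w0 y) \<le> card ?\<Omega>" if "y \<in> ?\<Omega>" for y
      by (rule card_mono[OF finite_atLeastAtMost perm_group.orb_subset[OF perm_group_fixer that]])
    thus "\<forall>y. y \<in> ?\<Omega> \<longrightarrow> card (?orb w0 y) < n + 1" by (auto simp: less_Suc_eq_le)
  qed
  hence y0: "y0 \<in> ?\<Omega>" and max: "\<And>y. y \<in> ?\<Omega> \<Longrightarrow> card (?orb w0 y) \<le> card (?orb w0 y0)" by auto
  define \<Delta> where "\<Delta> = ?orb w0 y0"
  have \<Delta>: "\<Delta> \<subseteq> ?\<Omega>" "finite \<Delta>"
    using perm_group.orb_subset[OF perm_group_fixer y0] perm_group.finite_orb[OF perm_group_fixer]
    by (auto simp: \<Delta>_def simp del: One_nat_def)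
  define a where "a = n - card \<Delta>"
  have card\<Delta>: "card \<Delta> \<le> n" using card_mono[OF _ \<Delta>(1)] by simp
  have "card (?orb w y) + a \<le> n" if wy: "w \<in> ?\<Omega>" "y \<in> ?\<Omega>" for w y
  proof -
    obtain g where g: "g \<in> H" "g w = w0" using transE[OF wy(1) w0(1)] by blast
    have "card (?orb w y) = card (g ` ?orb w y)" using eq_iff[OF g(1)] by (metis card_image inj_onI)
    also have "\<dots> = card (?orb w0 (g y))" using orb_fixer_conj[OF g(1), of w y] g(2) by simp
    also have "\<dots> \<le> card \<Delta>" unfolding \<Delta>_def using mem_points[OF g(1), of y] wy by (intro max) simp
    finally show ?thesis using card\<Delta> by (simp add: a_def)
  qed
  moreover have "n \<le> a\<^sup>2 + a"
  \<comment> \<open>If \<open>w0\<close> lies in a largest orbit, this orbit is \<open>{w0}\<close>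
    and \<open>a = n - 1\<close>. Otherwise \<open>r\<close> contains the loops that an equivalence
    relation requires.\<close>
  proof (cases "w0 \<in> \<Delta>")
    case True
    hence "?orb w0 w0 = \<Delta>" unfolding \<Delta>_def by (rule orb_eq')
    moreover have "?orb w0 w0 = {w0}"
    proof
      show "?orb w0 w0 \<subseteq> {w0}" by (auto simp: orb_def fixer_def)
      show "{w0} \<subseteq> ?orb w0 w0" using orb_refl' by blast
    qed
    ultimately have "a = n - 1" by (auto simp: a_def)
    moreover have "{w0, p} \<subseteq> ?\<Omega>" using w0 by auto
    hence "card {w0, p} \<le> n" using card_mono[of ?\<Omega> "{w0, p}"] by simp
    hence "2 \<le> n" using w0 by simp
    ultimately show ?thesis by (cases n) (auto simp: power2_eq_square)
  next
    case False
    define r where "r = {(g w0, g z) |g z. g \<in> H \<and> z \<in> ?\<Omega> - \<Delta>}"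
    have r_inv: "(h x, h y) \<in> r" if hxy: "h \<in> H" "(x, y) \<in> r" for h x y
    proof -
      obtain g z where "x = g w0" "y = g z" "g \<in> H" "z \<in> ?\<Omega> - \<Delta>" using hxy(2) by (auto simp: r_def)
      thus ?thesis using comp_mem[OF hxy(1), of g] unfolding r_def
        by (intro CollectI exI[of _ "h \<circ> g"] exI[of _ z]) auto
    qed
    have r_sub: "r \<subseteq> ?\<Omega> \<times> ?\<Omega>" using w0(1) mem_points by (fastforce simp: r_def)
    have r0: "r `` {w0} = ?\<Omega> - \<Delta>"
    proof
      show "?\<Omega> - \<Delta> \<subseteq> r `` {w0}"
      proof
        fix z assume "z \<in> ?\<Omega> - \<Delta>"
        hence "(id w0, id z) \<in> r" unfolding r_def using id_mem by blast
        thus "z \<in> r `` {w0}" by simp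
      qed
      show "r `` {w0} \<subseteq> ?\<Omega> - \<Delta>"
      proof
        fix y assume "y \<in> r `` {w0}"
        hence "(w0, y) \<in> r" by simp
        then obtain g z where "w0 = g w0" and g: "y = g z" "g \<in> H" "z \<in> ?\<Omega> - \<Delta>"
          unfolding r_def by blast
        hence "g \<in> fixer H {w0}" using g(2) by (auto simp: fixer_def)
        hence "y \<notin> \<Delta>" using g perm_group.apply_mem_orb[OF perm_group_fixer] unfolding \<Delta>_def by blast
        thus "y \<in> ?\<Omega> - \<Delta>" using g mem_points[OF g(2), of z] by auto
      qed
    qed
    have r_img: "r `` {g x} = g ` (r `` {x})" if g: "g \<in> H" for g x
    proof
      show "g ` (r `` {x}) \<subseteq> r `` {g x}" using r_inv[OF g] by auto
      show "r `` {g x} \<subseteq> g ` (r `` {x})"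
      proof
        fix v assume "v \<in> r `` {g x}"
        hence "(inv' g (g x), inv' g v) \<in> r" using r_inv[OF inv_mem[OF g]] by auto
        thus "v \<in> g ` (r `` {x})" using g by (intro image_eqI[of _ _ "inv' g v"]) (auto simp: inv_apply)
      qed
    qed
    have card_r0: "card (r `` {w0}) = a" using card_Diff_subset[OF \<Delta>(2,1)] by (simp add: r0 a_def)
    have card_r: "card (r `` {x}) = a" if x: "x \<in> ?\<Omega>" for x
    proof -
      obtain g where g: "g \<in> H" "g w0 = x" using transE[OF w0(1) x] by blast
      hence "r `` {x} = g ` (r `` {w0})" using r_img by blast
      thus ?thesis using eq_iff[OF g(1)] card_r0 by (metis card_image inj_onI)
    qed
    have fin_r: "finite (r `` {x})" for x by (rule finite_subset[of _ ?\<Omega>]) (use r_sub in auto)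
    have w0r: "w0 \<in> r `` {w0}" using False w0(1) by (simp add: r0)
    show ?thesis
    proof (cases "\<forall>y\<in>r `` {w0}. r `` {y} \<subseteq> r `` {w0}")
      case True
      \<comment> \<open>All neighbourhoods have the same size \<open>a\<close>, so inclusion is
        equality; this makes \<open>r\<close> an equivalence relation.\<close>
      have cls0: "r `` {y} = r `` {w0}" if "y \<in> r `` {w0}" for y
        using True that card_r[of y] card_r0 fin_r r_sub by (intro card_subset_eq) auto
      have cls: "r `` {y} = r `` {x}" if "(x, y) \<in> r" for x y
      proof -
        have "x \<in> ?\<Omega>" using that r_sub by auto
        obtain g where g: "g \<in> H" "g w0 = x" using transE[OF w0(1) \<open>x \<in> ?\<Omega>\<close>] by blast
        hence "y \<in> g ` (r `` {w0})" using r_img[OF g(1), of w0] that by auto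
        then obtain z where "z \<in> r `` {w0}" "y = g z" by auto
        thus ?thesis using cls0[of z] r_img[OF g(1)] g(2) by metis
      qed
      have refl: "(x, x) \<in> r" if x: "x \<in> ?\<Omega>" for x
      proof -
        obtain g where "g \<in> H" "g w0 = x" using transE[OF w0(1) x] by blast
        thus ?thesis using r_inv[of g w0 w0] w0r by auto
      qed
      have "equiv ?\<Omega> r"
      proof (rule equivI)
        show "sym r" unfolding sym_def using cls refl r_sub by blast
        show "trans r" unfolding trans_def using cls by blast
        show "refl_on ?\<Omega> r" unfolding refl_on_def using refl r_sub by blast
      qed (use r_sub in auto)
      hence "r = Id_on ?\<Omega> \<or> r = ?\<Omega> \<times> ?\<Omega>"
        by (rule primitive_equiv_trivial[OF prim pg]) (rule r_inv)
      moreover have "r \<noteq> ?\<Omega> \<times> ?\<Omega>"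
      proof
        assume "r = ?\<Omega> \<times> ?\<Omega>"
        hence "y0 \<in> r `` {w0}" using y0 w0 by auto
        thus False unfolding r0 \<Delta>_def using orb_refl' by blast
      qed
      moreover have "r \<noteq> Id_on ?\<Omega>"
      proof
        assume "r = Id_on ?\<Omega>"
        hence "r `` {w0} \<subseteq> {w0}" by auto
        hence "p \<in> \<Delta>" "q \<in> \<Delta>" using w0 unfolding r0 by auto
        thus False using w0(6) orb_eq' orb_refl' unfolding \<Delta>_def by blast
      qed
      ultimately show ?thesis by blast
    next
      case False
      then obtain y z where yz: "y \<in> r `` {w0}" "z \<in> r `` {y}" "z \<notin> r `` {w0}" by blast
      have "z \<in> ?\<Omega>" using yz(2) r_sub by auto
      hence z\<Delta>: "z \<in> \<Delta>" using yz(3) unfolding r0 by auto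
      have "\<Delta> \<subseteq> (\<Union>x\<in>r `` {w0}. r `` {x})"
      proof
        fix v assume "v \<in> \<Delta>"
        moreover have "?orb w0 z = \<Delta>" using z\<Delta> unfolding \<Delta>_def by (rule orb_eq')
        ultimately obtain h where h: "h \<in> H" "h w0 = w0" "v = h z" by (auto simp: orb_def fixer_def)
        have "(w0, h y) \<in> r" using r_inv[OF h(1), of w0 y] yz(1) h(2) by auto
        moreover have "(h y, v) \<in> r" using r_inv[OF h(1), of y z] yz(2) h(3) by auto
        ultimately show "v \<in> (\<Union>x\<in>r `` {w0}. r `` {x})" by auto
      qed
      hence "card \<Delta> \<le> card (\<Union>x\<in>r `` {w0}. r `` {x})" using fin_r by (intro card_mono) auto
      also have "\<dots> \<le> (\<Sum>x\<in>r `` {w0}. card (r `` {x}))" using fin_r by (intro card_UN_le) auto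
      also have "\<dots> = (\<Sum>x\<in>r `` {w0}. a)" using card_r r_sub by (intro sum.cong) auto
      also have "\<dots> = a\<^sup>2" using card_r0 by (simp add: power2_eq_square)
      finally show ?thesis by (simp add: a_def)
    qed
  qed
  ultimately show ?thesis by blast
qed

text \<open>Connectedness in the graph of pairs with at most \<open>\<theta>\<close> separators is
  an invariant equivalence relation. It is not total by \<open>close_graph_disconnected\<close>, so
  by primitivity no two distinct points are joined. The hypothesis on \<open>\<theta>\<close> forces
  \<open>6 * \<theta>\<^sup>2 < a\<close> because \<open>n \<le> a\<^sup>2 + a\<close>.\<close>

lemma separators_large:
  assumes prim: "primitive n H" and pg: "perm_group {1..n} H"
    and not2: "\<not> perm_group.doubly_transitive {1..n} H"
    and \<theta>: "(6 * \<theta>\<^sup>2)\<^sup>2 + 6 * \<theta>\<^sup>2 < n" and yz: "y \<in> {1..n}" "z \<in> {1..n}" "y \<noteq> z"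
  shows "\<theta> < card (perm_group.separators {1..n} H y z)"
proof -
  interpret perm_group "{1..n}" H by fact
  obtain a where a: "n \<le> a\<^sup>2 + a" "\<And>w y. w \<in> {1..n} \<Longrightarrow> y \<in> {1..n} \<Longrightarrow> card (orb (fixer H {w}) y) + a \<le> n"
    using suborbit_bound[OF prim pg not2] by blast
  have a\<theta>: "6 * \<theta>\<^sup>2 < a"
  proof (rule ccontr)
    assume "\<not> ?thesis"
    hence "a \<le> 6 * \<theta>\<^sup>2" by simp
    hence "a\<^sup>2 + a \<le> (6 * \<theta>\<^sup>2)\<^sup>2 + 6 * \<theta>\<^sup>2" by (intro add_mono power_mono) auto
    thus False using \<theta> a(1) by simp
  qed
  have trans: "orb H x = {1..n}" if "x \<in> {1..n}" for x
    using primitive_orb[OF prim pg that] .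
  define E where "E = {(y, z). y \<in> {1..n} \<and> z \<in> {1..n} \<and> card (separators y z) \<le> \<theta>}"
  have n2: "n \<ge> 2" using yz by auto
  obtain u v where uv: "u \<in> {1..n}" "v \<in> {1..n}" "(u, v) \<notin> E\<^sup>*"
    using close_graph_disconnected[OF _ n2 trans a(2) a\<theta>] unfolding E_def by auto
  define r where "r = E\<^sup>* \<inter> {1..n} \<times> {1..n}"
  have "sym E"
    using separators_commute by (auto simp: E_def sym_def)
  hence "sym (E\<^sup>*)" by (rule sym_rtrancl)
  hence eq: "equiv {1..n} r"
    by (intro equivI) (auto simp: r_def refl_on_def sym_def trans_def intro: rtrancl_trans)
  have E_inv: "(h x, h y) \<in> E" if "h \<in> H" "(x, y) \<in> E" for h x y
    using that mem_points[OF that(1)] by (simp add: E_def card_separators_apply del: One_nat_def atLeastAtMost_iff)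
  have "(h x, h y) \<in> E\<^sup>*" if h: "h \<in> H" "(x, y) \<in> E\<^sup>*" for h x y
    using h(2) by (induction rule: rtrancl_induct) (use E_inv[OF h(1)] in \<open>auto intro: rtrancl_into_rtrancl\<close>)
  hence r_inv: "(h x, h y) \<in> r" if "h \<in> H" "(x, y) \<in> r" for h x y
    using that mem_points[OF that(1)] by (simp add: r_def)
  have "r = Id_on {1..n} \<or> r = {1..n} \<times> {1..n}"
    by (rule primitive_equiv_trivial[OF prim pg eq]) (rule r_inv)
  moreover have "(u, v) \<notin> r" using uv(3) by (simp add: r_def)
  hence "r \<noteq> {1..n} \<times> {1..n}" using uv(1,2) by blast
  ultimately have "r = Id_on {1..n}" by argo
  hence "(y, z) \<notin> r" using yz(3) by auto
  hence "(y, z) \<notin> E" using yz(1,2) unfolding r_def by blast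
  thus ?thesis using yz(1,2) unfolding E_def by simp
qed

section \<open>The minimal degree of doubly transitive groups\<close>

context perm_group begin

lemma supp_nonempty: "h \<in> H \<Longrightarrow> h \<noteq> id \<Longrightarrow> supp h \<noteq> {}"
  by (auto simp: supp_def fun_eq_iff)

text \<open>For a random \<open>g\<close>, the pair \<open>(inv' g a, inv' g b)\<close> is uniform
  on the ordered pairs of distinct points, since every fibre \<open>K p\<close> is a coset of the
  stabilizer of \<open>a\<close> and \<open>b\<close>.\<close>

lemma card_pair_orbit:
  assumes dt: "doubly_transitive"
    and A: "A \<subseteq> \<Omega> \<times> \<Omega>" "\<And>p. p \<in> A \<Longrightarrow> fst p \<noteq> snd p"
    and ab: "a \<in> \<Omega>" "b \<in> \<Omega>" "a \<noteq> b"
  shows "card {g \<in> H. (inv' g a, inv' g b) \<in> A} * (card \<Omega> * (card \<Omega> - 1)) = card A * card H"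
proof -
  let ?D = "{p \<in> \<Omega> \<times> \<Omega>. fst p \<noteq> snd p}"
  define K where "K p = {g \<in> H. g (fst p) = a \<and> g (snd p) = b}" for p
  have K_alt: "{g \<in> H. (inv' g a, inv' g b) \<in> A} = (\<Union>p\<in>A. K p)"
    by (auto simp: K_def inv_apply)
  have finA: "finite A" using A(1) finite_points finite_subset by blast
  have disj: "\<And>p q. p \<noteq> q \<Longrightarrow> K p \<inter> K q = {}" using eq_iff by (auto simp: K_def prod_eq_iff)
  have finK: "finite (K p)" for p using finite_group by (auto simp: K_def)
  have same: "card (K p) = card (fixer H {a, b})" if p: "p \<in> ?D" for p
  proof -
    have "fst p \<in> \<Omega>" "snd p \<in> \<Omega>" "fst p \<noteq> snd p" using p by auto
    then obtain k where k: "k \<in> H" "k (fst p) = a" "k (snd p) = b"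
      using dt[unfolded doubly_transitive_def, rule_format, OF _ _ ab(1,2) _ ab(3)] by blast
    have "bij_betw (\<lambda>g. g \<circ> k) (fixer H {a, b}) (K p)"
    proof (rule bij_betw_byWitness[where f' = "\<lambda>g. g \<circ> inv' k"])
      show "(\<lambda>g. g \<circ> inv' k) ` K p \<subseteq> fixer H {a, b}"
      proof -
        have "inv' k a = fst p" "inv' k b = snd p" using k inv_apply(1)[OF k(1)] by metis+
        thus ?thesis using k by (auto simp: K_def fixer_def comp_mem inv_mem)
      qed
      show "(\<lambda>g. g \<circ> k) ` fixer H {a, b} \<subseteq> K p"
        using k by (auto simp: K_def fixer_def comp_mem)
    qed (auto simp: fun_eq_iff inv_apply[OF k(1)])
    from bij_betw_same_card[OF this] show ?thesis by simp
  qed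
  have count: "card (\<Union>p\<in>B. K p) = card B * card (fixer H {a, b})" if B: "B \<subseteq> ?D" for B
  proof -
    have "finite B" by (rule finite_subset[OF B]) (simp add: finite_points)
    hence "card (\<Union>p\<in>B. K p) = (\<Sum>p\<in>B. card (K p))"
      using disj finK by (intro card_UN_disjoint) auto
    also have "\<dots> = (\<Sum>p\<in>B. card (fixer H {a, b}))" using same B by (intro sum.cong refl) blast
    also have "\<dots> = card B * card (fixer H {a, b})" by simp
    finally show ?thesis .
  qed
  have "(\<Union>p\<in>?D. K p) = H"
  proof
    show "(\<Union>p\<in>?D. K p) \<subseteq> H" by (auto simp: K_def)
    show "H \<subseteq> (\<Union>p\<in>?D. K p)"
    proof
      fix g assume g: "g \<in> H"
      have "(inv' g a, inv' g b) \<in> ?D"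
        using ab g mem_points[OF inv_mem[OF g]] eq_iff[OF inv_mem[OF g]] by simp
      moreover have "g \<in> K (inv' g a, inv' g b)" using g by (simp add: K_def inv_apply)
      ultimately show "g \<in> (\<Union>p\<in>?D. K p)" by blast
    qed
  qed
  moreover have "card ?D = card \<Omega> * (card \<Omega> - 1)"
  proof -
    have "?D = (SIGMA x:\<Omega>. \<Omega> - {x})" by auto
    thus ?thesis using finite_points by simp
  qed
  ultimately have "card H = card \<Omega> * (card \<Omega> - 1) * card (fixer H {a, b})"
    using count[of ?D] by simp
  moreover have "A \<subseteq> ?D" using A by auto
  ultimately show ?thesis using count[of A] K_alt by simp
qed

text \<open>Compare \<open>u\<close>, of minimal support \<open>S\<close>, with a random conjugate
  \<open>v\<close>. Their commutator moves at most three times as many points as the supports have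
  in common, which is \<open>X g\<close>; so \<open>m \<le> 3 * X g\<close> unless \<open>u\<close>
  and \<open>v\<close> commute. Averaging over \<open>g\<close> only needs the distribution of
  pairs, which double transitivity supplies.\<close>

theorem minimal_degree_linear:
  assumes dt: "doubly_transitive"
    and u: "u \<in> H" "u \<noteq> id" and min: "\<And>h. h \<in> H \<Longrightarrow> h \<noteq> id \<Longrightarrow> card (supp u) \<le> card (supp h)"
    and m4: "card (supp u) \<ge> 4"
  shows "card \<Omega> \<le> 10 * card (supp u)"
proof -
  define S where "S = supp u"
  define m where "m = card S"
  define n where "n = card \<Omega>"
  define X where "X g = card {x \<in> S. inv' g x \<in> S}" for g
  \<comment> \<open>Counts witnesses of non-commutation: the conjugate \<open>v\<close> fixes
    \<open>a\<close> but moves \<open>u a\<close>, so \<open>v (u a)\<close> differs from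
    \<open>u (v a)\<close>.\<close>
  define c where "c g = card {a \<in> S. inv' g a \<in> \<Omega> - S \<and> inv' g (u a) \<in> S}" for g
  have S: "S \<subseteq> \<Omega>" "finite S" using supp_subset[OF u(1)] finite_supp[OF u(1)] by (auto simp: S_def)
  have mn: "m \<le> n" unfolding m_def n_def using S finite_points by (intro card_mono) auto
  have m4': "m \<ge> 4" using m4 by (simp add: m_def S_def)
  have uS: "u a \<in> S \<longleftrightarrow> a \<in> S" for a using eq_iff[OF u(1)] by (auto simp: S_def supp_def)
  \<comment> \<open>If \<open>c g > 0\<close> then \<open>m \<le> 3 * X g\<close>, and
    \<open>c g \<le> X g\<close> since \<open>u\<close> maps the witnesses into the overlap. The
    product \<open>X g * (X g - 1)\<close> counts ordered pairs and so can be averaged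
    exactly.\<close>
  have key: "c g * (m - 3) \<le> 3 * (X g * (X g - 1))" if g: "g \<in> H" for g
  proof (cases "c g = 0")
    case False
    define v where "v = g \<circ> u \<circ> inv' g"
    have v: "v \<in> H" using g u by (simp add: v_def comp_mem inv_mem)
    have vsupp: "x \<in> supp v \<longleftrightarrow> inv' g x \<in> S" for x
      using eq_iff[OF g, of "u (inv' g x)" "inv' g x"]
      by (simp add: supp_def v_def S_def inv_apply(2)[OF g])
    let ?J = "{x \<in> S. inv' g x \<in> S}"
    have finJ: "finite ?J" using S by simp
    have "{a \<in> S. inv' g a \<in> \<Omega> - S \<and> inv' g (u a) \<in> S} \<noteq> {}"
      using False unfolding c_def by (metis card.empty)
    then obtain a where a: "a \<in> S" "a \<notin> supp v" "u a \<in> supp v" using vsupp by blast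
    define w where "w = inv' (v \<circ> u) \<circ> (u \<circ> v)"
    have w: "w \<in> H" using u v by (simp add: w_def comp_mem inv_mem)
    have wx: "w x \<noteq> x \<longleftrightarrow> u (v x) \<noteq> v (u x)" for x
      unfolding w_def using inv_apply[OF comp_mem[OF v u(1)]] by (metis comp_apply)
    have "u (v a) \<noteq> v (u a)" using a by (simp add: supp_def)
    hence "w \<noteq> id" using wx[of a] by auto
    from min[OF w this] have "m \<le> card (supp w)" by (simp add: m_def S_def)
    also have "\<dots> \<le> card (?J \<union> inv' u ` ?J \<union> inv' v ` ?J)"
    proof (rule card_mono)
      \<comment> \<open>For a point moved by the commutator, the point itself, its image under
        \<open>u\<close> or its image under \<open>v\<close> lies in both supports.\<close>
      show "supp w \<subseteq> ?J \<union> inv' u ` ?J \<union> inv' v ` ?J"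
      proof
        fix x assume "x \<in> supp w"
        hence ne: "u (v x) \<noteq> v (u x)" using wx by (simp add: supp_def)
        have uJ: "x \<in> inv' u ` ?J" if "u x \<in> ?J" using that inv_apply(1)[OF u(1)] by (metis image_eqI)
        have vJ: "x \<in> inv' v ` ?J" if "v x \<in> ?J" using that inv_apply(1)[OF v] by (metis image_eqI)
        have vv: "v x \<in> supp v \<longleftrightarrow> x \<in> supp v" using eq_iff[OF v] by (auto simp: supp_def)
        show "x \<in> ?J \<union> inv' u ` ?J \<union> inv' v ` ?J"
        proof (cases "x \<in> S")
          case True
          show ?thesis
          proof (cases "x \<in> supp v")
            case False
            hence "v x = x" by (simp add: supp_def)
            hence "u x \<in> supp v" using ne by (simp add: supp_def)
            thus ?thesis using True uS vsupp uJ by blast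
          qed (use True vsupp in blast)
        next
          case False
          hence "u x = x" by (simp add: S_def supp_def)
          hence "v x \<in> S" "v x \<noteq> x" using ne \<open>u x = x\<close> by (auto simp: S_def supp_def)
          hence "v x \<in> supp v" using vv by (simp add: supp_def)
          thus ?thesis using \<open>v x \<in> S\<close> vsupp vJ by blast
        qed
      qed
    qed (use finJ in auto)
    also have "\<dots> \<le> card ?J + card (inv' u ` ?J) + card (inv' v ` ?J)"
      by (metis (no_types, lifting) card_Un_le add_le_mono1 le_trans)
    also have "\<dots> \<le> card ?J + card ?J + card ?J"
      using finJ by (intro add_mono card_image_le) auto
    finally have m3: "m \<le> 3 * X g" by (simp add: X_def)
    have "c g \<le> X g"
      unfolding c_def X_def using finJ eq_iff[OF u(1)] uS
      by (intro card_inj_on_le[of u]) (auto simp: inj_on_def)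
    hence "c g * (m - 3) \<le> X g * (3 * (X g - 1))" using m3 by (intro mult_mono) auto
    thus ?thesis by (simp add: mult_ac)
  qed simp
  have sum_c: "(\<Sum>g\<in>H. c g) * (n * (n - 1)) = m * ((n - m) * m) * card H"
  proof -
    have "(\<Sum>g\<in>H. c g) = (\<Sum>a\<in>S. card {g \<in> H. (inv' g a, inv' g (u a)) \<in> (\<Omega> - S) \<times> S})"
      unfolding c_def using finite_group S by (subst sum_card_swap) auto
    moreover have "card {g \<in> H. (inv' g a, inv' g (u a)) \<in> (\<Omega> - S) \<times> S} * (n * (n - 1))
        = ((n - m) * m) * card H" if "a \<in> S" for a
    proof -
      have "card ((\<Omega> - S) \<times> S) = (n - m) * m"
        using S by (simp add: card_cartesian_product card_Diff_subset n_def m_def)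
      moreover have "a \<in> \<Omega>" "u a \<in> \<Omega>" "a \<noteq> u a" using that S uS by (auto simp: S_def supp_def)
      moreover have "(\<Omega> - S) \<times> S \<subseteq> \<Omega> \<times> \<Omega>" "\<And>p. p \<in> (\<Omega> - S) \<times> S \<Longrightarrow> fst p \<noteq> snd p"
        using S by auto
      ultimately show ?thesis
        using card_pair_orbit[OF dt, of "(\<Omega> - S) \<times> S" a "u a"] by (simp add: n_def)
    qed
    ultimately show ?thesis by (simp add: sum_distrib_right m_def)
  qed
  have card_off: "card {p \<in> T \<times> T. fst p \<noteq> snd p} = card T * (card T - 1)" if "finite T" for T :: "'a set"
  proof -
    have "{p \<in> T \<times> T. fst p \<noteq> snd p} = (SIGMA x:T. T - {x})" by auto
    thus ?thesis using that by simp
  qed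
  have sum_X: "(\<Sum>g\<in>H. X g * (X g - 1)) * (n * (n - 1)) = (m * (m - 1)) * (m * (m - 1)) * card H"
  proof -
    let ?P = "{p \<in> S \<times> S. fst p \<noteq> snd p}"
    have "(\<Sum>g\<in>H. X g * (X g - 1)) = (\<Sum>g\<in>H. card {p \<in> ?P. (inv' g (fst p), inv' g (snd p)) \<in> ?P})"
    proof (rule sum.cong)
      fix g assume g: "g \<in> H"
      have "{p \<in> ?P. (inv' g (fst p), inv' g (snd p)) \<in> ?P}
        = {p \<in> {x \<in> S. inv' g x \<in> S} \<times> {x \<in> S. inv' g x \<in> S}. fst p \<noteq> snd p}"
        using eq_iff[OF inv_mem[OF g]] by auto
      thus "X g * (X g - 1) = card {p \<in> ?P. (inv' g (fst p), inv' g (snd p)) \<in> ?P}"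
        using card_off[of "{x \<in> S. inv' g x \<in> S}"] S by (simp add: X_def)
    qed simp
    also have "\<dots> = (\<Sum>p\<in>?P. card {g \<in> H. (inv' g (fst p), inv' g (snd p)) \<in> ?P})"
      using S finite_group by (intro sum_card_swap) auto
    finally have 1: "(\<Sum>g\<in>H. X g * (X g - 1)) = \<dots>" .
    have "card {g \<in> H. (inv' g (fst p), inv' g (snd p)) \<in> ?P} * (n * (n - 1)) = card ?P * card H"
      if "p \<in> ?P" for p
    proof -
      have "fst p \<in> \<Omega>" "snd p \<in> \<Omega>" "fst p \<noteq> snd p" "?P \<subseteq> \<Omega> \<times> \<Omega>" using that S(1) by auto
      thus ?thesis unfolding n_def using card_pair_orbit[OF dt, of ?P "fst p" "snd p"] by blast
    qed
    thus ?thesis unfolding 1 using card_off[OF S(2)] by (simp add: sum_distrib_right m_def)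
  qed
  have cH: "card H > 0" using finite_group id_mem by (auto simp: card_gt_0_iff)
  have "(\<Sum>g\<in>H. c g) * (m - 3) \<le> 3 * (\<Sum>g\<in>H. X g * (X g - 1))"
    unfolding sum_distrib_right sum_distrib_left by (intro sum_mono key)
  hence "((\<Sum>g\<in>H. c g) * (m - 3)) * (n * (n - 1)) \<le> (3 * (\<Sum>g\<in>H. X g * (X g - 1))) * (n * (n - 1))"
    by (rule mult_le_mono1)
  hence "((\<Sum>g\<in>H. c g) * (n * (n - 1))) * (m - 3) \<le> 3 * ((\<Sum>g\<in>H. X g * (X g - 1)) * (n * (n - 1)))"
    by (simp only: mult_ac)
  hence "(m * m * card H) * ((n - m) * (m - 3)) \<le> (m * m * card H) * (3 * ((m - 1) * (m - 1)))"
    unfolding sum_c sum_X by (simp only: mult_ac)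
  hence "(n - m) * (m - 3) \<le> 3 * ((m - 1) * (m - 1))"
    using cH m4' by (subst (asm) mult_le_cancel1) simp
  \<comment> \<open>From \<open>m \<ge> 4\<close> follows \<open>m - 1 \<le> 3 * (m - 3)\<close>, so
    that \<open>m - 3\<close> cancels; the resulting 9 becomes 10 when \<open>m\<close> is moved to
    the right.\<close>
  also have "\<dots> \<le> 3 * ((m - 1) * (3 * (m - 3)))" using m4' by (intro mult_le_mono2) auto
  finally have "(n - m) * (m - 3) \<le> (9 * (m - 1)) * (m - 3)" by (simp add: mult_ac)
  hence "n - m \<le> 9 * (m - 1)" using m4' by (subst (asm) mult_le_cancel2) simp
  thus ?thesis using m4' mn by (simp add: n_def m_def S_def)
qed

end

section \<open>Three-cycles and elements of support at most three\<close>

definition cyc3 :: "'a \<Rightarrow> 'a \<Rightarrow> 'a \<Rightarrow> 'a \<Rightarrow> 'a" where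
  "cyc3 a b c = transpose a b \<circ> transpose b c"

lemma cyc3_apply:
  assumes "distinct [a, b, c]"
  shows "cyc3 a b c a = b" "cyc3 a b c b = c" "cyc3 a b c c = a" "x \<notin> {a, b, c} \<Longrightarrow> cyc3 a b c x = x"
  using assms by (auto simp: cyc3_def transpose_def)

lemma cyc3_eqI:
  assumes "distinct [a, b, c]" "f a = b" "f b = c" "f c = a" "\<And>x. x \<notin> {a, b, c} \<Longrightarrow> f x = x"
  shows "f = cyc3 a b c"
proof
  fix x
  consider "x = a" | "x = b" | "x = c" | "x \<notin> {a, b, c}" by blast
  thus "f x = cyc3 a b c x"
    by cases (simp_all only: assms(2-5) cyc3_apply[OF assms(1)] simp_thms)
qed

lemma (in perm_group) cyc3_conj:
  assumes "g \<in> H" "cyc3 a b c \<in> H" "distinct [a, b, c]"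
  shows "cyc3 (g a) (g b) (g c) \<in> H"
proof -
  have "g \<circ> cyc3 a b c \<circ> inv' g = cyc3 (g a) (g b) (g c)"
  proof (rule cyc3_eqI)
    show "distinct [g a, g b, g c]" using assms(3) eq_iff[OF assms(1)] by auto
    fix x assume "x \<notin> {g a, g b, g c}"
    hence "inv' g x \<notin> {a, b, c}" using inv_apply(2)[OF assms(1), of x] by auto
    thus "(g \<circ> cyc3 a b c \<circ> inv' g) x = x" using cyc3_apply(4)[OF assms(3)] inv_apply(2)[OF assms(1)] by simp
  qed (simp_all add: cyc3_apply[OF assms(3)] inv_apply[OF assms(1)])
  thus ?thesis using assms by (metis comp_mem inv_mem)
qed

lemma cyc3_rotate: "distinct [a, b, c] \<Longrightarrow> cyc3 b c a = cyc3 a b c"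
  by (rule cyc3_eqI) (auto simp: cyc3_apply)

lemma (in perm_group) cyc3_inv:
  assumes "cyc3 a b c \<in> H" "distinct [a, b, c]"
  shows "cyc3 c b a \<in> H"
proof -
  have "cyc3 a b c \<circ> cyc3 a b c = cyc3 c b a"
    using assms(2) by (intro cyc3_eqI) (auto simp: cyc3_apply)
  thus ?thesis using comp_mem[OF assms(1,1)] by simp
qed

text \<open>Conjugation moves the first two points of a 3-cycle anywhere, so \<open>H\<close>
  contains some \<open>cyc3 a b d\<close> and \<open>cyc3 b c f\<close>. Conjugating the former by
  the latter, and in the generic case once more by the result, gives \<open>cyc3 a b c\<close> up to
  inversion.\<close>

lemma (in perm_group) all_cyc3_mem:
  assumes dt: "doubly_transitive" and xyz: "cyc3 x y z \<in> H" "distinct [x, y, z]" "{x, y, z} \<subseteq> \<Omega>"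
    and abc: "distinct [a, b, c]" "{a, b, c} \<subseteq> \<Omega>"
  shows "cyc3 a b c \<in> H"
proof -
  have ex: "\<exists>d. cyc3 p q d \<in> H \<and> distinct [p, q, d]" if pq: "p \<in> \<Omega>" "q \<in> \<Omega>" "p \<noteq> q" for p q
  proof -
    have "x \<in> \<Omega>" "y \<in> \<Omega>" "x \<noteq> y" using xyz(2,3) by auto
    then obtain g where g: "g \<in> H" "g x = p" "g y = q"
      using dt pq unfolding doubly_transitive_def by metis
    have "distinct [g x, g y, g z]" using xyz(2) eq_iff[OF g(1)] by auto
    thus ?thesis using cyc3_conj[OF g(1) xyz(1,2)] g by (intro exI[of _ "g z"]) auto
  qed
  obtain d where d: "cyc3 a b d \<in> H" "distinct [a, b, d]" using ex[of a b] abc by auto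
  obtain f where f: "cyc3 b c f \<in> H" "distinct [b, c, f]" using ex[of b c] abc by auto
  consider "d = c" | "f = a" | "d \<noteq> c" "f = d" | "d \<noteq> c" "f \<noteq> a" "f \<noteq> d" by blast
  thus ?thesis
  proof cases
    case 1 thus ?thesis using d by simp
  next
    case 2 thus ?thesis using f cyc3_rotate[OF abc(1)] by simp
  next
    case 3
    have "cyc3 (cyc3 b c f a) (cyc3 b c f b) (cyc3 b c f d) \<in> H"
      using f(1) d by (rule cyc3_conj)
    moreover have "cyc3 b c f a = a" "cyc3 b c f b = c" "cyc3 b c f d = b"
      using abc d f 3 by (auto intro: cyc3_apply)
    ultimately have "cyc3 a c b \<in> H" by simp
    from cyc3_inv[OF this] abc(1) have "cyc3 b c a \<in> H" by auto
    thus ?thesis using cyc3_rotate[OF abc(1)] by simp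
  next
    case 4
    have "cyc3 (cyc3 b c f a) (cyc3 b c f b) (cyc3 b c f d) \<in> H"
      using f(1) d by (rule cyc3_conj)
    moreover have "cyc3 b c f a = a" "cyc3 b c f b = c" "cyc3 b c f d = d"
      using abc d f 4 by (auto intro: cyc3_apply)
    ultimately have acd: "cyc3 a c d \<in> H" "distinct [a, c, d]" using abc d 4 by auto
    have "cyc3 (cyc3 a c d a) (cyc3 a c d b) (cyc3 a c d d) \<in> H"
      using acd(1) d by (rule cyc3_conj)
    moreover have "cyc3 a c d a = c" "cyc3 a c d b = b" "cyc3 a c d d = a"
      using abc acd d by (auto intro: cyc3_apply)
    ultimately have "cyc3 c b a \<in> H" by simp
    from cyc3_inv[OF this] abc(1) show ?thesis by auto
  qed
qed

lemma card_le_3_cases: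
  assumes "finite S" "card S \<le> 3"
  obtains "S = {}" | x where "S = {x}" | x y where "x \<noteq> y" "S = {x, y}"
    | x y z where "distinct [x, y, z]" "S = {x, y, z}"
proof -
  have "card S = 0 \<or> card S = 1 \<or> card S = 2 \<or> card S = 3" using assms(2) by linarith
  thus ?thesis
    using that assms(1) by (elim disjE) (auto simp: card_1_singleton_iff card_2_iff card_3_iff)
qed

text \<open>Such a \<open>u\<close> is a transposition or a 3-cycle. This settles the supports of
  size below 4, which \<open>minimal_degree_linear\<close> excludes.\<close>

lemma (in perm_group) cyc3_mem_of_small_support:
  assumes dt: "doubly_transitive" and u: "u \<in> H" "u \<noteq> id" "card (supp u) \<le> 3"
    and abc: "distinct [a, b, c]" "{a, b, c} \<subseteq> \<Omega>"
  shows "cyc3 a b c \<in> H"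
proof -
  have uS: "u x \<in> supp u" if "x \<in> supp u" for x using that eq_iff[OF u(1)] by (auto simp: supp_def)
  have sS: "supp u \<subseteq> \<Omega>" using u(1) by (rule supp_subset)
  from card_le_3_cases[OF finite_supp[OF u(1)] u(3)] show ?thesis
  proof cases
    case 1 thus ?thesis using supp_nonempty[OF u(1,2)] by simp
  next
    case (2 x) thus ?thesis using uS[of x] by (auto simp: supp_def)
  next
    case (3 x y)
    have "u = transpose x y"
    proof
      fix p show "u p = transpose x y p"
      proof (cases "p \<in> {x, y}")
        case True thus ?thesis using 3 uS[of p] by (auto simp: supp_def transpose_def set_eq_iff)
      next
        case False thus ?thesis using 3 by (auto simp: supp_def transpose_def set_eq_iff)
      qed
    qed
    have tr: "transpose p q \<in> H" if pq: "p \<in> \<Omega>" "q \<in> \<Omega>" "p \<noteq> q" for p q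
    proof -
      obtain g where g: "g \<in> H" "g x = p" "g y = q"
        using dt pq 3 sS unfolding doubly_transitive_def by (metis insert_subset)
      have "g \<circ> u \<circ> inv' g = transpose p q"
      proof
        fix v
        have "v = g (inv' g v)" using inv_apply(2)[OF g(1)] by simp
        thus "(g \<circ> u \<circ> inv' g) v = transpose p q v"
          unfolding \<open>u = transpose x y\<close> using g eq_iff[OF g(1)]
          by (metis comp_apply transpose_apply_first transpose_apply_other transpose_apply_second)
      qed
      thus ?thesis using g u by (metis comp_mem inv_mem)
    qed
    show ?thesis unfolding cyc3_def using abc by (intro comp_mem tr) auto
  next
    case (4 x y z)
    have fx: "u p = p" if "p \<notin> {x, y, z}" for p using that 4 by (auto simp: supp_def)
    have mv: "u p \<in> {x, y, z}" "u p \<noteq> p" if "p \<in> {x, y, z}" for p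
      using that uS[of p] 4 by (auto simp: supp_def)
    have inj: "p \<noteq> q \<Longrightarrow> u p \<noteq> u q" for p q using eq_iff[OF u(1)] by simp
    have "(u x = y \<and> u y = z \<and> u z = x) \<or> (u x = z \<and> u z = y \<and> u y = x)"
      using mv[of x] mv[of y] mv[of z] inj[of x y] inj[of x z] inj[of y z] 4(1) by auto
    hence "u = cyc3 x y z \<or> u = cyc3 x z y"
    proof
      assume "u x = y \<and> u y = z \<and> u z = x"
      hence "u = cyc3 x y z" using 4(1) fx by (intro cyc3_eqI) auto
      thus ?thesis ..
    next
      assume "u x = z \<and> u z = y \<and> u y = x"
      hence "u = cyc3 x z y" using 4(1) fx by (intro cyc3_eqI) auto
      thus ?thesis ..
    qed
    thus ?thesis
    proof
      assume "u = cyc3 x y z"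
      thus ?thesis using all_cyc3_mem[OF dt, of x y z] 4 sS u(1) abc by auto
    next
      assume "u = cyc3 x z y"
      thus ?thesis using all_cyc3_mem[OF dt, of x z y] 4 sS u(1) abc by auto
    qed
  qed
qed

lemma alt_group_subset:
  assumes sub: "subgroup H (sym_group n)" and cyc: "\<And>a b c. distinct [a, b, c] \<Longrightarrow> {a, b, c} \<subseteq> {1..n} \<Longrightarrow> cyc3 a b c \<in> H"
  shows "carrier (alt_group n) \<subseteq> H"
proof -
  interpret S: group "sym_group n" by (rule sym_group_is_group)
  interpret A: group "alt_group n" by (rule alt_group_is_group)
  have three: "three_cycles n \<subseteq> H"
  proof
    fix p assume "p \<in> three_cycles n"
    then obtain cs where cs: "p = cycle_of_list cs" "distinct cs" "length cs = 3" "set cs \<subseteq> {1..n}" by auto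
    obtain a b c where cs': "cs = [a, b, c]" using stupid_lemma[OF cs(3)] by auto
    have "p = cyc3 a b c" using cs(1) by (simp add: cs' cyc3_def)
    thus "p \<in> H" using cyc[of a b c] cs by (simp add: cs')
  qed
  have H: "\<And>g h. g \<in> H \<Longrightarrow> h \<in> H \<Longrightarrow> g \<circ> h \<in> H" "id \<in> H"
    using subgroup.m_closed[OF sub] subgroup.one_closed[OF sub] by (simp_all add: sym_group_mult sym_group_one)
  have invH: "inv' h \<in> H" if "h \<in> H" for h
    using subgroup.m_inv_closed[OF sub that] sym_group_inv_equality[of h n] subgroup.subset[OF sub] that by auto
  have "p \<in> H" if "p \<in> generate (alt_group n) (three_cycles n)" for p
    using that
  proof induction
    case one thus ?case using H(2) by (simp only: alt_group_one)
  next
    case (incl h) thus ?case using three by blast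
  next
    case (inv h)
    hence "h \<in> carrier (alt_group n)" using three_cycles_incl by blast
    thus ?case using invH inv three alt_group_inv_equality[of h n] by auto
  next
    case (eng h1 h2) thus ?case using H(1)[of h1 h2] by (simp only: alt_group_mult)
  qed
  thus ?thesis unfolding alt_group_carrier_as_three_cycles by blast
qed

lemma subgroup_above_alt_group:
  assumes sub: "subgroup H (sym_group n)" and alt: "carrier (alt_group n) \<subseteq> H"
  shows "H = carrier (alt_group n) \<or> H = carrier (sym_group n)"
proof (cases "H \<subseteq> carrier (alt_group n)")
  case False
  then obtain h where h: "h \<in> H" "h \<notin> carrier (alt_group n)" by blast
  have hp: "h permutes {1..n}" using h subgroup.subset[OF sub] by (auto simp: sym_group_carrier)
  hence odd: "\<not> evenperm h" using h by (simp add: alt_group_carrier)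
  have "p \<in> H" if p: "p \<in> carrier (sym_group n)" for p
  proof (cases "evenperm p")
    case True thus ?thesis using p alt by (auto simp: alt_group_carrier sym_group_carrier)
  next
    case False
    have pp: "p permutes {1..n}" using p by (simp add: sym_group_carrier)
    have P: "permutation p" "permutation h" using pp hp permutation_permutes by auto
    have "p \<circ> h permutes {1..n}" using pp hp permutes_compose by blast
    moreover have "evenperm (p \<circ> h)" using evenperm_comp[OF P] odd False by simp
    ultimately have ph: "p \<circ> h \<in> H" using alt by (auto simp: alt_group_carrier)
    have invh: "inv' h \<in> H"
      using subgroup.m_inv_closed[OF sub h(1)] sym_group_inv_equality[of h n] subgroup.subset[OF sub] h by auto
    have "(p \<circ> h) \<circ> inv' h \<in> H"
      using subgroup.m_closed[OF sub ph invh] by (simp add: sym_group_mult)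
    moreover have "(p \<circ> h) \<circ> inv' h = p" using permutes_inv_o(1)[OF hp] by (simp add: comp_assoc)
    ultimately show ?thesis by simp
  qed
  thus ?thesis using subgroup.subset[OF sub] by blast
qed (use alt in blast)

lemma minimal_degree_doubly_transitive:
  assumes sub: "subgroup H (sym_group n)" and pg: "perm_group {1..n} H"
    and dt: "perm_group.doubly_transitive {1..n} H"
    and neq: "H \<noteq> carrier (alt_group n)" "H \<noteq> carrier (sym_group n)"
    and h: "h \<in> H" "h \<noteq> id"
  shows "n \<le> 10 * card (supp h)"
proof -
  interpret perm_group "{1..n}" H by fact
  define u where "u = (ARG_MIN (\<lambda>h. card (supp h)) h. h \<in> H \<and> h \<noteq> id)"
  have u: "u \<in> H" "u \<noteq> id"
    using arg_min_natI[of "\<lambda>h. h \<in> H \<and> h \<noteq> id" h "\<lambda>h. card (supp h)"] h by (auto simp: u_def)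
  have min: "card (supp u) \<le> card (supp k)" if "k \<in> H" "k \<noteq> id" for k
    unfolding u_def using arg_min_nat_le[of "\<lambda>h. h \<in> H \<and> h \<noteq> id" k "\<lambda>h. card (supp h)"] that by simp
  have "card (supp u) \<ge> 4"
  proof (rule ccontr)
    assume "\<not> ?thesis"
    hence "card (supp u) \<le> 3" by simp
    hence "carrier (alt_group n) \<subseteq> H"
      using cyc3_mem_of_small_support[OF dt u] by (intro alt_group_subset[OF sub]) auto
    thus False using subgroup_above_alt_group[OF sub] neq by blast
  qed
  from minimal_degree_linear[OF dt u min this] have "n \<le> 10 * card (supp u)" by simp
  thus ?thesis using min[OF h] by simp
qed

section \<open>The order of doubly transitive groups\<close>

context perm_group begin

lemma card_map_orbit: "card ((\<lambda>k. map k ws) ` H) * card (fixer H (set ws)) = card H"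
proof -
  let ?F = "\<lambda>ys. {k \<in> H. map k ws = ys}"
  have "card (?F ys) = card (fixer H (set ws))" if "ys \<in> (\<lambda>k. map k ws) ` H" for ys
  proof -
    from that obtain k0 where k0: "k0 \<in> H" "ys = map k0 ws" by blast
    have "bij_betw (\<lambda>h. k0 \<circ> h) (fixer H (set ws)) (?F ys)"
    proof (rule bij_betw_byWitness[where f' = "\<lambda>h. inv' k0 \<circ> h"])
      show "(\<lambda>h. inv' k0 \<circ> h) ` ?F ys \<subseteq> fixer H (set ws)"
        using k0 by (auto simp: fixer_def comp_mem inv_mem inv_apply)
      show "(\<lambda>h. k0 \<circ> h) ` fixer H (set ws) \<subseteq> ?F ys"
        using k0 by (auto simp: fixer_def comp_mem)
    qed (auto simp: fun_eq_iff inv_apply[OF k0(1)])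
    from bij_betw_same_card[OF this] show ?thesis by simp
  qed
  hence "(\<Sum>ys\<in>(\<lambda>k. map k ws) ` H. card (?F ys)) = card ((\<lambda>k. map k ws) ` H) * card (fixer H (set ws))"
    by simp
  moreover have "card (\<Union>ys\<in>(\<lambda>k. map k ws) ` H. ?F ys) = (\<Sum>ys\<in>(\<lambda>k. map k ws) ` H. card (?F ys))"
    using finite_group by (intro card_UN_disjoint) auto
  moreover have "(\<Union>ys\<in>(\<lambda>k. map k ws) ` H. ?F ys) = H" by auto
  ultimately show ?thesis by simp
qed

text \<open>If no small set breaks up the orbit \<open>O\<close>, then a single orbit on \<open>O ^ r\<close> contains more than
  half of all tuples, so it meets its image under any permutation of the coordinates.\<close>

lemma ex_coordinate_permuting_element:
  fixes \<gamma> :: real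
  assumes x: "x \<in> \<Omega>" and \<gamma>: "0 < \<gamma>" "\<gamma> \<le> 1/2" "(1 - \<gamma>) ^ r > 1/2" and o2: "2 \<le> card (orb H x)"
    and unbroken: "\<And>W. W \<subseteq> orb H x \<Longrightarrow> card W < r \<Longrightarrow>
          \<exists>y\<in>orb H x. card (orb (fixer H W) y) > (1 - \<gamma>) * card (orb H x)"
    and \<pi>: "\<pi> permutes {..<r}"
  shows "\<exists>k\<in>H. \<exists>ws. length ws = r \<and> distinct ws \<and> set ws \<subseteq> \<Omega> \<and> (\<forall>i<r. k (ws ! i) = ws ! \<pi> i)"
proof -
  define S where "S = orb H x"
  define s where "s = card S"
  have finS: "finite S" by (simp add: S_def finite_orb)
  have S\<Omega>: "S \<subseteq> \<Omega>" unfolding S_def using x by (rule orb_subset)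
  \<comment> \<open>Greedy choice: after fixing the earlier points some point of \<open>S\<close>
    still has an orbit larger than \<open>(1 - \<gamma>) * s\<close>, so by orbit-stabilizer the
    orbit of the tuple grows by at least this factor.\<close>
  have "\<exists>ws. length ws = j \<and> distinct ws \<and> set ws \<subseteq> S \<and>
      real (card ((\<lambda>k. map k ws) ` H)) \<ge> (1 - \<gamma>) ^ j * real s ^ j" if "j \<le> r" for j
    using that
  proof (induction j)
    case 0
    have "(\<lambda>k. map k []) ` H = {[]}" using id_mem by auto
    thus ?case by (intro exI[of _ "[]"]) simp
  next
    case (Suc j)
    then obtain ws where ws: "length ws = j" "distinct ws" "set ws \<subseteq> S"
      "real (card ((\<lambda>k. map k ws) ` H)) \<ge> (1 - \<gamma>) ^ j * real s ^ j" by auto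
    have "card (set ws) < r" using Suc.prems ws distinct_card by fastforce
    then obtain y where y: "y \<in> S" "card (orb (fixer H (set ws)) y) > (1 - \<gamma>) * s"
      using unbroken[of "set ws"] ws(3) by (auto simp: S_def s_def)
    let ?K = "fixer H (set ws)"
    interpret K: perm_group \<Omega> ?K by (rule perm_group_fixer)
    have "y \<notin> set ws"
    proof
      assume "y \<in> set ws"
      hence "orb ?K y \<subseteq> {y}" by (auto simp: orb_def fixer_def)
      hence "card (orb ?K y) \<le> 1" using card_mono[of "{y}" "orb ?K y"] by simp
      moreover have "(1 - \<gamma>) * s \<ge> (1/2) * 2" using \<gamma> o2 by (intro mult_mono) (auto simp: s_def S_def)
      ultimately show False using y(2) by simp
    qed
    have "fixer ?K {y} = fixer H (set (ws @ [y]))" by (simp add: fixer_fixer)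
    hence "card ((\<lambda>k. map k (ws @ [y])) ` H) * card (fixer ?K {y}) = card H"
      using card_map_orbit[of "ws @ [y]"] by simp
    also have "\<dots> = card ((\<lambda>k. map k ws) ` H) * (card (orb ?K y) * card (fixer ?K {y}))"
      using card_map_orbit[of ws] K.orbit_stabilizer[of y] by simp
    finally have "card ((\<lambda>k. map k (ws @ [y])) ` H) * card (fixer ?K {y})
        = (card ((\<lambda>k. map k ws) ` H) * card (orb ?K y)) * card (fixer ?K {y})" by (simp only: mult.assoc)
    moreover have "card (fixer ?K {y}) > 0"
      using perm_group.finite_group[OF K.perm_group_fixer] perm_group.id_mem[OF K.perm_group_fixer]
      by (auto simp: card_gt_0_iff)
    ultimately have eq: "card ((\<lambda>k. map k (ws @ [y])) ` H) = card ((\<lambda>k. map k ws) ` H) * card (orb ?K y)"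
      by simp
    have "(1 - \<gamma>) ^ Suc j * real s ^ Suc j = ((1 - \<gamma>) ^ j * real s ^ j) * ((1 - \<gamma>) * s)" by simp
    also have "\<dots> \<le> real (card ((\<lambda>k. map k ws) ` H)) * real (card (orb ?K y))"
      using ws(4) y(2) \<gamma> by (intro mult_mono) auto
    finally have "(1 - \<gamma>) ^ Suc j * real s ^ Suc j \<le> real (card ((\<lambda>k. map k (ws @ [y])) ` H))"
      unfolding eq by simp
    thus ?case using ws y \<open>y \<notin> set ws\<close> by (intro exI[of _ "ws @ [y]"]) auto
  qed
  then obtain ws where ws: "length ws = r" "distinct ws" "set ws \<subseteq> S"
    "real (card ((\<lambda>k. map k ws) ` H)) \<ge> (1 - \<gamma>) ^ r * real s ^ r" by blast
  define L where "L = {xs. set xs \<subseteq> S \<and> length xs = r}"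
  define G where "G = (\<lambda>k. map k ws) ` H"
  define P where "P xs = map (\<lambda>i. xs ! \<pi> i) [0..<r]" for xs :: "'a list"
  have finL: "finite L" and cL: "card L = s ^ r"
    using finite_lists_length_eq[OF finS] card_lists_length_eq[OF finS] by (auto simp: L_def s_def)
  have GL: "G \<subseteq> L"
  proof
    fix xs assume "xs \<in> G"
    then obtain k where k: "k \<in> H" "xs = map k ws" by (auto simp: G_def)
    have "k y \<in> S" if "y \<in> S" for y using that k(1) apply_mem_orb by (simp add: S_def)
    thus "xs \<in> L" using k ws by (auto simp: L_def)
  qed
  have \<pi>r: "\<pi> i < r" if "i < r" for i using permutes_in_image[OF \<pi>, of i] that by simp
  have PL: "P xs \<in> L" if "xs \<in> L" for xs
    using that \<pi>r by (auto simp: P_def L_def)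
  have injP: "inj_on P L"
  proof (rule inj_onI, rule nth_equalityI)
    fix xs ys assume xy: "xs \<in> L" "ys \<in> L" "P xs = P ys"
    show "length xs = length ys" using xy by (simp add: L_def)
    fix i assume "i < length xs"
    hence i: "i < r" using xy by (simp add: L_def)
    have "inv' \<pi> i < r" using permutes_in_image[OF permutes_inv[OF \<pi>], of i] i by simp
    moreover have "\<pi> (inv' \<pi> i) = i" using permutes_inverses(1)[OF \<pi>] .
    moreover have "P xs ! inv' \<pi> i = P ys ! inv' \<pi> i" using xy by simp
    ultimately show "xs ! i = ys ! i" by (simp add: P_def)
  qed
  have "real (card L) < 2 * real (card G)"
  proof -
    have "s > 0" using o2 by (simp add: s_def S_def)
    hence "1/2 * real s ^ r < (1 - \<gamma>) ^ r * real s ^ r" using \<gamma>(3) by simp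
    thus ?thesis using ws(4) cL by (simp add: G_def)
  qed
  hence big: "card L < card G + card (P ` G)"
    using card_image[OF inj_on_subset[OF injP GL]] by simp
  have "G \<inter> P ` G \<noteq> {}"
  proof
    assume "G \<inter> P ` G = {}"
    hence "card (G \<union> P ` G) = card G + card (P ` G)"
      using finite_subset[OF GL finL] by (intro card_Un_disjoint) auto
    moreover have "card (G \<union> P ` G) \<le> card L" using GL PL finL by (intro card_mono) auto
    ultimately show False using big by simp
  qed
  then obtain k1 k2 where k: "k1 \<in> H" "k2 \<in> H" "map k1 ws = P (map k2 ws)" by (auto simp: G_def)
  have "(inv' k2 \<circ> k1) (ws ! i) = ws ! \<pi> i" if i: "i < r" for i
  proof -
    have "map k1 ws ! i = P (map k2 ws) ! i" using k by simp
    hence "k1 (ws ! i) = k2 (ws ! \<pi> i)" using i ws \<pi>r by (simp add: P_def)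
    thus ?thesis using inv_apply(1)[OF k(2)] by simp
  qed
  thus ?thesis using ws k S\<Omega> by (intro bexI[of _ "inv' k2 \<circ> k1"] exI[of _ ws]) (auto simp: comp_mem inv_mem)
qed

end

text \<open>Rotation of each \<open>{..<p}\<close> in the disjoint union over \<open>P\<close>,
  transported to an initial segment. As \<open>p\<close> is prime, the condition puts
  \<open>i\<close> on a \<open>p\<close>-cycle, in a form that passes to any element acting on a
  tuple of distinct points through \<open>\<pi>\<close>.\<close>

lemma ex_permutation_with_prime_cycles:
  fixes P :: "nat set"
  assumes fin: "finite P" and pr: "\<And>p. p \<in> P \<Longrightarrow> prime p"
  shows "\<exists>\<pi>. \<pi> permutes {..<\<Sum>P} \<and> (\<forall>p\<in>P. \<exists>i<\<Sum>P. (\<pi> ^^ p) i = i \<and> \<pi> i \<noteq> i)"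
proof -
  define I where "I = (SIGMA p:P. {..<p})"
  define \<sigma> where "\<sigma> q = (fst q, Suc (snd q) mod fst q)" for q :: "nat \<times> nat"
  have finI: "finite I" using fin by (simp add: I_def)
  have cI: "card I = \<Sum>P" using fin by (simp add: I_def)
  then obtain f where f: "bij_betw f I {..<\<Sum>P}"
    using ex_bij_betw_finite_nat[OF finI] by (auto simp: atLeast0LessThan)
  define g where "g = the_inv_into I f"
  have gf: "g (f q) = q" if "q \<in> I" for q
    using f that by (simp add: g_def bij_betw_def the_inv_into_f_f)
  have fg: "f (g i) = i" "g i \<in> I" if "i < \<Sum>P" for i
    using f that f_the_inv_into_f_bij_betw[OF f, of i] bij_betw_the_inv_into[OF f]
    by (auto simp: g_def bij_betw_def)
  have \<sigma>I: "\<sigma> q \<in> I" if "q \<in> I" for q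
    using that by (cases q) (auto simp: I_def \<sigma>_def)
  have \<sigma>k: "(\<sigma> ^^ k) q = (fst q, (snd q + k) mod fst q)" if "q \<in> I" for q k
    using that by (induction k) (auto simp: I_def \<sigma>_def mod_Suc_eq)
  have \<sigma>p: "(\<sigma> ^^ fst q) q = q" if "q \<in> I" for q
    using that by (auto simp: \<sigma>k) (auto simp: I_def)
  define \<pi> where "\<pi> i = (if i < \<Sum>P then f (\<sigma> (g i)) else i)" for i
  have f_lt: "f q < \<Sum>P" if "q \<in> I" for q using bij_betwE[OF f] that by auto
  have \<pi>k: "(\<pi> ^^ k) (f q) = f ((\<sigma> ^^ k) q) \<and> (\<sigma> ^^ k) q \<in> I" if "q \<in> I" for q k
    using that by (induction k) (auto simp: \<pi>_def f_lt gf \<sigma>I)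
  have "inj_on \<pi> {..<\<Sum>P}"
  proof (rule inj_onI)
    fix i j assume ij: "i \<in> {..<\<Sum>P}" "j \<in> {..<\<Sum>P}" "\<pi> i = \<pi> j"
    hence "g (f (\<sigma> (g i))) = g (f (\<sigma> (g j)))" by (simp add: \<pi>_def)
    hence eq: "\<sigma> (g i) = \<sigma> (g j)" using fg ij by (simp add: gf \<sigma>I)
    hence fst: "fst (g i) = fst (g j)" by (simp add: \<sigma>_def)
    \<comment> \<open>Some positive power of \<open>\<sigma>\<close> is the identity on the common
      fibre, so equal images come from equal points.\<close>
    have "(\<sigma> ^^ Suc k) (g i) = (\<sigma> ^^ Suc k) (g j)" for k
      unfolding funpow_Suc_right using eq by simp
    moreover have "fst (g j) > 0" using fg(2)[of j] ij by (auto simp: I_def)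
    then obtain k where "fst (g j) = Suc k" using gr0_implies_Suc by blast
    ultimately have "(\<sigma> ^^ fst (g i)) (g i) = (\<sigma> ^^ fst (g j)) (g j)" using fst by metis
    moreover have "(\<sigma> ^^ fst (g i)) (g i) = g i" "(\<sigma> ^^ fst (g j)) (g j) = g j"
      using fg(2) ij by (auto intro: \<sigma>p)
    ultimately have "g i = g j" by argo
    moreover have "f (g i) = i" "f (g j) = j" using fg(1) ij by auto
    ultimately show "i = j" by argo
  qed
  moreover have "\<pi> ` {..<\<Sum>P} \<subseteq> {..<\<Sum>P}" using f_lt[OF \<sigma>I[OF fg(2)]] by (auto simp: \<pi>_def)
  ultimately have "bij_betw \<pi> {..<\<Sum>P} {..<\<Sum>P}"
    by (simp add: bij_betw_def endo_inj_surj)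
  hence "\<pi> permutes {..<\<Sum>P}" by (rule bij_imp_permutes) (simp add: \<pi>_def)
  moreover have "\<exists>i<\<Sum>P. (\<pi> ^^ p) i = i \<and> \<pi> i \<noteq> i" if p: "p \<in> P" for p
  proof (intro exI conjI)
    have p2: "p \<ge> 2" using pr[OF p] by (rule prime_ge_2_nat)
    hence q: "(p, 0) \<in> I" using p by (auto simp: I_def)
    show "f (p, 0) < \<Sum>P" using q by (rule f_lt)
    show "(\<pi> ^^ p) (f (p, 0)) = f (p, 0)" using \<pi>k[OF q, of p] \<sigma>p[OF q] by simp
    have "\<sigma> (p, 0) \<noteq> (p, 0)" using p2 by (simp add: \<sigma>_def)
    hence "f (\<sigma> (p, 0)) \<noteq> f (p, 0)" using f q \<sigma>I[OF q] by (metis bij_betw_imp_inj_on inj_onD)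
    thus "\<pi> (f (p, 0)) \<noteq> f (p, 0)" using q by (simp add: \<pi>_def f_lt gf)
  qed
  ultimately show ?thesis by blast
qed

section \<open>Prime divisors of cycle lengths\<close>

lemma fact_card_le_prod:
  fixes Q :: "nat set"
  assumes "finite Q" "0 \<notin> Q"
  shows "fact (card Q) \<le> \<Prod>Q"
  using assms
proof (induction "card Q" arbitrary: Q)
  case (Suc c)
  hence ne: "Q \<noteq> {}" by auto
  let ?m = "Max Q"
  have m: "?m \<in> Q" using Suc ne by simp
  have "Q \<subseteq> {1..?m}" using Suc Max_ge by (metis One_nat_def Suc_leI atLeastAtMost_iff neq0_conv subsetI)
  hence "card Q \<le> ?m" using card_mono[of "{1..?m}" Q] by simp
  moreover have "fact (card (Q - {?m})) \<le> \<Prod>(Q - {?m})"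
    using Suc m by (intro Suc.hyps(1)) auto
  ultimately have "card Q * fact (card (Q - {?m})) \<le> ?m * \<Prod>(Q - {?m})" by (rule mult_le_mono)
  also have "\<dots> = \<Prod>Q" using prod.remove[OF Suc.prems(1) m, of "\<lambda>x. x"] by simp
  also have "card (Q - {?m}) = c" using Suc m by simp
  finally show ?case using Suc.hyps(2) by (metis fact_Suc of_nat_id)
qed simp

text \<open>The product of the primes divides \<open>L\<close> and is at least the factorial of
  their number. The gain over the trivial bound by the binary logarithm is essential:
  \<open>\<tau>\<close> may be an arbitrarily small multiple of \<open>ln n\<close>, so that a small
  power of \<open>n\<close> exceeds \<open>2 powr (10 * \<tau>)\<close>.\<close>

lemma card_prime_divisors_le:
  fixes Q :: "nat set"
  assumes "finite Q" "\<And>p. p \<in> Q \<Longrightarrow> prime p \<and> p dvd L" and L: "0 < L" "L \<le> n" and \<tau>: "fact (Suc \<tau>) > n"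
  shows "card Q \<le> \<tau>"
proof (rule ccontr)
  assume "\<not> ?thesis"
  hence "fact (Suc \<tau>) \<le> (fact (card Q) :: nat)" by (intro fact_mono) simp
  also have "\<dots> \<le> \<Prod>Q" using assms by (intro fact_card_le_prod) (auto dest: prime_gt_0_nat)
  also have "\<Prod>Q dvd L"
    using assms(1,2)
  proof (induction Q rule: finite_induct)
    case (insert p Q)
    have "coprime p (\<Prod>Q)"
      using insert by (intro prod_coprime_right) (auto intro!: primes_coprime)
    thus ?case using insert by (simp add: divides_mult)
  qed simp
  hence "\<Prod>Q \<le> L" using L by (intro dvd_imp_le)
  finally show False using L \<tau> by simp
qed

context perm_group begin

lemma funpow_mem: "k \<in> H \<Longrightarrow> k ^^ m \<in> H"
  by (induction m) (auto simp: id_mem comp_mem)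

lemma least_power_le_card:
  assumes k: "k \<in> H" and y: "y \<in> \<Omega>"
  shows "least_power k y \<le> card \<Omega>"
proof -
  have "(\<lambda>i. (k ^^ i) y) ` {..card \<Omega>} \<subseteq> \<Omega>" using mem_points[OF funpow_mem[OF k]] y by auto
  hence "card ((\<lambda>i. (k ^^ i) y) ` {..card \<Omega>}) \<le> card \<Omega>" using finite_points by (intro card_mono)
  hence "\<not> inj_on (\<lambda>i. (k ^^ i) y) {..card \<Omega>}" using card_image by fastforce
  then obtain i' j' where ij': "i' \<noteq> j'" "i' \<le> card \<Omega>" "j' \<le> card \<Omega>" "(k ^^ i') y = (k ^^ j') y"
    by (auto simp: inj_on_def)
  obtain i j where ij: "i < j" "j \<le> card \<Omega>" "(k ^^ i) y = (k ^^ j) y"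
    using ij' by (metis linorder_neqE_nat)
  have "(k ^^ i) ((k ^^ (j - i)) y) = (k ^^ i) y"
    using ij by (metis add_diff_inverse_nat funpow_add less_imp_not_less o_apply)
  hence "(k ^^ (j - i)) y = y" using eq_iff[OF funpow_mem[OF k]] by blast
  hence "least_power k y \<le> j - i" using ij by (intro least_power_le) auto
  thus ?thesis using ij by simp
qed

lemma permutation_mem: "k \<in> H \<Longrightarrow> permutation k"
  using permutes finite_points permutation_permutes by blast

text \<open>For each prime \<open>p\<close> in \<open>P\<close>, a suitable power of \<open>k\<close> moves only points whose cycle length
  is divisible by \<open>p\<close>. A cycle length \<open>\<le> n\<close> has few prime divisors, so
  one of these powers has small support.\<close>

lemma card_prime_cycles_le:
  assumes P: "finite P" "\<And>p. p \<in> P \<Longrightarrow> prime p" and k: "k \<in> H"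
    and cyc: "\<And>p. p \<in> P \<Longrightarrow> \<exists>v. (k ^^ p) v = v \<and> k v \<noteq> v"
    and n: "n = card \<Omega>" "n > 0" and \<tau>: "fact (Suc \<tau>) > n"
    and deg: "\<And>h. h \<in> H \<Longrightarrow> h \<noteq> id \<Longrightarrow> n \<le> 10 * card (supp h)"
  shows "card P \<le> 10 * \<tau>"
proof -
  let ?len = "least_power k"
  have perm: "permutation k" using k by (rule permutation_mem)
  have len: "0 < ?len y" "?len y dvd fact n" "?len y \<le> n" if "y \<in> \<Omega>" for y
  proof -
    show 0: "0 < ?len y" by (rule least_power_of_permutation[OF perm])
    show "?len y \<le> n" using least_power_le_card[OF k that] n by simp
    thus "?len y dvd fact n" using 0 by (intro dvd_fact) auto
  qed
  have *: "n \<le> 10 * card {y \<in> \<Omega>. p dvd ?len y}" if p: "p \<in> P" for p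
  proof -
    have pp: "prime p" using P p by blast
    \<comment> \<open>\<open>m\<close> is the part of \<open>n!\<close> prime to \<open>p\<close>.
      Cycle lengths are at most \<open>n\<close> and so divide \<open>n!\<close>; hence
      \<open>k ^^ m\<close> fixes every point whose cycle length is not divisible by
      \<open>p\<close>, but no point of a \<open>p\<close>-cycle.\<close>
    obtain m where m: "fact n = p ^ multiplicity p (fact n) * m" "\<not> p dvd m"
      using multiplicity_decompose'[of "fact n" p] pp not_prime_unit[of p] by (auto simp: prime_nat_iff)
    have cop: "coprime (p ^ multiplicity p (fact n)) m"
      using m(2) pp by (simp add: prime_imp_coprime)
    let ?h = "k ^^ m"
    obtain v where v: "(k ^^ p) v = v" "k v \<noteq> v" using cyc[OF p] by blast
    have "?len v dvd p" using v(1) least_power_dvd[OF perm] by blast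
    moreover have "?len v \<noteq> 1" using least_power_gt_one[OF perm v(2)] by simp
    ultimately have "?len v = p" using pp by (auto simp: prime_nat_iff)
    hence "?h v \<noteq> v" using m(2) least_power_dvd[OF perm, of v m] by simp
    hence "?h \<noteq> id" by auto
    from deg[OF funpow_mem[OF k] this] have "n \<le> 10 * card (supp ?h)" .
    also have "supp ?h \<subseteq> {y \<in> \<Omega>. p dvd ?len y}"
    proof
      fix y assume y: "y \<in> supp ?h"
      hence y\<Omega>: "y \<in> \<Omega>" using supp_subset[OF funpow_mem[OF k]] by blast
      have "p dvd ?len y"
      proof (rule ccontr)
        assume "\<not> p dvd ?len y"
        hence "coprime (?len y) (p ^ multiplicity p (fact n))"
          using pp by (simp add: prime_imp_coprime coprime_commute)
        moreover have "?len y dvd p ^ multiplicity p (fact n) * m" using len(2)[OF y\<Omega>] m(1) by simp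
        ultimately have "?len y dvd m" using coprime_dvd_mult_right_iff by blast
        hence "?h y = y" using least_power_dvd[OF perm] by blast
        thus False using y by (simp add: supp_def)
      qed
      thus "y \<in> {y \<in> \<Omega>. p dvd ?len y}" using y\<Omega> by simp
    qed
    hence "card (supp ?h) \<le> card {y \<in> \<Omega>. p dvd ?len y}" using finite_points by (intro card_mono) auto
    finally show ?thesis by simp
  qed
  \<comment> \<open>Double counting: each prime divides the cycle lengths of at least
    \<open>n / 10\<close> points, and each cycle length has at most \<open>\<tau>\<close> prime
    divisors.\<close>
  have "card P * n = (\<Sum>p\<in>P. n)" by simp
  also have "\<dots> \<le> (\<Sum>p\<in>P. 10 * card {y \<in> \<Omega>. p dvd ?len y})" by (intro sum_mono *)
  also have "\<dots> = 10 * (\<Sum>y\<in>\<Omega>. card {p \<in> P. p dvd ?len y})"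
    unfolding sum_distrib_left[symmetric] using P finite_points by (subst sum_card_swap) auto
  also have "\<dots> \<le> 10 * (\<Sum>y\<in>\<Omega>. \<tau>)"
  proof (intro mult_le_mono2 sum_mono)
    fix y assume "y \<in> \<Omega>"
    thus "card {p \<in> P. p dvd ?len y} \<le> \<tau>"
      using P len by (intro card_prime_divisors_le[OF _ _ _ _ \<tau>, where L = "?len y"]) auto
  qed
  also have "\<dots> = (10 * \<tau>) * n" using n by simp
  finally show ?thesis using n by simp
qed

text \<open>Otherwise \<open>ex_coordinate_permuting_element\<close>, applied to
  \<open>fixer H B\<close>, yields an element with a \<open>p\<close>-cycle for every
  \<open>p\<close> in \<open>P\<close>. It lies in \<open>H\<close>, whose minimal degree allows at
  most \<open>10 * \<tau>\<close> such primes.\<close>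

lemma ex_orbit_breaking_set:
  fixes \<gamma> :: real
  assumes P: "finite P" "\<And>p. p \<in> P \<Longrightarrow> prime p" and r: "r = \<Sum>P"
    and n: "n = card \<Omega>" "n > 0" and \<tau>: "fact (Suc \<tau>) > n" "card P > 10 * \<tau>"
    and deg: "\<And>h. h \<in> H \<Longrightarrow> h \<noteq> id \<Longrightarrow> n \<le> 10 * card (supp h)"
    and \<gamma>: "0 < \<gamma>" "\<gamma> \<le> 1/2" "(1 - \<gamma>) ^ r > 1/2"
    and x: "x \<in> \<Omega>" "2 \<le> card (orb (fixer H B) x)"
  shows "\<exists>W. W \<subseteq> orb (fixer H B) x \<and> card W < r \<and>
           (\<forall>y\<in>orb (fixer H B) x. card (orb (fixer H (B \<union> W)) y) \<le> (1 - \<gamma>) * card (orb (fixer H B) x))"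
proof (rule ccontr)
  assume contr: "\<not> ?thesis"
  interpret K: perm_group \<Omega> "fixer H B" by (rule perm_group_fixer)
  obtain \<pi> where \<pi>: "\<pi> permutes {..<r}" "\<And>p. p \<in> P \<Longrightarrow> \<exists>i<r. (\<pi> ^^ p) i = i \<and> \<pi> i \<noteq> i"
    using ex_permutation_with_prime_cycles[OF P] unfolding r by blast
  have unb: "\<exists>y\<in>orb (fixer H B) x. card (orb (fixer (fixer H B) W) y) > (1 - \<gamma>) * card (orb (fixer H B) x)"
    if "W \<subseteq> orb (fixer H B) x" "card W < r" for W
    using contr that unfolding fixer_fixer by (metis not_le)
  obtain k ws where k: "k \<in> fixer H B" and ws: "length ws = r" "distinct ws" "\<And>i. i < r \<Longrightarrow> k (ws ! i) = ws ! \<pi> i"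
    using K.ex_coordinate_permuting_element[OF x(1) \<gamma> x(2) unb \<pi>(1)] by blast
  have kH: "k \<in> H" using k fixer_subset by blast
  have pow: "(k ^^ j) (ws ! i) = ws ! ((\<pi> ^^ j) i) \<and> (\<pi> ^^ j) i < r" if "i < r" for i j
    using that
  proof (induction j)
    case (Suc j)
    have "\<pi> ((\<pi> ^^ j) i) < r" using permutes_in_image[OF \<pi>(1), of "(\<pi> ^^ j) i"] Suc by simp
    thus ?case using Suc ws(3) by simp
  qed simp
  have "\<exists>v. (k ^^ p) v = v \<and> k v \<noteq> v" if p: "p \<in> P" for p
  proof -
    obtain i where i: "i < r" "(\<pi> ^^ p) i = i" "\<pi> i \<noteq> i" using \<pi>(2)[OF p] by blast
    have "\<pi> i < r" using pow[OF i(1), of 1] by simp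
    hence "ws ! \<pi> i \<noteq> ws ! i" using ws i by (simp add: nth_eq_iff_index_eq)
    thus ?thesis using i pow[OF i(1), of p] ws(3)[OF i(1)] by (intro exI[of _ "ws ! i"]) simp
  qed
  from card_prime_cycles_le[OF P kH this n \<tau>(1) deg] \<tau>(2) show False by simp
qed

text \<open>The potential \<open>\<Phi>\<close> starts at most at \<open>n * ln n\<close> and is
  never negative. Breaking an orbit of more than \<open>s\<close> points lowers the logarithm by at
  least \<open>\<gamma>\<close> at each of them, so \<open>j\<close> rounds make all orbits short.
  Then \<open>n ^ (r * j)\<close> bounds the images of the points fixed so far, and the remaining
  stabilizer embeds into the product of its orbits.\<close>

theorem card_le_of_breaking:
  fixes \<gamma> :: real and s :: nat
  assumes n: "n = card \<Omega>" "n > 0" and \<gamma>: "0 < \<gamma>" "\<gamma> < 1" and s: "s \<ge> 1"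
    and break: "\<And>B x. x \<in> \<Omega> \<Longrightarrow> s < card (orb (fixer H B) x) \<Longrightarrow>
       \<exists>W. W \<subseteq> orb (fixer H B) x \<and> card W < r \<and>
           (\<forall>y\<in>orb (fixer H B) x. card (orb (fixer H (B \<union> W)) y) \<le> (1 - \<gamma>) * card (orb (fixer H B) x))"
    and j: "n * ln n < j * \<gamma> * s"
  shows "card H \<le> n ^ (r * j) * s ^ n"
proof -
  define \<Phi> where "\<Phi> B = (\<Sum>y\<in>\<Omega>. ln (card (orb (fixer H B) y)))" for B
  have orb1: "1 \<le> card (orb (fixer H B) y)" for B y
    using perm_group.orb_refl[OF perm_group_fixer] perm_group.finite_orb[OF perm_group_fixer]
    by (metis One_nat_def Suc_leI card_gt_0_iff empty_iff)
  \<comment> \<open>Once all orbits are short, \<open>B\<close> is simply kept for the remaining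
    rounds.\<close>
  have step: "\<exists>B. B \<subseteq> \<Omega> \<and> card B \<le> r * i \<and>
      ((\<forall>y\<in>\<Omega>. card (orb (fixer H B) y) \<le> s) \<or> \<Phi> B \<le> n * ln n - i * \<gamma> * s)" for i
  proof (induction i)
    case 0
    have "\<Phi> {} \<le> (\<Sum>y\<in>\<Omega>. ln n)"
      unfolding \<Phi>_def
    proof (rule sum_mono)
      fix y assume y: "y \<in> \<Omega>"
      have "card (orb (fixer H {}) y) \<le> n"
        unfolding n using perm_group.orb_subset[OF perm_group_fixer y] finite_points by (intro card_mono)
      thus "ln (card (orb (fixer H {}) y)) \<le> ln n" using orb1[of "{}" y] by simp
    qed
    thus ?case using n by (intro exI[of _ "{}"]) simp
  next
    case (Suc i)
    then obtain B where B: "B \<subseteq> \<Omega>" "card B \<le> r * i"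
      "(\<forall>y\<in>\<Omega>. card (orb (fixer H B) y) \<le> s) \<or> \<Phi> B \<le> n * ln n - i * \<gamma> * s" by blast
    show ?case
    proof (cases "\<forall>y\<in>\<Omega>. card (orb (fixer H B) y) \<le> s")
      case True
      thus ?thesis using B by (intro exI[of _ B]) auto
    next
      case False
      interpret K: perm_group \<Omega> "fixer H B" by (rule perm_group_fixer)
      from False obtain x where x: "x \<in> \<Omega>" "s < card (orb (fixer H B) x)" by force
      let ?O = "orb (fixer H B) x"
      obtain W where W: "W \<subseteq> ?O" "card W < r"
        "\<And>y. y \<in> ?O \<Longrightarrow> card (orb (fixer H (B \<union> W)) y) \<le> (1 - \<gamma>) * card ?O"
        using break[OF x] by blast
      have O\<Omega>: "?O \<subseteq> \<Omega>" using x(1) by (rule K.orb_subset)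
      have mono: "card (orb (fixer H (B \<union> W)) y) \<le> card (orb (fixer H B) y)" for y
        using fixer_mono[of B "B \<union> W"] by (intro card_mono K.finite_orb) (auto simp: orb_def)
      have "\<Phi> (B \<union> W) \<le> (\<Sum>y\<in>\<Omega>. ln (card (orb (fixer H B) y)) - (if y \<in> ?O then \<gamma> else 0))"
        unfolding \<Phi>_def
      proof (rule sum_mono)
        fix y assume y: "y \<in> \<Omega>"
        show "ln (card (orb (fixer H (B \<union> W)) y)) \<le> ln (card (orb (fixer H B) y)) - (if y \<in> ?O then \<gamma> else 0)"
        proof (cases "y \<in> ?O")
          case True
          have eq: "orb (fixer H B) y = ?O" using True by (rule K.orb_eq)
          have "ln (card (orb (fixer H (B \<union> W)) y)) \<le> ln ((1 - \<gamma>) * card ?O)"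
            using W(3)[OF True] orb1[of "B \<union> W" y] by simp
          also have "\<dots> = ln (1 - \<gamma>) + ln (card ?O)"
            using \<gamma> orb1[of B x] by (simp add: ln_mult)
          also have "ln (1 - \<gamma>) \<le> - \<gamma>" using ln_add_one_self_le_self2[of "- \<gamma>"] \<gamma> by simp
          finally show ?thesis using True eq by simp
        next
          case False
          thus ?thesis using mono[of y] orb1[of "B \<union> W" y] by simp
        qed
      qed
      also have "\<dots> = \<Phi> B - \<gamma> * card ?O"
        unfolding sum_subtractf \<Phi>_def[symmetric]
        using finite_points O\<Omega> by (simp add: sum.If_cases Int_absorb1)
      also have "\<dots> \<le> \<Phi> B - \<gamma> * s" using x(2) \<gamma> by simp
      also have "\<Phi> B \<le> n * ln n - i * \<gamma> * s" using B(3) False by blast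
      finally have "\<Phi> (B \<union> W) \<le> n * ln n - Suc i * \<gamma> * s" by (simp add: algebra_simps)
      moreover have "card (B \<union> W) \<le> r * Suc i"
        using card_Un_le[of B W] B(2) W(2) by simp
      moreover have "B \<union> W \<subseteq> \<Omega>" using B W O\<Omega> by blast
      ultimately show ?thesis by blast
    qed
  qed
  obtain B where B: "B \<subseteq> \<Omega>" "card B \<le> r * j"
    "(\<forall>y\<in>\<Omega>. card (orb (fixer H B) y) \<le> s) \<or> \<Phi> B \<le> n * ln n - j * \<gamma> * s" using step by blast
  have "\<Phi> B \<ge> 0" unfolding \<Phi>_def using orb1 by (intro sum_nonneg) (simp add: Suc_le_eq)
  hence orbs: "card (orb (fixer H B) y) \<le> s" if "y \<in> \<Omega>" for y using B(3) j that by fastforce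
  interpret K: perm_group \<Omega> "fixer H B" by (rule perm_group_fixer)
  have finB: "finite B" using B(1) finite_points finite_subset by blast
  obtain ws where ws: "set ws = B" "distinct ws" using finite_distinct_list[OF finB] by blast
  have "card ((\<lambda>k. map k ws) ` H) \<le> card {xs. set xs \<subseteq> \<Omega> \<and> length xs = card B}"
  proof (rule card_mono)
    show "finite {xs. set xs \<subseteq> \<Omega> \<and> length xs = card B}" using finite_points by (rule finite_lists_length_eq)
    show "(\<lambda>k. map k ws) ` H \<subseteq> {xs. set xs \<subseteq> \<Omega> \<and> length xs = card B}"
      using ws B(1) mem_points distinct_card[OF ws(2)] by (auto simp: subset_iff)
  qed
  also have "\<dots> = n ^ card B" using finite_points by (simp add: card_lists_length_eq n)
  also have "\<dots> \<le> n ^ (r * j)" using B(2) n by (intro power_increasing) auto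
  finally have 1: "card ((\<lambda>k. map k ws) ` H) \<le> n ^ (r * j)" .
  have "card (fixer H B) \<le> card (PiE \<Omega> (\<lambda>y. orb (fixer H B) y))"
  proof (rule card_inj_on_le[of "\<lambda>h. restrict h \<Omega>"])
    show "inj_on (\<lambda>h. restrict h \<Omega>) (fixer H B)"
    proof (rule inj_onI)
      fix g h assume gh: "g \<in> fixer H B" "h \<in> fixer H B" "restrict g \<Omega> = restrict h \<Omega>"
      show "g = h"
      proof
        fix y show "g y = h y"
          using fun_cong[OF gh(3), of y] permutes_not_in[OF K.permutes[OF gh(1)], of y]
            permutes_not_in[OF K.permutes[OF gh(2)], of y] by (cases "y \<in> \<Omega>") auto
      qed
    qed
    show "(\<lambda>h. restrict h \<Omega>) ` fixer H B \<subseteq> PiE \<Omega> (\<lambda>y. orb (fixer H B) y)" by (auto simp: orb_def)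
    show "finite (PiE \<Omega> (\<lambda>y. orb (fixer H B) y))" using finite_points K.finite_orb by (intro finite_PiE)
  qed
  also have "\<dots> = (\<Prod>y\<in>\<Omega>. card (orb (fixer H B) y))" using finite_points by (rule card_PiE)
  also have "\<dots> \<le> (\<Prod>y\<in>\<Omega>. s)" using orbs by (intro prod_mono) auto
  also have "\<dots> = s ^ n" using n by simp
  finally have 2: "card (fixer H B) \<le> s ^ n" .
  have "card H = card ((\<lambda>k. map k ws) ` H) * card (fixer H B)" using card_map_orbit[of ws] ws by simp
  also have "\<dots> \<le> n ^ (r * j) * s ^ n" using 1 2 by (rule mult_le_mono)
  finally show ?thesis .
qed

end

text \<open>Every \<open>m \<le> x\<close> is a square times a product of distinct primes.\<close>

lemma card_primes_ge:
  fixes x :: nat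
  assumes "x \<ge> 1"
  shows "x \<le> sqrt x * 2 ^ card {p. prime p \<and> p \<le> x}"
proof -
  let ?Pr = "{p. prime p \<and> p \<le> x}"
  \<comment> \<open>Erdos's encoding: there are at most \<open>sqrt x\<close> square parts and
    \<open>2 ^ card ?Pr\<close> sets of primes.\<close>
  let ?f = "\<lambda>m::nat. (square_part m, prime_factors (squarefree_part m))"
  let ?R = "nat \<lfloor>sqrt x\<rfloor>"
  have fin: "finite ?Pr" by simp
  have "inj_on ?f {1..x}"
  proof (rule inj_onI)
    fix a b assume ab: "a \<in> {1..x}" "b \<in> {1..x}" "?f a = ?f b"
    have sqf: "squarefree_part m = \<Prod>(prime_factors (squarefree_part m))" if "m \<in> {1..x}" for m :: nat
    proof -
      have "squarefree_part m \<noteq> 0" using that by auto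
      hence "squarefree_part m = (\<Prod>p\<in>prime_factors (squarefree_part m). p ^ multiplicity p (squarefree_part m))"
        by (simp add: prod_prime_factors)
      also have "\<dots> = \<Prod>(prime_factors (squarefree_part m))"
      proof (rule prod.cong)
        fix p assume p: "p \<in> prime_factors (squarefree_part m)"
        have "squarefree (squarefree_part m)" using that by auto
        hence "multiplicity p (squarefree_part m) = 1"
          using p squarefree_factorial_semiring'[OF \<open>squarefree_part m \<noteq> 0\<close>] by blast
        thus "p ^ multiplicity p (squarefree_part m) = p" by simp
      qed simp
      finally show ?thesis .
    qed
    have "squarefree_part a = squarefree_part b" using sqf[OF ab(1)] sqf[OF ab(2)] ab(3) by simp
    thus "a = b" using squarefree_decompose[of a] squarefree_decompose[of b] ab(3) by (metis prod.inject)
  qed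
  moreover have "?f ` {1..x} \<subseteq> {1..?R} \<times> Pow ?Pr"
  proof
    fix q assume "q \<in> ?f ` {1..x}"
    then obtain m where m: "m \<in> {1..x}" "q = ?f m" by blast
    have dec: "m = squarefree_part m * square_part m ^ 2" by (rule squarefree_decompose)
    have pos: "squarefree_part m > 0" "square_part m > 0"
    proof -
      have "m \<noteq> 0" using m by auto
      hence "squarefree_part m \<noteq> 0" "square_part m \<noteq> 0"
        using dec by (metis mult_0, metis mult_0_right zero_power2)
      thus "squarefree_part m > 0" "square_part m > 0" by (simp_all only: neq0_conv)
    qed
    have "square_part m ^ 2 \<le> m" using dec pos by (metis mult_le_mono1 nat_mult_1 One_nat_def Suc_leI)
    hence "real (square_part m ^ 2) \<le> real x" using m by (intro of_nat_mono) simp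
    hence "real (square_part m) \<le> sqrt x" by (intro real_le_rsqrt) simp
    hence "square_part m \<le> ?R" by (simp add: le_nat_floor)
    moreover have "squarefree_part m \<le> m" using dec pos by (metis dvd_imp_le dvd_triv_left mult_pos_pos zero_less_power)
    hence "prime_factors (squarefree_part m) \<subseteq> ?Pr"
      using m pos by (auto simp: in_prime_factors_iff dest!: dvd_imp_le)
    ultimately show "q \<in> {1..?R} \<times> Pow ?Pr" using m(2) pos by (simp add: Suc_le_eq)
  qed
  ultimately have "card {1..x} \<le> card ({1..?R} \<times> Pow ?Pr)" using fin by (intro card_inj_on_le[of ?f]) auto
  hence "x \<le> ?R * 2 ^ card ?Pr" using fin by (simp add: card_cartesian_product card_Pow)
  hence "real x \<le> real (?R * 2 ^ card ?Pr)" by (simp only: of_nat_le_iff)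
  also have "\<dots> = real ?R * 2 ^ card ?Pr" by simp
  also have "\<dots> \<le> sqrt x * 2 ^ card ?Pr" by (intro mult_right_mono) auto
  finally show ?thesis .
qed

section \<open>The asymptotic estimates\<close>

text \<open>The single term \<open>t ^ t / fact t\<close> of the series of \<open>exp t\<close> is
  at most its sum.\<close>

lemma fact_ge_powr: "(real t / exp 1) powr t \<le> fact t"
proof (cases "t = 0")
  case False
  let ?f = "\<lambda>k. real t ^ k /\<^sub>R fact k"
  have sums: "?f sums exp (real t)" by (rule exp_converges)
  have "sum ?f {t} \<le> suminf ?f"
    using sums by (intro sum_le_suminf) (auto simp: sums_iff)
  hence "real t ^ t / fact t \<le> exp (real t)" using sums by (simp add: sums_iff field_simps)
  hence "real t ^ t / exp (real t) \<le> fact t" by (simp add: field_simps)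
  moreover have "(real t / exp 1) powr t = real t ^ t / exp (real t)"
    using False by (simp add: powr_divide powr_realpow exp_powr_real)
  ultimately show ?thesis by simp
qed simp

text \<open>The 9 comes from \<open>t / e \<ge> (k / 3) / 3\<close>, the 6 from
  \<open>t \<ge> k / 3\<close> and the square root. The base involves the lower bound
  \<open>\<theta>\<close> instead of \<open>k\<close>, which makes the estimate geometric in
  \<open>k\<close>.\<close>

lemma sqrt_fact_ge:
  fixes \<theta> :: real and k t :: nat
  assumes "k \<le> 3 * t" "9 \<le> \<theta>" "\<theta> \<le> k"
  shows "(\<theta> / 9) powr (k / 6) \<le> sqrt (fact t)"
proof -
  have "\<theta> / 9 \<le> (k / 3) / 3" using assms by simp
  also have "\<dots> \<le> t / exp 1" using assms exp_le by (intro frac_le) auto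
  finally have 1: "\<theta> / 9 \<le> t / exp 1" .
  have "((\<theta> / 9) powr (k / 6))\<^sup>2 = (\<theta> / 9) powr (k / 3)"
    using assms by (simp add: power2_eq_square flip: powr_add)
  also have "\<dots> \<le> (\<theta> / 9) powr t" using assms by (intro powr_mono) auto
  also have "\<dots> \<le> (t / exp 1) powr t" using 1 assms by (intro powr_mono2) auto
  also have "\<dots> \<le> fact t" by (rule fact_ge_powr)
  finally show ?thesis by (rule real_le_rsqrt)
qed

section \<open>The distance bound for explicit parameters\<close>

lemma perm_group_of_subgroup:
  assumes "subgroup H (sym_group n)"
  shows "perm_group {1..n} H"
proof
  show "h permutes {1..n}" if "h \<in> H" for h
    using subgroup.subset[OF assms] that by (auto simp: sym_group_carrier)
  show "id \<in> H" using subgroup.one_closed[OF assms] by (simp only: sym_group_one)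
  show "g \<circ> h \<in> H" if "g \<in> H" "h \<in> H" for g h
    using subgroup.m_closed[OF assms that] by (simp only: sym_group_mult)
  show "inv' h \<in> H" if "h \<in> H" for h
    using subgroup.m_inv_closed[OF assms that] sym_group_inv_equality[of h n] subgroup.subset[OF assms] that by auto
qed simp

lemma D_dist_sym_group_le:
  assumes "subgroup H (sym_group n)"
  shows "D_dist (sym_group n) H \<le> (\<Sum>h\<in>H - {id}. 1 / sqrt (card (group.conj_class (sym_group n) h)))"
proof -
  interpret group "sym_group n" by (rule sym_group_is_group)
  have "finite (carrier (sym_group n))"
    using finite_permutations[of "{1..n}"] by (simp add: sym_group_def)
  from D_dist_le[OF this subgroup.subset[OF assms]] show ?thesis by (simp only: sym_group_one)
qed

lemma inverse_sqrt_card_conj_class_le: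
  fixes \<theta> :: real
  assumes h: "h \<in> carrier (sym_group n)" and \<theta>: "9 \<le> \<theta>" "\<theta> \<le> card (supp h)"
  shows "1 / sqrt (card (group.conj_class (sym_group n) h)) \<le> (\<theta> / 9) powr - (card (supp h) / 6)"
proof -
  have "group.conj_class (sym_group n) h = {g \<circ> h \<circ> inv' g |g. g \<in> carrier (sym_group n)}"
    unfolding group.conj_class_def[OF sym_group_is_group] sym_group_mult
    using sym_group_inv_equality by (auto simp: image_iff)
  then obtain t where t: "card (supp h) \<le> 3 * t" "fact t \<le> card (group.conj_class (sym_group n) h)"
    using card_conj_class_sym_group[OF h] by auto
  have "(\<theta> / 9) powr (card (supp h) / 6) \<le> sqrt (fact t)" using t(1) \<theta> by (rule sqrt_fact_ge)
  also have "\<dots> \<le> sqrt (card (group.conj_class (sym_group n) h))"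
    using t(2) by (metis of_nat_fact of_nat_mono real_sqrt_le_mono)
  finally show ?thesis using \<theta> by (simp add: powr_minus divide_simps)
qed

text \<open>Split by support size \<open>k\<close>, which is at least \<open>Suc \<theta>\<close>
  because of the separators. Up to the factor 4, level \<open>k\<close> contributes at most the
  \<open>k\<close>-th power of the left side of the last hypothesis.\<close>

lemma D_dist_not_doubly_transitive:
  fixes n b \<theta> :: nat
  assumes sub: "subgroup H (sym_group n)" and prim: "primitive n H"
    and not2: "\<not> perm_group.doubly_transitive {1..n} H"
    and \<theta>: "(6 * \<theta>\<^sup>2)\<^sup>2 + 6 * \<theta>\<^sup>2 < n" "9 \<le> Suc \<theta>"
    and b: "2 * n\<^sup>2 * (n - Suc \<theta>) ^ b \<le> n ^ b" and n: "n \<ge> 2"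
    and q: "n powr (12 * b / n) * (Suc \<theta> / 9) powr (- (1/6)) \<le> 1/2"
  shows "D_dist (sym_group n) H \<le> 4 * (real n + 1) * (1/2) ^ Suc \<theta>"
proof -
  interpret perm_group "{1..n}" H using sub by (rule perm_group_of_subgroup)
  have pg: "perm_group {1..n} H" by (rule perm_group_of_subgroup[OF sub])
  let ?cl = "group.conj_class (sym_group n)"
  define S where "S k = {h \<in> H. card (supp h) = k}" for k
  have sep: "Suc \<theta> \<le> card (separators y z)" if "y \<in> {1..n}" "z \<in> {1..n}" "y \<noteq> z" for y z
    using separators_large[OF prim pg not2 \<theta>(1) that] by simp
  have supp_ge: "Suc \<theta> \<le> card (supp h)" if h: "h \<in> H" "h \<noteq> id" for h
  proof -
    obtain y where y: "h y \<noteq> y" using h(2) by (auto simp: fun_eq_iff)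
    hence y': "y \<in> {1..n}" using supp_subset[OF h(1)] unfolding supp_def by blast
    hence "h y \<in> {1..n}" using mem_points[OF h(1), of y] by blast
    hence "Suc \<theta> \<le> card (separators y (h y))" using sep[OF y'] y by metis
    also have "\<dots> \<le> card (supp h)"
      by (rule card_mono[OF finite_supp[OF h(1)] separators_apply_subset_supp[OF h(1)]])
    finally show ?thesis .
  qed
  have level: "(\<Sum>h\<in>S k. 1 / sqrt (card (?cl h))) \<le> 4 * (1/2) ^ Suc \<theta>" if k: "k \<in> {Suc \<theta>..n}" for k
  proof -
    \<comment> \<open>An admissible \<open>J\<close> for \<open>card_support_le\<close>. With
      \<open>n\<^sup>2 + 1 \<le> n ^ 3\<close> the count becomes
      \<open>4 * n powr (12 * b / n * k)\<close>, whence the 12.\<close>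
    let ?J = "(4 * b * k) div n"
    have "4 * b * k < n + ?J * n" using n by (intro dividend_less_div_times) simp
    hence J: "4 * b * k \<le> (?J + 1) * n" by simp
    have "card (S k) \<le> 4 * (n\<^sup>2 + 1) ^ ?J"
      unfolding S_def by (rule card_support_le[OF _ sep b J]) (use n in auto)
    hence "real (card (S k)) \<le> real (4 * (n\<^sup>2 + 1) ^ ?J)" by (simp only: of_nat_le_iff)
    also have "\<dots> = 4 * ((real n)\<^sup>2 + 1) ^ ?J" by (simp add: add.commute)
    also have "((real n)\<^sup>2 + 1) ^ ?J \<le> (real n ^ 3) ^ ?J"
    proof (rule power_mono)
      have "n\<^sup>2 + 1 \<le> n\<^sup>2 * 2" using n by simp
      also have "\<dots> \<le> n\<^sup>2 * n" using n by (intro mult_le_mono2)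
      finally have "n\<^sup>2 + 1 \<le> n ^ 3" by (simp add: power2_eq_square power3_eq_cube)
      hence "real (n\<^sup>2 + 1) \<le> real (n ^ 3)" by (simp only: of_nat_le_iff)
      thus "(real n)\<^sup>2 + 1 \<le> real n ^ 3" by (simp add: add.commute)
    qed simp
    also have "(real n ^ 3) ^ ?J = real n ^ (3 * ?J)" by (rule power_mult[symmetric])
    also have "\<dots> = n powr real (3 * ?J)" using n by (intro powr_realpow[symmetric]) simp
    also have "\<dots> \<le> n powr (12 * b / n * k)"
    proof (rule powr_mono)
      have "real ?J \<le> real (4 * b * k) / real n" by (rule of_nat_div_le_of_nat)
      thus "real (3 * ?J) \<le> real (12 * b) / real n * real k" by simp
    qed (use n in simp)
    finally have cS: "real (card (S k)) \<le> 4 * n powr (12 * b / n * k)" by simp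
    have "(\<Sum>h\<in>S k. 1 / sqrt (card (?cl h))) \<le> (\<Sum>h\<in>S k. (Suc \<theta> / 9) powr - (k / 6))"
    proof (rule sum_mono)
      fix h assume h: "h \<in> S k"
      hence "h \<in> carrier (sym_group n)" using subgroup.subset[OF sub] by (auto simp: S_def)
      moreover have ck: "card (supp h) = k" using h by (simp add: S_def)
      ultimately show "1 / sqrt (card (?cl h)) \<le> (Suc \<theta> / 9) powr - (k / 6)"
        using inverse_sqrt_card_conj_class_le[of h n "real (Suc \<theta>)"] \<theta>(2) k unfolding ck by simp
    qed
    also have "\<dots> = card (S k) * (Suc \<theta> / 9) powr - (k / 6)" by simp
    also have "\<dots> \<le> (4 * n powr (12 * b / n * k)) * (Suc \<theta> / 9) powr - (k / 6)"
      using cS by (intro mult_right_mono) auto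
    also have "\<dots> = 4 * (n powr (12 * b / n) * (Suc \<theta> / 9) powr (- (1/6))) ^ k"
      using n by (simp add: power_mult_distrib powr_power mult_ac)
    also have "\<dots> \<le> 4 * (1/2) ^ k" using q by (intro mult_left_mono power_mono) auto
    also have "\<dots> \<le> 4 * (1/2) ^ Suc \<theta>" using k by (intro mult_left_mono power_decreasing) auto
    finally show ?thesis .
  qed
  have supp_le: "card (supp h) \<le> n" if "h \<in> H" for h
    using card_mono[OF finite_points supp_subset[OF that]] by simp
  have "D_dist (sym_group n) H \<le> (\<Sum>h\<in>H - {id}. 1 / sqrt (card (?cl h)))"
    using sub by (rule D_dist_sym_group_le)
  also have "\<dots> \<le> (\<Sum>h\<in>(\<Union>k\<in>{Suc \<theta>..n}. S k). 1 / sqrt (card (?cl h)))"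
  proof (rule sum_mono2)
    show "finite (\<Union>k\<in>{Suc \<theta>..n}. S k)" using finite_group by (auto simp: S_def)
    show "H - {id} \<subseteq> (\<Union>k\<in>{Suc \<theta>..n}. S k)"
    proof
      fix h assume h: "h \<in> H - {id}"
      hence "card (supp h) \<in> {Suc \<theta>..n}" using supp_ge[of h] supp_le[of h] by simp
      moreover have "h \<in> S (card (supp h))" using h by (simp add: S_def)
      ultimately show "h \<in> (\<Union>k\<in>{Suc \<theta>..n}. S k)" by blast
    qed
  qed auto
  also have "\<dots> = (\<Sum>k\<in>{Suc \<theta>..n}. \<Sum>h\<in>S k. 1 / sqrt (card (?cl h)))"
    using finite_group by (intro sum.UNION_disjoint) (auto simp: S_def)
  also have "\<dots> \<le> (\<Sum>k\<in>{Suc \<theta>..n}. 4 * (1/2) ^ Suc \<theta>)" by (intro sum_mono level)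
  also have "\<dots> = real (n + 1 - Suc \<theta>) * (4 * (1/2) ^ Suc \<theta>)" by simp
  also have "\<dots> \<le> real (n + 1) * (4 * (1/2) ^ Suc \<theta>)" by (intro mult_right_mono) auto
  finally show ?thesis by (simp only: mult_ac of_nat_add of_nat_1)
qed

text \<open>\<open>P\<close> consists of the primes up to \<open>x\<close>. By
  \<open>card_primes_ge\<close> there are more than \<open>10 * \<tau>\<close> of them, while their
  sum \<open>r\<close>, the cost of one breaking step, is at most \<open>x\<^sup>2\<close>.\<close>

lemma card_doubly_transitive_le:
  fixes n s x j \<tau> :: nat
  assumes sub: "subgroup H (sym_group n)"
    and dt: "perm_group.doubly_transitive {1..n} H"
    and neq: "H \<noteq> carrier (alt_group n)" "H \<noteq> carrier (sym_group n)"
    and x: "2 \<le> x" and \<tau>: "fact (Suc \<tau>) > n" "2 powr (10 * \<tau>) < sqrt x"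
    and s: "s \<ge> 1" and j: "n * ln n * (2 * real x ^ 2 + 1) < real j * s" and n: "n > 0"
  shows "card H \<le> n ^ (x\<^sup>2 * j) * s ^ n"
proof -
  interpret perm_group "{1..n}" H using sub by (rule perm_group_of_subgroup)
  have pg: "perm_group {1..n} H" by unfold_locales
  define P where "P = {p. prime p \<and> p \<le> x}"
  define r where "r = \<Sum>P"
  \<comment> \<open>Chosen so that Bernoulli's bound \<open>1 - r * \<gamma>\<close> for
    \<open>(1 - \<gamma>) ^ r\<close> exceeds 1/2.\<close>
  define \<gamma> where "\<gamma> = 1 / (2 * real r + 1)"
  have P: "finite P" "\<And>p. p \<in> P \<Longrightarrow> prime p" by (auto simp: P_def)
  have "sqrt x * sqrt x \<le> sqrt x * 2 ^ card P" using card_primes_ge[of x] x by (simp add: P_def)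
  hence "sqrt x \<le> 2 ^ card P" by (subst (asm) mult_le_cancel_left_pos) (use x in auto)
  hence "2 powr (10 * \<tau>) < 2 powr (card P)" using \<tau>(2) by (simp add: powr_realpow)
  hence cP: "10 * \<tau> < card P" by simp
  have "r \<le> (\<Sum>p\<in>{1..x}. x)" unfolding r_def
  proof -
    have "\<Sum>P \<le> (\<Sum>p\<in>P. x)" by (intro sum_mono) (auto simp: P_def)
    also have "\<dots> \<le> (\<Sum>p\<in>{1..x}. x)"
      by (intro sum_mono2) (auto simp: P_def dest: prime_ge_1_nat)
    finally show "\<Sum>P \<le> (\<Sum>p\<in>{1..x}. x)" .
  qed
  hence r_le: "r \<le> x\<^sup>2" by (simp add: power2_eq_square)
  have "2 \<in> P" using x by (simp add: P_def)
  hence r1: "r \<ge> 1" unfolding r_def using member_le_sum[of 2 P "\<lambda>p. p"] P(1) by simp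
  have \<gamma>: "0 < \<gamma>" "\<gamma> \<le> 1/2" "\<gamma> < 1" using r1 by (auto simp: \<gamma>_def field_simps)
  have "1 - real r * \<gamma> > 1/2" using r1 by (simp add: \<gamma>_def field_simps)
  also have "1 - real r * \<gamma> \<le> (1 - \<gamma>) ^ r" using Bernoulli_inequality[of "- \<gamma>" r] \<gamma> by simp
  finally have \<gamma>r: "(1 - \<gamma>) ^ r > 1/2" .
  have deg: "n \<le> 10 * card (supp h)" if "h \<in> H" "h \<noteq> id" for h
    by (rule minimal_degree_doubly_transitive[OF sub pg dt neq that])
  have jj: "n * ln n < j * \<gamma> * s"
  proof -
    have "n * ln n * (2 * real r + 1) \<le> n * ln n * (2 * real x ^ 2 + 1)"
    proof (rule mult_left_mono)
      have "real r \<le> real (x\<^sup>2)" using r_le by (simp only: of_nat_le_iff)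
      thus "2 * real r + 1 \<le> 2 * real x ^ 2 + 1" by simp
    qed (use n in simp)
    hence "n * ln n * (2 * real r + 1) < real j * s" using j by simp
    thus ?thesis using r1 by (simp add: \<gamma>_def field_simps)
  qed
  have "card H \<le> n ^ (r * j) * s ^ n"
  proof (rule card_le_of_breaking[OF _ n \<gamma>(1,3) s _ jj])
    fix B y assume y: "y \<in> {1..n}" "s < card (orb (fixer H B) y)"
    show "\<exists>W. W \<subseteq> orb (fixer H B) y \<and> card W < r \<and>
           (\<forall>z\<in>orb (fixer H B) y. card (orb (fixer H (B \<union> W)) z) \<le> (1 - \<gamma>) * card (orb (fixer H B) y))"
      using y s by (intro ex_orbit_breaking_set[OF P r_def _ n \<tau>(1) cP deg \<gamma>(1,2) \<gamma>r]) auto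
  qed simp
  also have "\<dots> \<le> n ^ (x\<^sup>2 * j) * s ^ n"
    using n r_le by (intro mult_le_mono1 power_increasing) auto
  finally show ?thesis .
qed

text \<open>All supports have at least \<open>n / 10\<close> points, which turns the 9 and 6 of
  \<open>sqrt_fact_ge\<close> into 90 and 60. Together with the bound on \<open>card H\<close> the
  total is an \<open>n\<close>-th power.\<close>

lemma D_dist_doubly_transitive:
  fixes n s x j \<tau> :: nat
  assumes sub: "subgroup H (sym_group n)"
    and dt: "perm_group.doubly_transitive {1..n} H"
    and neq: "H \<noteq> carrier (alt_group n)" "H \<noteq> carrier (sym_group n)"
    and x: "2 \<le> x" and \<tau>: "fact (Suc \<tau>) > n" "2 powr (10 * \<tau>) < sqrt x"
    and s: "s \<ge> 1" and j: "n * ln n * (2 * real x ^ 2 + 1) < real j * s" and n: "n \<ge> 90"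
    and q: "n powr (x\<^sup>2 * j / n) * s * (n / 90) powr (- (1/60)) \<le> 1/2"
  shows "D_dist (sym_group n) H \<le> (1/2) ^ n"
proof -
  interpret perm_group "{1..n}" H using sub by (rule perm_group_of_subgroup)
  have pg: "perm_group {1..n} H" by unfold_locales
  have deg: "n \<le> 10 * card (supp h)" if "h \<in> H" "h \<noteq> id" for h
    by (rule minimal_degree_doubly_transitive[OF sub pg dt neq that])
  let ?cl = "group.conj_class (sym_group n)"
  have "D_dist (sym_group n) H \<le> (\<Sum>h\<in>H - {id}. 1 / sqrt (card (?cl h)))"
    using sub by (rule D_dist_sym_group_le)
  also have "\<dots> \<le> (\<Sum>h\<in>H - {id}. (n / 90) powr - (n / 60))"
  proof (rule sum_mono)
    fix h assume h: "h \<in> H - {id}"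
    hence hc: "h \<in> carrier (sym_group n)" using subgroup.subset[OF sub] by auto
    have k: "real n / 10 \<le> card (supp h)" using deg[of h] h by simp
    have "1 / sqrt (card (?cl h)) \<le> (n / 10 / 9) powr - (card (supp h) / 6)"
      using n k inverse_sqrt_card_conj_class_le[OF hc, of "n / 10"] by simp
    also have "\<dots> \<le> (n / 10 / 9) powr - (n / 60)" using n k by (intro powr_mono) auto
    finally show "1 / sqrt (card (?cl h)) \<le> (n / 90) powr - (n / 60)" by simp
  qed
  also have "\<dots> = real (card (H - {id})) * (n / 90) powr - (n / 60)" by simp
  also have "\<dots> \<le> real (card H) * (n / 90) powr - (n / 60)"
    using finite_group by (intro mult_right_mono) (auto intro: card_mono)
  also have "\<dots> \<le> (real n ^ (x\<^sup>2 * j) * real s ^ n) * (n / 90) powr - (n / 60)"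
  proof (rule mult_right_mono)
    have "card H \<le> n ^ (x\<^sup>2 * j) * s ^ n"
      using n by (intro card_doubly_transitive_le[OF sub dt neq x \<tau> s j]) auto
    hence "real (card H) \<le> real (n ^ (x\<^sup>2 * j) * s ^ n)" by (simp only: of_nat_le_iff)
    thus "real (card H) \<le> real n ^ (x\<^sup>2 * j) * real s ^ n" by simp
  qed simp
  also have "\<dots> = (n powr (x\<^sup>2 * j / n) * s * (n / 90) powr (- (1/60))) ^ n"
  proof -
    have "(n powr (real (x\<^sup>2 * j) / n)) ^ n = n powr real (x\<^sup>2 * j)"
      using n by (simp add: powr_power del: of_nat_mult of_nat_power)
    also have "\<dots> = real n ^ (x\<^sup>2 * j)" using n by (intro powr_realpow) simp
    finally have "(n powr (x\<^sup>2 * j / n)) ^ n = real n ^ (x\<^sup>2 * j)" by simp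
    moreover have "((n / 90) powr (- (1/60))) ^ n = (n / 90) powr - (n / 60)"
      using n by (simp add: powr_power)
    ultimately show ?thesis by (simp add: power_mult_distrib)
  qed
  also have "\<dots> \<le> (1/2) ^ n" using q by (intro power_mono) auto
  finally show ?thesis .
qed


section \<open>Choice of the parameters as functions of \<open>n\<close>\<close>

lemma nat_floor_bounds:
  fixes y :: real
  assumes "0 \<le> y"
  shows "real (nat \<lfloor>y\<rfloor>) \<le> y" "y < real (Suc (nat \<lfloor>y\<rfloor>))"
  using assms by (simp, linarith)

text \<open>The fourth root in \<open>\<theta>\<close> is dictated by
  \<open>36 * \<theta> ^ 4 < n\<close>. The exponent 7/8 of \<open>b\<close> makes
  \<open>\<theta> * b / n\<close>, of order \<open>n powr (1/8)\<close>, beat \<open>ln n\<close>,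
  while \<open>n powr (12 * b / n)\<close> still tends to 1.\<close>

lemma eventually_D_dist_not_doubly_transitive:
  "\<forall>\<^sub>F n in sequentially. \<forall>H. subgroup H (sym_group n) \<longrightarrow> primitive n H \<longrightarrow>
     \<not> perm_group.doubly_transitive {1..n} H \<longrightarrow>
     D_dist (sym_group n) H \<le> 4 * (real n + 1) * 2 powr (- (n powr (1/4) / 4))"
proof -
  have e1: "\<forall>\<^sub>F n in sequentially. 36 * (real n powr (1/4) / 4) ^ 4 + 6 * (real n powr (1/4) / 4) ^ 2 < real n"
    using eventually_ge_at_top[of 1]
  proof eventually_elim
    case (elim n)
    have "(real n powr (1/4)) ^ 4 = real n" using elim by (simp add: powr_power)
    moreover have "(real n powr (1/4)) ^ 2 \<le> real n"
      using elim powr_mono[of "1/2" 1 "real n"] by (simp add: powr_power)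
    ultimately show ?case using elim by (simp add: power_divide)
  qed
  have e2: "\<forall>\<^sub>F n in sequentially. 9 \<le> real n powr (1/4) / 4" by real_asymp
  have e3: "\<forall>\<^sub>F n in sequentially. 2 * real n ^ 2 * exp (- (real n powr (1/4) / 4 * (real n powr (7/8)) / real n)) \<le> 1"
    by real_asymp
  have e4: "\<forall>\<^sub>F n in sequentially.
      real n powr (12 * (real n powr (7/8) + 1) / real n) * (real n powr (1/4) / 4 / 9) powr (- (1/6)) \<le> 1/2"
    by real_asymp
  show ?thesis
    using e1 e2 e3 e4 eventually_ge_at_top[of 2]
  proof eventually_elim
    case (elim n)
    define c where "c = real n powr (1/4) / 4"
    define \<theta> where "\<theta> = nat \<lfloor>c\<rfloor>"
    define b where "b = Suc (nat \<lfloor>real n powr (7/8)\<rfloor>)"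
    have c: "real \<theta> \<le> c" "c < real (Suc \<theta>)" "c \<ge> 9"
      using elim(2) nat_floor_bounds[of c] by (auto simp: \<theta>_def c_def)
    have b: "real n powr (7/8) \<le> real b" "real b \<le> real n powr (7/8) + 1"
      using nat_floor_bounds[of "real n powr (7/8)"] unfolding b_def by auto
    have t1: "(6 * \<theta>\<^sup>2)\<^sup>2 + 6 * \<theta>\<^sup>2 < n"
    proof -
      have "real ((6 * \<theta>\<^sup>2)\<^sup>2 + 6 * \<theta>\<^sup>2) = 36 * real \<theta> ^ 4 + 6 * real \<theta> ^ 2"
        by (simp add: power_mult_distrib flip: power_mult)
      also have "\<dots> \<le> 36 * c ^ 4 + 6 * c ^ 2" using c by (intro add_mono mult_left_mono power_mono) auto
      also have "\<dots> < real n" using elim(1) by (simp add: c_def)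
      finally show ?thesis by (simp only: of_nat_less_iff)
    qed
    have t2: "9 \<le> Suc \<theta>" using c by linarith
    have \<theta>n: "Suc \<theta> \<le> n"
    proof -
      have "\<theta> \<le> 6 * \<theta>\<^sup>2" by (cases \<theta>) (auto simp: power2_eq_square)
      thus ?thesis using t1 by simp
    qed
    have t3: "2 * n\<^sup>2 * (n - Suc \<theta>) ^ b \<le> n ^ b"
    proof -
      have "real (n - Suc \<theta>) = real n * (1 - real (Suc \<theta>) / real n)"
        using \<theta>n elim(5) by (simp add: field_simps of_nat_diff)
      also have "\<dots> \<le> real n * exp (- (real (Suc \<theta>) / real n))"
        using exp_ge_add_one_self[of "- (real (Suc \<theta>) / real n)"] by (intro mult_left_mono) auto
      also have "\<dots> \<le> real n * exp (- (c / real n))" using c by (intro mult_left_mono) (auto simp: divide_right_mono)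
      finally have "real (n - Suc \<theta>) ^ b \<le> (real n * exp (- (c / real n))) ^ b" by (intro power_mono) auto
      also have "\<dots> = real n ^ b * exp (- (c * real b / real n))"
        by (simp add: power_mult_distrib mult_ac flip: exp_of_nat_mult)
      also have "\<dots> \<le> real n ^ b * exp (- (c * real n powr (7/8) / real n))"
        using b(1) c by (intro mult_left_mono) (auto intro!: divide_right_mono mult_left_mono)
      finally have *: "real (n - Suc \<theta>) ^ b \<le> real n ^ b * exp (- (c * real n powr (7/8) / real n))" .
      have "real (2 * n\<^sup>2 * (n - Suc \<theta>) ^ b) = 2 * real n ^ 2 * real (n - Suc \<theta>) ^ b" by simp
      also have "\<dots> \<le> 2 * real n ^ 2 * (real n ^ b * exp (- (c * real n powr (7/8) / real n)))"
        using * by (intro mult_left_mono) auto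
      also have "\<dots> = real n ^ b * (2 * real n ^ 2 * exp (- (c * real n powr (7/8) / real n)))"
        by (simp only: mult_ac)
      also have "\<dots> \<le> real n ^ b * 1" using elim(3) by (intro mult_left_mono) (auto simp: c_def)
      finally have "real (2 * n\<^sup>2 * (n - Suc \<theta>) ^ b) \<le> real (n ^ b)" by simp
      thus ?thesis by (simp only: of_nat_le_iff)
    qed
    have t4: "n powr (12 * b / n) * (Suc \<theta> / 9) powr (- (1/6)) \<le> 1/2"
    proof -
      have "n powr (12 * b / n) * (Suc \<theta> / 9) powr (- (1/6))
          \<le> n powr (12 * (n powr (7/8) + 1) / n) * (c / 9) powr (- (1/6))"
        using b c elim(5)
        by (intro mult_mono powr_mono powr_mono2' divide_right_mono mult_left_mono) auto
      also have "\<dots> \<le> 1/2" using elim(4) by (simp only: c_def)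
      finally show ?thesis .
    qed
    have "(1/2 :: real) ^ Suc \<theta> = 2 powr (- real (Suc \<theta>))"
      by (simp only: powr_minus powr_realpow zero_less_numeral power_one_over inverse_eq_divide)
    also have "\<dots> \<le> 2 powr (- c)" using c by (intro powr_mono) auto
    finally have half: "(1/2 :: real) ^ Suc \<theta> \<le> 2 powr (- c)" .
    show ?case
    proof (intro allI impI)
      fix H assume H: "subgroup H (sym_group n)" "primitive n H" "\<not> perm_group.doubly_transitive {1..n} H"
      have "D_dist (sym_group n) H \<le> 4 * (real n + 1) * (1/2) ^ Suc \<theta>"
        by (rule D_dist_not_doubly_transitive[OF H t1 t2 t3 elim(5) t4])
      also have "\<dots> \<le> 4 * (real n + 1) * 2 powr (- c)" using half by (intro mult_left_mono) auto
      finally show "D_dist (sym_group n) H \<le> 4 * (real n + 1) * 2 powr (- (n powr (1/4) / 4))"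
        by (simp only: c_def)
    qed
  qed
qed

text \<open>With these \<open>x\<close> and \<open>s\<close> the exponent
  \<open>x\<^sup>2 * j / n\<close> has order \<open>x ^ 4 * ln n / s\<close>, that is
  \<open>n powr (- 1/1000) * ln n\<close>, so this power of \<open>n\<close> tends to 1; and
  \<open>s\<close> stays below the gain \<open>n powr (1/60)\<close>. The small
  \<open>\<tau>\<close> gives \<open>2 powr (10 * \<tau>) \<le> n powr (1/5000)\<close>, which is
  below \<open>sqrt x\<close>.\<close>

lemma eventually_D_dist_doubly_transitive:
  "\<forall>\<^sub>F n in sequentially. \<forall>H. subgroup H (sym_group n) \<longrightarrow>
     perm_group.doubly_transitive {1..n} H \<longrightarrow> H \<noteq> carrier (alt_group n) \<longrightarrow> H \<noteq> carrier (sym_group n) \<longrightarrow>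
     D_dist (sym_group n) H \<le> (1/2) ^ n"
proof -
  have e1: "\<forall>\<^sub>F n in sequentially. 3 \<le> real n powr (1/1000)" by real_asymp
  \<comment> \<open>The base tends to infinity, so this outgrows every power of \<open>n\<close>.
    The 150000 is 3 times 50000, with 3 as a bound for \<open>e\<close> in
    \<open>fact_ge_powr\<close>.\<close>
  have e2: "\<forall>\<^sub>F n in sequentially. real n < (ln (real n) / 150000) powr (ln (real n) / 50000)" by real_asymp
  have e3: "\<forall>\<^sub>F n in sequentially. real n powr (1/5000) < sqrt (real n powr (1/1000) - 1)" by real_asymp
  have e4: "\<forall>\<^sub>F n in sequentially. 2 \<le> real n powr (1/200)" by real_asymp
  have e5: "\<forall>\<^sub>F n in sequentially. real n powr (real n powr (2/1000) *
      (real n * ln (real n) * (2 * real n powr (2/1000) + 1) / (real n powr (1/200) - 1) + 2) / real n)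
      * real n powr (1/200) * (real n / 90) powr (- (1/60)) \<le> 1/2" by real_asymp
  have e6: "\<forall>\<^sub>F n in sequentially. 150000 \<le> ln (real n)" by real_asymp
  show ?thesis
    using e1 e2 e3 e4 e5 e6 eventually_ge_at_top[of 90]
  proof eventually_elim
    case (elim n)
    define x where "x = nat \<lfloor>real n powr (1/1000)\<rfloor>"
    define s where "s = nat \<lfloor>real n powr (1/200)\<rfloor>"
    define \<tau> where "\<tau> = nat \<lfloor>ln (real n) / 50000\<rfloor>"
    define R where "R = real n * ln (real n) * (2 * real x ^ 2 + 1) / real s"
    define j where "j = nat \<lfloor>R\<rfloor> + 1"
    have x: "real x \<le> real n powr (1/1000)" "real n powr (1/1000) - 1 < real x"
      unfolding x_def by (simp, linarith)
    have x2: "2 \<le> x" using x elim(1) by linarith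
    have s: "real s \<le> real n powr (1/200)" "real n powr (1/200) - 1 < real s"
      unfolding s_def by (simp, linarith)
    have s1: "s \<ge> 1" using s elim(4) by linarith
    have ln0: "ln (real n) > 0" using elim(6) by simp
    have \<tau>: "real \<tau> \<le> ln (real n) / 50000" "ln (real n) / 50000 < real (Suc \<tau>)"
      using ln0 nat_floor_bounds[of "ln (real n) / 50000"] unfolding \<tau>_def by auto
    have t1: "fact (Suc \<tau>) > n"
    proof -
      have "real n < (ln (real n) / 150000) powr (ln (real n) / 50000)" by (rule elim(2))
      also have "\<dots> \<le> (ln (real n) / 150000) powr (Suc \<tau>)" using \<tau>(2) elim(6) by (intro powr_mono) auto
      also have "\<dots> \<le> (Suc \<tau> / exp 1) powr (Suc \<tau>)"
      proof (rule powr_mono2)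
        have "ln (real n) / 150000 = (ln (real n) / 50000) / 3" by simp
        also have "\<dots> \<le> real (Suc \<tau>) / exp 1"
          using \<tau>(2) ln0 exp_le by (intro frac_le) auto
        finally show "ln (real n) / 150000 \<le> real (Suc \<tau>) / exp 1" .
      qed (use ln0 in auto)
      also have "\<dots> \<le> fact (Suc \<tau>)" by (rule fact_ge_powr)
      finally have "real n < real (fact (Suc \<tau>))" by (simp only: of_nat_fact)
      thus ?thesis by (simp only: of_nat_less_iff)
    qed
    have t2: "2 powr (10 * \<tau>) < sqrt x"
    proof -
      have "2 powr (10 * \<tau>) \<le> exp 1 powr (10 * \<tau>)" using exp_ge_add_one_self[of 1] by (intro powr_mono2) auto
      also have "\<dots> \<le> exp 1 powr (ln (real n) / 5000)" using \<tau>(1) by (intro powr_mono) auto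
      also have "\<dots> = real n powr (1/5000)" using elim(7) by (simp add: powr_def)
      also have "\<dots> < sqrt (real n powr (1/1000) - 1)" by (rule elim(3))
      also have "\<dots> \<le> sqrt x" using x(2) by simp
      finally show ?thesis .
    qed
    have R0: "R \<ge> 0" using ln0 by (simp add: R_def)
    have j: "R < real j" "real j \<le> R + 1" using R0 unfolding j_def by linarith+
    have t3: "n * ln n * (2 * real x ^ 2 + 1) < real j * s"
      using j(1) s1 by (simp add: R_def field_simps)
    have t4: "n powr (x\<^sup>2 * j / n) * s * (n / 90) powr (- (1/60)) \<le> 1/2"
    proof -
      have "real x ^ 2 \<le> (real n powr (1/1000)) ^ 2" using x by (intro power_mono) auto
      also have "\<dots> = real n powr (2/1000)" using elim(7) by (simp add: powr_power)
      finally have xx: "real x ^ 2 \<le> real n powr (2/1000)" .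
      have "R \<le> real n * ln (real n) * (2 * real n powr (2/1000) + 1) / (real n powr (1/200) - 1)"
        unfolding R_def using xx s elim(4) ln0 by (intro frac_le mult_left_mono) auto
      hence "real j \<le> real n * ln (real n) * (2 * real n powr (2/1000) + 1) / (real n powr (1/200) - 1) + 2"
        using j(2) by simp
      hence "real (x\<^sup>2 * j) \<le> real n powr (2/1000) *
          (real n * ln (real n) * (2 * real n powr (2/1000) + 1) / (real n powr (1/200) - 1) + 2)"
        using xx by (simp only: of_nat_mult of_nat_power) (intro mult_mono, auto)
      hence "n powr (x\<^sup>2 * j / n) * s * (n / 90) powr (- (1/60))
        \<le> real n powr (real n powr (2/1000) *
      (real n * ln (real n) * (2 * real n powr (2/1000) + 1) / (real n powr (1/200) - 1) + 2) / real n)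
      * real n powr (1/200) * (real n / 90) powr (- (1/60))"
        using s(1) elim(7) by (intro mult_mono powr_mono divide_right_mono) auto
      also have "\<dots> \<le> 1/2" by (rule elim(5))
      finally show ?thesis .
    qed
    show ?case
      using D_dist_doubly_transitive[OF _ _ _ _ x2 t1 t2 s1 t3 elim(7) t4] by blast
  qed
qed

lemma eventually_D_dist_primitive:
  "\<forall>\<^sub>F n in sequentially. \<forall>H. subgroup H (sym_group n) \<longrightarrow> primitive n H \<longrightarrow>
     H \<noteq> carrier (alt_group n) \<longrightarrow> H \<noteq> carrier (sym_group n) \<longrightarrow>
     D_dist (sym_group n) H \<le> 4 * (real n + 1) * 2 powr (- (n powr (1/4) / 4))"
proof -
  have "\<forall>\<^sub>F n in sequentially. (1/2) ^ n \<le> 4 * (real n + 1) * 2 powr (- (real n powr (1/4) / 4))"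
    by real_asymp
  thus ?thesis
    using eventually_D_dist_doubly_transitive eventually_D_dist_not_doubly_transitive
  proof eventually_elim
    case (elim n)
    show ?case
    proof (intro allI impI)
      fix H assume H: "subgroup H (sym_group n)" "primitive n H"
        "H \<noteq> carrier (alt_group n)" "H \<noteq> carrier (sym_group n)"
      show "D_dist (sym_group n) H \<le> 4 * (real n + 1) * 2 powr (- (n powr (1/4) / 4))"
      proof (cases "perm_group.doubly_transitive {1..n} H")
        case True
        have "D_dist (sym_group n) H \<le> (1/2) ^ n" using elim(2) H(1,3,4) True by blast
        thus ?thesis using elim(1) by linarith
      next
        case False
        thus ?thesis using elim(3) H(1,2) by blast
      qed
    qed
  qed
qed

lemma ln_fact_le: "n \<ge> 1 \<Longrightarrow> ln (fact n) \<le> real n ^ 2"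
proof -
  assume n: "n \<ge> 1"
  have "(fact n :: real) \<le> real n ^ n" using fact_le_power[of n, where 'a = real] by simp
  hence "ln (fact n) \<le> ln (real n ^ n)" using n by simp
  also have "\<dots> = real n * ln (real n)" using n by (simp add: ln_realpow)
  also have "\<dots> \<le> real n * real n" using n ln_le_minus_one[of "real n"] by (intro mult_left_mono) auto
  finally show ?thesis by (simp add: power2_eq_square)
qed

text \<open>By \<open>ln_fact_le\<close> the threshold is at least \<open>n powr (- 2 * c)\<close>,
  which the superpolynomially small distance eventually undercuts; since \<open>I\<close> is
  infinite, some \<open>n\<close> in \<open>I\<close> is large enough for a contradiction.\<close>

theorem theorem3:
  fixes I :: "nat set" and H :: "nat \<Rightarrow> (nat \<Rightarrow> nat) set"
  assumes "infinite I" and "\<forall>n \<in> I. n > 0"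
    and "\<forall>n \<in> I. subgroup (H n) (sym_group n)"
    and "\<forall>n \<in> I. primitive n (H n)"
    and "\<forall>n \<in> I. H n \<noteq> carrier (alt_group n)"
    and "\<forall>n \<in> I. H n \<noteq> carrier (sym_group n)"
  shows "indistinguishable I sym_group H"
  unfolding indistinguishable_def distinguishable_def
proof
  assume "\<exists>c>0. \<exists>N. \<forall>i\<in>I. N \<le> i \<longrightarrow>
    ln (real (card (carrier (sym_group i)))) powr - c \<le> D_dist (sym_group i) (H i)"
  then obtain c N where c: "c > 0"
    and lower: "\<And>i. i \<in> I \<Longrightarrow> N \<le> i \<Longrightarrow>
      ln (real (card (carrier (sym_group i)))) powr - c \<le> D_dist (sym_group i) (H i)" by blast
  have "\<forall>\<^sub>F n in sequentially. 4 * (real n + 1) * 2 powr (- (real n powr (1/4) / 4)) < (real n ^ 2) powr (- c)"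
    using c by real_asymp
  with eventually_D_dist_primitive
  have "\<forall>\<^sub>F n in sequentially. n \<in> I \<longrightarrow> D_dist (sym_group n) (H n) < (real n ^ 2) powr (- c)"
    by eventually_elim (use assms in fastforce)
  then obtain M where M: "\<And>n. n \<ge> M \<Longrightarrow> n \<in> I \<Longrightarrow> D_dist (sym_group n) (H n) < (real n ^ 2) powr (- c)"
    unfolding eventually_sequentially by blast
  \<comment> \<open>\<open>n \<ge> 2\<close> makes \<open>ln (fact n)\<close> positive, as needed to
    reverse the inequality under \<open>powr\<close> with a negative exponent.\<close>
  obtain n where n: "n \<in> I" "n \<ge> max (max M N) 2"
    using assms(1) infinite_nat_iff_unbounded_le by blast
  have "fact 2 \<le> (fact n :: real)" using n by (intro fact_mono) simp
  hence "ln (fact n :: real) > 0" by (simp add: fact_2)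
  moreover have "ln (fact n) \<le> real n ^ 2" using n by (intro ln_fact_le) simp
  ultimately have "(real n ^ 2) powr (- c) \<le> ln (fact n) powr (- c)" using c by (intro powr_mono2') auto
  also have "\<dots> = ln (real (card (carrier (sym_group n)))) powr - c"
    by (simp add: sym_group_card_carrier)
  also have "\<dots> \<le> D_dist (sym_group n) (H n)" using n by (intro lower) auto
  also have "\<dots> < (real n ^ 2) powr (- c)" using n by (intro M) auto
  finally show False by simp
qed

end
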